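(* Let $\mathbf{M}$ be a bicomplete closed symmetric monoidal category, $\overline{\mathbf{C}}=(\mathbf{C},\perp)$ an orthogonal category, $W\subseteq\mathrm{Mor}\,\mathbf{C}$ a subset, $L:\mathbf{C}\to\mathbf{C}[W^{-1}]$ the localization functor and $\overline{\mathbf{C}[W^{-1}]}:=(\mathbf{C}[W^{-1}],L_*(\perp))$. Then the adjunction $$\mathcal{O}_{L\,!}:\mathbf{Alg}_{\mathcal{O}_{\overline{\mathbf{C}}}}(\mathbf{M})\rightleftarrows\mathbf{Alg}_{\mathcal{O}_{\overline{\mathbf{C}[W^{-1}]}}}(\mathbf{M}):\mathcal{O}_L^*$$ induced by the orthogonal functor $L:\overline{\mathbf{C}}\to\overline{\mathbf{C}[W^{-1}]}$ exhibits $\mathbf{Alg}_{\mathcal{O}_{\overline{\mathbf{C}[W^{-1}]}}}(\mathbf{M})$ as a full reflective subcategory of $\mathbf{Alg}_{\mathcal{O}_{\overline{\mathbf{C}}}}(\mathbf{M})$, i.e. the counit $\epsilon:\mathcal{O}_{L\,!}\,\mathcal{O}_L^*\to\mathrm{id}$ is a natural isomorphism.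
   Context: Colored operads are symmetric and $\mathbf{Set}$-valued: a colored operad $\mathcal{O}$ has a set of colors, sets of operations $\mathcal{O}\binom{t}{\underline{c}}$, permutation maps $\mathcal{O}\binom{t}{\underline{c}}\to\mathcal{O}\binom{t}{\underline{c}\sigma}$ with $\underline{c}\sigma=(c_{\sigma(1)},\dots,c_{\sigma(n)})$, compositions $\gamma$ and units, subject to the usual axioms. A morphism consists of a map of color sets and compatible maps of operations. $\mathbf{Op}_{\mathfrak{C}}$ is the category of operads with color set $\mathfrak{C}$ and morphisms that are the identity on colors. Orthogonal category: a pair $\overline{\mathbf{C}}=(\mathbf{C},\perp)$ of a small category $\mathbf{C}$ and a set $\perp$ of pairs $(f_1,f_2)$ of $\mathbf{C}$-morphisms with common target (written $f_1\perp f_2$) that is symmetric and stable under post-composition ($f_1\perp f_2\Rightarrow gf_1\perp gf_2$) and pre-composition ($f_1\perp f_2\Rightarrow f_1h_1\perp f_2h_2$). An orthogonal functor is a functor preserving orthogonal pairs. For a functor $L:\mathbf{C}\to\mathbf{D}$ and an orthogonality relation $\perp$ on $\mathbf{C}$, the pushforward is $L_*(\perp)=\{(g\,L(f_1)\,h_1,\,g\,L(f_2)\,h_2): f_1\perp f_2,\ g,h_1,h_2\in\mathrm{Mor}\,\mathbf{D}\text{ composable}\}$. $\mathbf{C}[W^{-1}]$ is the (strict) localization of $\mathbf{C}$ at $W$. The operad $\mathcal{O}_{\mathbf{C}}$: the colors are the objects $\mathbf{C}_0$; $\mathcal{O}_{\mathbf{C}}\binom{t}{\underline{c}}=\Sigma_n\times\prod_{i=1}^n\mathbf{C}(c_i,t)$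 with elements $(\sigma,\underline{f})$; permutations act by $(\sigma,\underline{f})\mapsto(\sigma\sigma',\underline{f}\sigma')$; composition is $\gamma\big((\sigma,\underline{f}),((\sigma_i,\underline{g}_i))_i\big)=\big(\sigma(\sigma_1,\dots,\sigma_m),(f_1g_{11},\dots,f_1g_{1k_1},\dots,f_mg_{m1},\dots,f_mg_{mk_m})\big)$, where $\sigma(\sigma_1,\dots,\sigma_m)$ is the composition in the associative operad (sum permutation $\sigma_1\oplus\cdots\oplus\sigma_m$ followed by the block permutation moving the $i$-th block to the $\sigma(i)$-th block position); units are $(e,\mathrm{id}_t)$. The operad $\mathcal{O}_{\overline{\mathbf{C}}}$ is the quotient of $\mathcal{O}_{\mathbf{C}}$ (coequalizer in $\mathbf{Op}_{\mathbf{C}_0}$) universally identifying $(e,(f_1,f_2))$ with $(\tau,(f_1,f_2))$ for all $f_1\perp f_2$, with $e,\tau\in\Sigma_2$ the identity and the transposition. An orthogonal functor $F:\overline{\mathbf{C}}\to\overline{\mathbf{D}}$ induces an operad morphism $\mathcal{O}_F:\mathcal{O}_{\overline{\mathbf{C}}}\to\mathcal{O}_{\overline{\mathbf{D}}}$, given by $F$ on colors and $[(\sigma,\underline{f})]\mapsto[(\sigma,F(\underline{f}))]$ on operations. Algebras: an $\mathcal{O}$-algebra $A$ in $\mathbf{M}$ consists of objects $A_t\in\mathbf{M}$ for all colors $t$ and morphisms $\alpha(o):A_{c_1}\otimes\cdots\otimes A_{c_n}\to A_t$ for all $o\in\mathcal{O}\binom{t}{\underline{c}}$, subject to the usual axioms;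 $\mathbf{Alg}_{\mathcal{O}}(\mathbf{M})$ is their category. For an operad morphism $\phi:\mathcal{O}\to\mathcal{P}$, $\phi^*:\mathbf{Alg}_{\mathcal{P}}(\mathbf{M})\to\mathbf{Alg}_{\mathcal{O}}(\mathbf{M})$ is the pullback functor ($\phi^*(B)_t=B_{\phi(t)}$, action $o\mapsto\alpha^B(\phi(o))$); it has a left adjoint $\phi_!$. The category $\mathbf{Alg}_{\mathcal{O}_{\overline{\mathbf{C}}}}(\mathbf{M})$ is identified with the category of functors $\mathfrak{A}$ from $\mathbf{C}$ to monoids in $\mathbf{M}$ such that $\mu_c(\mathfrak{A}(f_1)\otimes\mathfrak{A}(f_2))=\mu_c^{\mathrm{op}}(\mathfrak{A}(f_1)\otimes\mathfrak{A}(f_2))$ for all $f_1\perp f_2$ with target $c$; under this identification $\mathcal{O}_F^*$ is precomposition with $F$. *)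

theory Defs
  imports "HOL-Combinatorics.Combinatorics" "HOL-Library.FuncSet"
begin

section \<open>Categories, functors, adjunctions\<close>

record ('o, 'a) cat =
  Obj :: "'o set"
  Arr :: "'a set"
  Dom :: "'a \<Rightarrow> 'o"
  Cod :: "'a \<Rightarrow> 'o"
  Id :: "'o \<Rightarrow> 'a"
  Comp :: "'a \<Rightarrow> 'a \<Rightarrow> 'a"  (infixl \<open>\<cdot>\<index>\<close> 70)

definition hom :: "('o, 'a, 'z) cat_scheme \<Rightarrow> 'o \<Rightarrow> 'o \<Rightarrow> 'a set" where
  "hom C a b = {f \<in> Arr C. Dom C f = a \<and> Cod C f = b}"

locale category =
  fixes C :: "('o, 'a, 'z) cat_scheme" (structure)
  assumes Dom_in: "f \<in> Arr C \<Longrightarrow> Dom C f \<in> Obj C"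
    and Cod_in: "f \<in> Arr C \<Longrightarrow> Cod C f \<in> Obj C"
    and Id_in: "a \<in> Obj C \<Longrightarrow> Id C a \<in> hom C a a"
    and Comp_in: "f \<in> hom C a b \<Longrightarrow> g \<in> hom C b c \<Longrightarrow> g \<cdot> f \<in> hom C a c"
    and Comp_Id: "f \<in> hom C a b \<Longrightarrow> f \<cdot> Id C a = f"
    and Id_Comp: "f \<in> hom C a b \<Longrightarrow> Id C b \<cdot> f = f"
    and Comp_assoc: "f \<in> hom C a b \<Longrightarrow> g \<in> hom C b c \<Longrightarrow> h \<in> hom C c d \<Longrightarrow>
      (h \<cdot> g) \<cdot> f = h \<cdot> (g \<cdot> f)"

definition is_inverse :: "('o, 'a, 'z) cat_scheme \<Rightarrow> 'a \<Rightarrow> 'a \<Rightarrow> bool" where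
  "is_inverse C f g \<longleftrightarrow> f \<in> Arr C \<and> g \<in> hom C (Cod C f) (Dom C f) \<and>
     Comp C g f = Id C (Dom C f) \<and> Comp C f g = Id C (Cod C f)"

definition is_iso :: "('o, 'a, 'z) cat_scheme \<Rightarrow> 'a \<Rightarrow> bool" where
  "is_iso C f \<longleftrightarrow> (\<exists>g. is_inverse C f g)"

definition inverse_arr :: "('o, 'a, 'z) cat_scheme \<Rightarrow> 'a \<Rightarrow> 'a" where
  "inverse_arr C f = (THE g. is_inverse C f g)"

record ('o, 'a, 'p, 'b) fctr =
  FO :: "'o \<Rightarrow> 'p"
  FA :: "'a \<Rightarrow> 'b"

definition is_functor ::
  "('o, 'a, 'y) cat_scheme \<Rightarrow> ('p, 'b, 'z) cat_scheme \<Rightarrow> ('o, 'a, 'p, 'b) fctr \<Rightarrow> bool" where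
  "is_functor C D F \<longleftrightarrow>
     (\<forall>a\<in>Obj C. FO F a \<in> Obj D) \<and>
     (\<forall>f\<in>Arr C. FA F f \<in> hom D (FO F (Dom C f)) (FO F (Cod C f))) \<and>
     (\<forall>a\<in>Obj C. FA F (Id C a) = Id D (FO F a)) \<and>
     (\<forall>f\<in>Arr C. \<forall>g\<in>Arr C. Cod C f = Dom C g \<longrightarrow>
        FA F (Comp C g f) = Comp D (FA F g) (FA F f))"

definition id_functor :: "('o, 'a, 'o, 'a) fctr" where
  "id_functor = \<lparr>FO = (\<lambda>a. a), FA = (\<lambda>f. f)\<rparr>"

definition comp_functor ::
  "('p, 'b, 'q, 'c) fctr \<Rightarrow> ('o, 'a, 'p, 'b) fctr \<Rightarrow> ('o, 'a, 'q, 'c) fctr"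
  (infixl \<open>\<circ>\<^sub>F\<close> 55) where
  "G \<circ>\<^sub>F F = \<lparr>FO = FO G \<circ> FO F, FA = FA G \<circ> FA F\<rparr>"

text \<open>The maps of a functor are total HOL functions; only their values on the carrier of the
  domain category are meaningful, so equality of functors is tested there.\<close>

definition functor_eq ::
  "('o, 'a, 'z) cat_scheme \<Rightarrow> ('o, 'a, 'p, 'b) fctr \<Rightarrow> ('o, 'a, 'p, 'b) fctr \<Rightarrow> bool" where
  "functor_eq C F G \<longleftrightarrow> (\<forall>a\<in>Obj C. FO F a = FO G a) \<and> (\<forall>f\<in>Arr C. FA F f = FA G f)"

definition natural_transformation ::
  "('o, 'a, 'y) cat_scheme \<Rightarrow> ('p, 'b, 'z) cat_scheme \<Rightarrow> ('o, 'a, 'p, 'b) fctr \<Rightarrow>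
   ('o, 'a, 'p, 'b) fctr \<Rightarrow> ('o \<Rightarrow> 'b) \<Rightarrow> bool" where
  "natural_transformation C D F G \<tau> \<longleftrightarrow>
     (\<forall>a\<in>Obj C. \<tau> a \<in> hom D (FO F a) (FO G a)) \<and>
     (\<forall>f\<in>Arr C. Comp D (\<tau> (Cod C f)) (FA F f) = Comp D (FA G f) (\<tau> (Dom C f)))"

definition natural_isomorphism ::
  "('o, 'a, 'y) cat_scheme \<Rightarrow> ('p, 'b, 'z) cat_scheme \<Rightarrow> ('o, 'a, 'p, 'b) fctr \<Rightarrow>
   ('o, 'a, 'p, 'b) fctr \<Rightarrow> ('o \<Rightarrow> 'b) \<Rightarrow> bool" where
  "natural_isomorphism C D F G \<tau> \<longleftrightarrow>
     natural_transformation C D F G \<tau> \<and> (\<forall>a\<in>Obj C. is_iso D (\<tau> a))"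

definition adjunction ::
  "('o, 'a, 'y) cat_scheme \<Rightarrow> ('p, 'b, 'z) cat_scheme \<Rightarrow> ('o, 'a, 'p, 'b) fctr \<Rightarrow>
   ('p, 'b, 'o, 'a) fctr \<Rightarrow> ('o \<Rightarrow> 'a) \<Rightarrow> ('p \<Rightarrow> 'b) \<Rightarrow> bool" where
  "adjunction A B F G \<eta> \<epsilon> \<longleftrightarrow>
     is_functor A B F \<and> is_functor B A G \<and>
     natural_transformation A A id_functor (G \<circ>\<^sub>F F) \<eta> \<and>
     natural_transformation B B (F \<circ>\<^sub>F G) id_functor \<epsilon> \<and>
     (\<forall>x\<in>Obj A. Comp B (\<epsilon> (FO F x)) (FA F (\<eta> x)) = Id B (FO F x)) \<and>
     (\<forall>y\<in>Obj B. Comp A (FA G (\<epsilon> y)) (\<eta> (FO G y)) = Id A (FO G y))"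


section \<open>Limits and colimits\<close>

definition is_cone ::
  "('i, 'j, 'y) cat_scheme \<Rightarrow> ('o, 'a, 'z) cat_scheme \<Rightarrow> ('i, 'j, 'o, 'a) fctr \<Rightarrow> 'o \<Rightarrow>
   ('i \<Rightarrow> 'a) \<Rightarrow> bool" where
  "is_cone J M F x p \<longleftrightarrow> x \<in> Obj M \<and> (\<forall>i\<in>Obj J. p i \<in> hom M x (FO F i)) \<and>
     (\<forall>f\<in>Arr J. Comp M (FA F f) (p (Dom J f)) = p (Cod J f))"

definition is_limit ::
  "('i, 'j, 'y) cat_scheme \<Rightarrow> ('o, 'a, 'z) cat_scheme \<Rightarrow> ('i, 'j, 'o, 'a) fctr \<Rightarrow> 'o \<Rightarrow>
   ('i \<Rightarrow> 'a) \<Rightarrow> bool" where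
  "is_limit J M F x p \<longleftrightarrow> is_cone J M F x p \<and>
     (\<forall>y q. is_cone J M F y q \<longrightarrow> (\<exists>!u. u \<in> hom M y x \<and> (\<forall>i\<in>Obj J. Comp M (p i) u = q i)))"

definition is_cocone ::
  "('i, 'j, 'y) cat_scheme \<Rightarrow> ('o, 'a, 'z) cat_scheme \<Rightarrow> ('i, 'j, 'o, 'a) fctr \<Rightarrow> 'o \<Rightarrow>
   ('i \<Rightarrow> 'a) \<Rightarrow> bool" where
  "is_cocone J M F x p \<longleftrightarrow> x \<in> Obj M \<and> (\<forall>i\<in>Obj J. p i \<in> hom M (FO F i) x) \<and>
     (\<forall>f\<in>Arr J. Comp M (p (Cod J f)) (FA F f) = p (Dom J f))"

definition is_colimit ::
  "('i, 'j, 'y) cat_scheme \<Rightarrow> ('o, 'a, 'z) cat_scheme \<Rightarrow> ('i, 'j, 'o, 'a) fctr \<Rightarrow> 'o \<Rightarrow>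
   ('i \<Rightarrow> 'a) \<Rightarrow> bool" where
  "is_colimit J M F x p \<longleftrightarrow> is_cocone J M F x p \<and>
     (\<forall>y q. is_cocone J M F y q \<longrightarrow> (\<exists>!u. u \<in> hom M x y \<and> (\<forall>i\<in>Obj J. Comp M u (p i) = q i)))"

text \<open>Smallness is relative to a type \<open>'u\<close> (to be taken infinite): a small category is one whose
  objects and arrows are elements of \<open>'u\<close>, i.e. a value of type \<open>('u, 'u) cat\<close>. The large
  category \<open>M\<close> lives on unrelated types.\<close>

definition bicomplete :: "'u itself \<Rightarrow> ('o, 'a, 'z) cat_scheme \<Rightarrow> bool" where
  "bicomplete _ M \<longleftrightarrow>
     (\<forall>(J :: ('u, 'u) cat) F. category J \<and> is_functor J M F \<longrightarrow>
        (\<exists>x p. is_limit J M F x p) \<and> (\<exists>x p. is_colimit J M F x p))"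


section \<open>Closed symmetric monoidal categories\<close>

record ('o, 'm) moncat = "('o, 'm) cat" +
  TO :: "'o \<Rightarrow> 'o \<Rightarrow> 'o"  (infixr \<open>\<otimes>\<index>\<close> 75)
  TA :: "'m \<Rightarrow> 'm \<Rightarrow> 'm"  (infixr \<open>\<boxtimes>\<index>\<close> 75)
  Unit :: 'o
  Assoc :: "'o \<Rightarrow> 'o \<Rightarrow> 'o \<Rightarrow> 'm"
  LUnit :: "'o \<Rightarrow> 'm"
  RUnit :: "'o \<Rightarrow> 'm"
  Braid :: "'o \<Rightarrow> 'o \<Rightarrow> 'm"

locale symmetric_monoidal_category = category M
  for M :: "('o, 'm, 'z) moncat_scheme" (structure) +
  assumes Unit_in: "Unit M \<in> Obj M"
    and TO_in: "x \<in> Obj M \<Longrightarrow> y \<in> Obj M \<Longrightarrow> x \<otimes> y \<in> Obj M"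
    and TA_in: "f \<in> hom M a b \<Longrightarrow> g \<in> hom M c d \<Longrightarrow> f \<boxtimes> g \<in> hom M (a \<otimes> c) (b \<otimes> d)"
    and TA_Id: "x \<in> Obj M \<Longrightarrow> y \<in> Obj M \<Longrightarrow> Id M x \<boxtimes> Id M y = Id M (x \<otimes> y)"
    and TA_Comp: "f \<in> hom M a b \<Longrightarrow> f' \<in> hom M b c \<Longrightarrow> g \<in> hom M a' b' \<Longrightarrow> g' \<in> hom M b' c' \<Longrightarrow>
      (f' \<cdot> f) \<boxtimes> (g' \<cdot> g) = (f' \<boxtimes> g') \<cdot> (f \<boxtimes> g)"
    and Assoc_in: "x \<in> Obj M \<Longrightarrow> y \<in> Obj M \<Longrightarrow> z \<in> Obj M \<Longrightarrow>
      Assoc M x y z \<in> hom M ((x \<otimes> y) \<otimes> z) (x \<otimes> (y \<otimes> z))"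
    and Assoc_iso: "x \<in> Obj M \<Longrightarrow> y \<in> Obj M \<Longrightarrow> z \<in> Obj M \<Longrightarrow> is_iso M (Assoc M x y z)"
    and Assoc_natural: "f \<in> hom M x x' \<Longrightarrow> g \<in> hom M y y' \<Longrightarrow> h \<in> hom M z z' \<Longrightarrow>
      Assoc M x' y' z' \<cdot> ((f \<boxtimes> g) \<boxtimes> h) = (f \<boxtimes> (g \<boxtimes> h)) \<cdot> Assoc M x y z"
    and LUnit_in: "x \<in> Obj M \<Longrightarrow> LUnit M x \<in> hom M (Unit M \<otimes> x) x"
    and LUnit_iso: "x \<in> Obj M \<Longrightarrow> is_iso M (LUnit M x)"
    and LUnit_natural: "f \<in> hom M x y \<Longrightarrow> LUnit M y \<cdot> (Id M (Unit M) \<boxtimes> f) = f \<cdot> LUnit M x"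
    and RUnit_in: "x \<in> Obj M \<Longrightarrow> RUnit M x \<in> hom M (x \<otimes> Unit M) x"
    and RUnit_iso: "x \<in> Obj M \<Longrightarrow> is_iso M (RUnit M x)"
    and RUnit_natural: "f \<in> hom M x y \<Longrightarrow> RUnit M y \<cdot> (f \<boxtimes> Id M (Unit M)) = f \<cdot> RUnit M x"
    and Braid_in: "x \<in> Obj M \<Longrightarrow> y \<in> Obj M \<Longrightarrow> Braid M x y \<in> hom M (x \<otimes> y) (y \<otimes> x)"
    and Braid_natural: "f \<in> hom M x x' \<Longrightarrow> g \<in> hom M y y' \<Longrightarrow>
      Braid M x' y' \<cdot> (f \<boxtimes> g) = (g \<boxtimes> f) \<cdot> Braid M x y"
    and pentagon: "w \<in> Obj M \<Longrightarrow> x \<in> Obj M \<Longrightarrow> y \<in> Obj M \<Longrightarrow> z \<in> Obj M \<Longrightarrow>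
      Assoc M w x (y \<otimes> z) \<cdot> Assoc M (w \<otimes> x) y z =
      (Id M w \<boxtimes> Assoc M x y z) \<cdot> Assoc M w (x \<otimes> y) z \<cdot> (Assoc M w x y \<boxtimes> Id M z)"
    and triangle: "x \<in> Obj M \<Longrightarrow> y \<in> Obj M \<Longrightarrow>
      (Id M x \<boxtimes> LUnit M y) \<cdot> Assoc M x (Unit M) y = RUnit M x \<boxtimes> Id M y"
    and hexagon: "x \<in> Obj M \<Longrightarrow> y \<in> Obj M \<Longrightarrow> z \<in> Obj M \<Longrightarrow>
      Assoc M y z x \<cdot> Braid M x (y \<otimes> z) \<cdot> Assoc M x y z =
      (Id M y \<boxtimes> Braid M x z) \<cdot> Assoc M y x z \<cdot> (Braid M x y \<boxtimes> Id M z)"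
    and symmetry: "x \<in> Obj M \<Longrightarrow> y \<in> Obj M \<Longrightarrow> Braid M y x \<cdot> Braid M x y = Id M (x \<otimes> y)"

locale closed_symmetric_monoidal_category = symmetric_monoidal_category M
  for M :: "('o, 'm, 'z) moncat_scheme" (structure) +
  assumes closed: "y \<in> Obj M \<Longrightarrow> z \<in> Obj M \<Longrightarrow>
    \<exists>h\<in>Obj M. \<exists>ev\<in>hom M (h \<otimes> y) z. \<forall>x\<in>Obj M. \<forall>f\<in>hom M (x \<otimes> y) z.
      \<exists>!g. g \<in> hom M x h \<and> ev \<cdot> (g \<boxtimes> Id M y) = f"

text \<open>Iterated tensor products are bracketed to the right and end with the unit:
  \<open>x\<^sub>1 \<otimes> (x\<^sub>2 \<otimes> (\<dots> \<otimes> (x\<^sub>n \<otimes> I)))\<close>.\<close>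

primrec tens :: "('o, 'm, 'z) moncat_scheme \<Rightarrow> 'o list \<Rightarrow> 'o" where
  "tens M [] = Unit M"
| "tens M (x # xs) = TO M x (tens M xs)"

primrec tens_arr :: "('o, 'm, 'z) moncat_scheme \<Rightarrow> 'm list \<Rightarrow> 'm" where
  "tens_arr M [] = Id M (Unit M)"
| "tens_arr M (f # fs) = TA M f (tens_arr M fs)"

text \<open>The coherence isomorphism \<open>tens (xs @ ys) \<rightarrow> tens xs \<otimes> tens ys\<close>.\<close>

primrec append_iso :: "('o, 'm, 'z) moncat_scheme \<Rightarrow> 'o list \<Rightarrow> 'o list \<Rightarrow> 'm" where
  "append_iso M [] ys = inverse_arr M (LUnit M (tens M ys))"
| "append_iso M (x # xs) ys =
     Comp M (inverse_arr M (Assoc M x (tens M xs) (tens M ys)))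
            (TA M (Id M x) (append_iso M xs ys))"

text \<open>The coherence isomorphism \<open>tens (concat xss) \<rightarrow> tens (map tens xss)\<close>.\<close>

primrec concat_iso :: "('o, 'm, 'z) moncat_scheme \<Rightarrow> 'o list list \<Rightarrow> 'm" where
  "concat_iso M [] = Id M (Unit M)"
| "concat_iso M (xs # xss) =
     Comp M (TA M (Id M (tens M xs)) (concat_iso M xss)) (append_iso M xs (concat xss))"

definition delete_nth :: "nat \<Rightarrow> 'x list \<Rightarrow> 'x list" where
  "delete_nth k xs = take k xs @ drop (Suc k) xs"

text \<open>The symmetry isomorphism \<open>x\<^sub>k \<otimes> tens (delete_nth k xs) \<rightarrow> tens xs\<close> moving the leftmost
  factor into position \<open>k\<close>.\<close>

fun insert_iso :: "('o, 'm, 'z) moncat_scheme \<Rightarrow> nat \<Rightarrow> 'o list \<Rightarrow> 'm" where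
  "insert_iso M 0 xs = Id M (tens M xs)"
| "insert_iso M (Suc k) [] = Id M (Unit M)"
| "insert_iso M (Suc k) (x # xs) =
     (let y = xs ! k; r = tens M (delete_nth k xs) in
      Comp M (TA M (Id M x) (insert_iso M k xs))
       (Comp M (Assoc M x y r)
         (Comp M (TA M (Braid M y x) (Id M r))
           (inverse_arr M (Assoc M y x r)))))"

text \<open>For a permutation \<open>\<sigma>\<close> of \<open>{..<Suc n}\<close>, \<open>delete_perm \<sigma>\<close> is the permutation of \<open>{..<n}\<close>
  obtained by deleting \<open>0\<close> from the domain and \<open>\<sigma> 0\<close> from the codomain and renumbering.\<close>

definition delete_perm :: "(nat \<Rightarrow> nat) \<Rightarrow> nat \<Rightarrow> nat" where
  "delete_perm \<sigma> i = (if \<sigma> (Suc i) < \<sigma> 0 then \<sigma> (Suc i) else \<sigma> (Suc i) - 1)"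

text \<open>The symmetry isomorphism
  \<open>x\<^bsub>\<sigma>(1)\<^esub> \<otimes> \<dots> \<otimes> x\<^bsub>\<sigma>(n)\<^esub> \<rightarrow> x\<^sub>1 \<otimes> \<dots> \<otimes> x\<^sub>n\<close>, i.e. \<open>tens (permute_list \<sigma> xs) \<rightarrow> tens xs\<close>,
  for \<open>n = length xs\<close>: the first factor is moved to position \<open>\<sigma> 0\<close>, after the others have been
  permuted among themselves.\<close>

primrec perm_iso :: "('o, 'm, 'z) moncat_scheme \<Rightarrow> nat \<Rightarrow> (nat \<Rightarrow> nat) \<Rightarrow> 'o list \<Rightarrow> 'm" where
  "perm_iso M 0 \<sigma> xs = Id M (Unit M)"
| "perm_iso M (Suc n) \<sigma> xs =
     Comp M (insert_iso M (\<sigma> 0) xs)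
       (TA M (Id M (xs ! \<sigma> 0)) (perm_iso M n (delete_perm \<sigma>) (delete_nth (\<sigma> 0) xs)))"


section \<open>Permutations of blocks\<close>

text \<open>Permutations in \<open>\<Sigma>\<^sub>n\<close> are functions with \<open>\<sigma> permutes {..<n}\<close>, with product \<open>\<sigma> \<circ> \<sigma>'\<close>;
  \<open>permute_list \<sigma> cs\<close> is \<open>(c\<^bsub>\<sigma>(1)\<^esub>, \<dots>, c\<^bsub>\<sigma>(n)\<^esub>)\<close>. A list \<open>ks\<close> of lengths divides
  \<open>{..<sum_list ks}\<close> into consecutive blocks; \<open>block_pos ks i j\<close> is the position of the \<open>j\<close>-th
  element of the \<open>i\<close>-th block and \<open>locate ks\<close> recovers \<open>(i, j)\<close> from it.\<close>

definition block_pos :: "nat list \<Rightarrow> nat \<Rightarrow> nat \<Rightarrow> nat" where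
  "block_pos ks i j = sum_list (take i ks) + j"

fun locate :: "nat list \<Rightarrow> nat \<Rightarrow> nat \<times> nat" where
  "locate [] p = (0, p)"
| "locate (k # ks) p = (if p < k then (0, p) else (case locate ks (p - k) of (i, j) \<Rightarrow> (Suc i, j)))"

definition sum_perm :: "nat list \<Rightarrow> (nat \<Rightarrow> nat) list \<Rightarrow> nat \<Rightarrow> nat" where
  "sum_perm ks \<tau>s p =
     (if p < sum_list ks then (case locate ks p of (i, j) \<Rightarrow> block_pos ks i ((\<tau>s ! i) j)) else p)"

text \<open>\<open>\<sigma>\<langle>k\<^sub>1, \<dots>, k\<^sub>m\<rangle>\<close>: the \<open>i\<close>-th block, of length \<open>k\<^sub>i\<close>, is moved to the \<open>\<sigma> i\<close>-th block position.
  The \<open>a\<close>-th block of the target has length \<open>k\<^bsub>\<sigma>\<inverse>(a)\<^esub>\<close>.\<close>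

definition block_perm :: "nat list \<Rightarrow> (nat \<Rightarrow> nat) \<Rightarrow> nat \<Rightarrow> nat" where
  "block_perm ks \<sigma> p =
     (if p < sum_list ks
      then (case locate ks p of (i, j) \<Rightarrow> block_pos (permute_list (inv \<sigma>) ks) (\<sigma> i) j) else p)"

text \<open>The composition \<open>\<sigma>(\<tau>\<^sub>1, \<dots>, \<tau>\<^sub>m)\<close> of the associative operad.\<close>

definition assoc_comp :: "nat list \<Rightarrow> (nat \<Rightarrow> nat) \<Rightarrow> (nat \<Rightarrow> nat) list \<Rightarrow> nat \<Rightarrow> nat" where
  "assoc_comp ks \<sigma> \<tau>s = block_perm ks \<sigma> \<circ> sum_perm ks \<tau>s"


section \<open>Colored operads\<close>

text \<open>\<open>Ops P t cs\<close> is the set of operations with output color \<open>t\<close> and input colors \<open>cs\<close>. The sets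
  for different profiles need not be disjoint, so the structure maps carry the profile as
  arguments: \<open>Act P t cs \<sigma> : Ops P t cs \<rightarrow> Ops P t (permute_list \<sigma> cs)\<close> and
  \<open>Gam P t ds css : Ops P t ds \<times> (\<Prod>i. Ops P (ds ! i) (css ! i)) \<rightarrow> Ops P t (concat css)\<close>.\<close>

record ('c, 'x) operad =
  Col :: "'c set"
  Ops :: "'c \<Rightarrow> 'c list \<Rightarrow> 'x set"
  Act :: "'c \<Rightarrow> 'c list \<Rightarrow> (nat \<Rightarrow> nat) \<Rightarrow> 'x \<Rightarrow> 'x"
  Gam :: "'c \<Rightarrow> 'c list \<Rightarrow> 'c list list \<Rightarrow> 'x \<Rightarrow> 'x list \<Rightarrow> 'x"
  One :: "'c \<Rightarrow> 'x"

definition composable ::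
  "('c, 'x, 'z) operad_scheme \<Rightarrow> 'c \<Rightarrow> 'c list \<Rightarrow> 'c list list \<Rightarrow> 'x \<Rightarrow> 'x list \<Rightarrow> bool" where
  "composable P t ds css x ys \<longleftrightarrow>
     x \<in> Ops P t ds \<and> length css = length ds \<and> length ys = length ds \<and>
     (\<forall>i<length ds. ys ! i \<in> Ops P (ds ! i) (css ! i))"

locale colored_operad =
  fixes P :: "('c, 'x, 'z) operad_scheme"
  assumes Ops_col: "x \<in> Ops P t cs \<Longrightarrow> t \<in> Col P \<and> set cs \<subseteq> Col P"
    and Act_in: "x \<in> Ops P t cs \<Longrightarrow> \<sigma> permutes {..<length cs} \<Longrightarrow>
      Act P t cs \<sigma> x \<in> Ops P t (permute_list \<sigma> cs)"
    and Gam_in: "composable P t ds css x ys \<Longrightarrow> Gam P t ds css x ys \<in> Ops P t (concat css)"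
    and One_in: "t \<in> Col P \<Longrightarrow> One P t \<in> Ops P t [t]"
    and Act_id: "x \<in> Ops P t cs \<Longrightarrow> Act P t cs id x = x"
    and Act_Act: "x \<in> Ops P t cs \<Longrightarrow> \<sigma> permutes {..<length cs} \<Longrightarrow> \<tau> permutes {..<length cs} \<Longrightarrow>
      Act P t (permute_list \<sigma> cs) \<tau> (Act P t cs \<sigma> x) = Act P t cs (\<sigma> \<circ> \<tau>) x"
    and Gam_One_left: "x \<in> Ops P t cs \<Longrightarrow> Gam P t [t] [cs] (One P t) [x] = x"
    and Gam_One_right: "x \<in> Ops P t cs \<Longrightarrow>
      Gam P t cs (map (\<lambda>c. [c]) cs) x (map (One P) cs) = x"
    and Gam_Gam: "composable P t ds css x ys \<Longrightarrow>
      length bsss = length ds \<Longrightarrow> length zss = length ds \<Longrightarrow>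
      (\<And>i. i < length ds \<Longrightarrow> composable P (ds ! i) (css ! i) (bsss ! i) (ys ! i) (zss ! i)) \<Longrightarrow>
      Gam P t (concat css) (concat bsss) (Gam P t ds css x ys) (concat zss) =
      Gam P t ds (map concat bsss) x
        (map (\<lambda>i. Gam P (ds ! i) (css ! i) (bsss ! i) (ys ! i) (zss ! i)) [0..<length ds])"
    and Gam_Act_left: "composable P t ds css x ys \<Longrightarrow> \<sigma> permutes {..<length ds} \<Longrightarrow>
      Gam P t (permute_list \<sigma> ds) (permute_list \<sigma> css) (Act P t ds \<sigma> x) (permute_list \<sigma> ys) =
      Act P t (concat css) (block_perm (permute_list \<sigma> (map length css)) \<sigma>) (Gam P t ds css x ys)"
    and Gam_Act_right: "composable P t ds css x ys \<Longrightarrow> length \<tau>s = length ds \<Longrightarrow>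
      (\<And>i. i < length ds \<Longrightarrow> \<tau>s ! i permutes {..<length (css ! i)}) \<Longrightarrow>
      Gam P t ds (map2 permute_list \<tau>s css) x
        (map (\<lambda>i. Act P (ds ! i) (css ! i) (\<tau>s ! i) (ys ! i)) [0..<length ds]) =
      Act P t (concat css) (sum_perm (map length css) \<tau>s) (Gam P t ds css x ys)"

record ('c, 'x, 'd, 'y) operad_map =
  MC :: "'c \<Rightarrow> 'd"
  MO :: "'c \<Rightarrow> 'c list \<Rightarrow> 'x \<Rightarrow> 'y"

definition operad_morphism ::
  "('c, 'x, 'w) operad_scheme \<Rightarrow> ('d, 'y, 'z) operad_scheme \<Rightarrow> ('c, 'x, 'd, 'y) operad_map \<Rightarrow> bool" where
  "operad_morphism P Q \<phi> \<longleftrightarrow>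
     (\<forall>c\<in>Col P. MC \<phi> c \<in> Col Q) \<and>
     (\<forall>t cs. \<forall>x\<in>Ops P t cs. MO \<phi> t cs x \<in> Ops Q (MC \<phi> t) (map (MC \<phi>) cs)) \<and>
     (\<forall>t cs \<sigma>. \<forall>x\<in>Ops P t cs. \<sigma> permutes {..<length cs} \<longrightarrow>
        MO \<phi> t (permute_list \<sigma> cs) (Act P t cs \<sigma> x) =
        Act Q (MC \<phi> t) (map (MC \<phi>) cs) \<sigma> (MO \<phi> t cs x)) \<and>
     (\<forall>t ds css x ys. composable P t ds css x ys \<longrightarrow>
        MO \<phi> t (concat css) (Gam P t ds css x ys) =
        Gam Q (MC \<phi> t) (map (MC \<phi>) ds) (map (map (MC \<phi>)) css) (MO \<phi> t ds x)
          (map (\<lambda>i. MO \<phi> (ds ! i) (css ! i) (ys ! i)) [0..<length ds])) \<and>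
     (\<forall>t\<in>Col P. MO \<phi> t [t] (One P t) = One Q (MC \<phi> t))"

text \<open>The quotient of an operad, with colors fixed, universally identifying \<open>x\<close> and \<open>y\<close> whenever
  \<open>R t cs x y\<close>: divide by the smallest equivalence relation which contains \<open>R\<close> and is
  compatible with permutations and compositions.\<close>

inductive operad_cong ::
  "('c, 'x, 'z) operad_scheme \<Rightarrow> ('c \<Rightarrow> 'c list \<Rightarrow> 'x \<Rightarrow> 'x \<Rightarrow> bool) \<Rightarrow>
   'c \<Rightarrow> 'c list \<Rightarrow> 'x \<Rightarrow> 'x \<Rightarrow> bool"
  for P :: "('c, 'x, 'z) operad_scheme" and R :: "'c \<Rightarrow> 'c list \<Rightarrow> 'x \<Rightarrow> 'x \<Rightarrow> bool" where
  base: "R t cs x y \<Longrightarrow> x \<in> Ops P t cs \<Longrightarrow> y \<in> Ops P t cs \<Longrightarrow> operad_cong P R t cs x y"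
| refl: "x \<in> Ops P t cs \<Longrightarrow> operad_cong P R t cs x x"
| sym: "operad_cong P R t cs x y \<Longrightarrow> operad_cong P R t cs y x"
| trans: "operad_cong P R t cs x y \<Longrightarrow> operad_cong P R t cs y z \<Longrightarrow> operad_cong P R t cs x z"
| act: "operad_cong P R t cs x y \<Longrightarrow> \<sigma> permutes {..<length cs} \<Longrightarrow>
    operad_cong P R t (permute_list \<sigma> cs) (Act P t cs \<sigma> x) (Act P t cs \<sigma> y)"
| gam: "operad_cong P R t ds x x' \<Longrightarrow>
    length css = length ds \<Longrightarrow> length ys = length ds \<Longrightarrow> length ys' = length ds \<Longrightarrow>
    (\<And>i. i < length ds \<Longrightarrow> operad_cong P R (ds ! i) (css ! i) (ys ! i) (ys' ! i)) \<Longrightarrow>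
    operad_cong P R t (concat css) (Gam P t ds css x ys) (Gam P t ds css x' ys')"

definition cong_class ::
  "('c, 'x, 'z) operad_scheme \<Rightarrow> ('c \<Rightarrow> 'c list \<Rightarrow> 'x \<Rightarrow> 'x \<Rightarrow> bool) \<Rightarrow>
   'c \<Rightarrow> 'c list \<Rightarrow> 'x \<Rightarrow> 'x set" where
  "cong_class P R t cs x = {y. operad_cong P R t cs x y}"

definition quotient_operad ::
  "('c, 'x, 'z) operad_scheme \<Rightarrow> ('c \<Rightarrow> 'c list \<Rightarrow> 'x \<Rightarrow> 'x \<Rightarrow> bool) \<Rightarrow> ('c, 'x set) operad" where
  "quotient_operad P R =
     \<lparr>Col = Col P,
      Ops = (\<lambda>t cs. cong_class P R t cs ` Ops P t cs),
      Act = (\<lambda>t cs \<sigma> X. \<Union>x\<in>X. cong_class P R t (permute_list \<sigma> cs) (Act P t cs \<sigma> x)),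
      Gam = (\<lambda>t ds css X Ys. \<Union>x\<in>X. \<Union>ys\<in>{ys. list_all2 (\<in>) ys Ys}.
               cong_class P R t (concat css) (Gam P t ds css x ys)),
      One = (\<lambda>t. cong_class P R t [t] (One P t))\<rparr>"


section \<open>Orthogonal categories and their operads\<close>

locale orthogonal_category = category C
  for C :: "('o, 'a, 'z) cat_scheme" (structure) and orth :: "('a \<times> 'a) set" +
  assumes orth_arr: "(f1, f2) \<in> orth \<Longrightarrow> f1 \<in> Arr C \<and> f2 \<in> Arr C \<and> Cod C f1 = Cod C f2"
    and orth_sym: "(f1, f2) \<in> orth \<Longrightarrow> (f2, f1) \<in> orth"
    and orth_post: "(f1, f2) \<in> orth \<Longrightarrow> g \<in> Arr C \<Longrightarrow> Dom C g = Cod C f1 \<Longrightarrow>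
      (g \<cdot> f1, g \<cdot> f2) \<in> orth"
    and orth_pre: "(f1, f2) \<in> orth \<Longrightarrow> h1 \<in> Arr C \<Longrightarrow> h2 \<in> Arr C \<Longrightarrow>
      Cod C h1 = Dom C f1 \<Longrightarrow> Cod C h2 = Dom C f2 \<Longrightarrow> (f1 \<cdot> h1, f2 \<cdot> h2) \<in> orth"

definition orthogonal_functor ::
  "('o, 'a, 'y) cat_scheme \<Rightarrow> ('a \<times> 'a) set \<Rightarrow> ('p, 'b, 'z) cat_scheme \<Rightarrow> ('b \<times> 'b) set \<Rightarrow>
   ('o, 'a, 'p, 'b) fctr \<Rightarrow> bool" where
  "orthogonal_functor C orth D orth' F \<longleftrightarrow>
     is_functor C D F \<and> (\<forall>(f1, f2)\<in>orth. (FA F f1, FA F f2) \<in> orth')"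

definition pushforward_orth ::
  "('p, 'b, 'z) cat_scheme \<Rightarrow> ('o, 'a, 'p, 'b) fctr \<Rightarrow> ('a \<times> 'a) set \<Rightarrow> ('b \<times> 'b) set" where
  "pushforward_orth D F orth =
     {(Comp D (Comp D g (FA F f1)) h1, Comp D (Comp D g (FA F f2)) h2) | g f1 f2 h1 h2.
        (f1, f2) \<in> orth \<and> g \<in> Arr D \<and> h1 \<in> Arr D \<and> h2 \<in> Arr D \<and>
        Dom D g = Cod D (FA F f1) \<and> Dom D g = Cod D (FA F f2) \<and>
        Cod D h1 = Dom D (FA F f1) \<and> Cod D h2 = Dom D (FA F f2)}"

definition cat_operad ::
  "('o, 'a, 'z) cat_scheme \<Rightarrow> ('o, (nat \<Rightarrow> nat) \<times> 'a list) operad" where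
  "cat_operad C =
     \<lparr>Col = Obj C,
      Ops = (\<lambda>t cs. {(\<sigma>, fs). t \<in> Obj C \<and> set cs \<subseteq> Obj C \<and> \<sigma> permutes {..<length cs} \<and>
               length fs = length cs \<and> (\<forall>i<length cs. fs ! i \<in> hom C (cs ! i) t)}),
      Act = (\<lambda>t cs \<sigma>' (\<sigma>, fs). (\<sigma> \<circ> \<sigma>', permute_list \<sigma>' fs)),
      Gam = (\<lambda>t ds css (\<sigma>, fs) ys.
               (assoc_comp (map length css) \<sigma> (map fst ys),
                concat (map2 (\<lambda>f y. map (Comp C f) (snd y)) fs ys))),
      One = (\<lambda>t. (id, [Id C t]))\<rparr>"

definition orth_rel ::
  "('o, 'a, 'z) cat_scheme \<Rightarrow> ('a \<times> 'a) set \<Rightarrow>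
   'o \<Rightarrow> 'o list \<Rightarrow> (nat \<Rightarrow> nat) \<times> 'a list \<Rightarrow> (nat \<Rightarrow> nat) \<times> 'a list \<Rightarrow> bool" where
  "orth_rel C orth t cs x y \<longleftrightarrow>
     (\<exists>f1 f2. (f1, f2) \<in> orth \<and> t = Cod C f1 \<and> cs = [Dom C f1, Dom C f2] \<and>
        x = (id, [f1, f2]) \<and> y = (Transposition.transpose 0 1, [f1, f2]))"

definition orth_operad ::
  "('o, 'a, 'z) cat_scheme \<Rightarrow> ('a \<times> 'a) set \<Rightarrow> ('o, ((nat \<Rightarrow> nat) \<times> 'a list) set) operad" where
  "orth_operad C orth = quotient_operad (cat_operad C) (orth_rel C orth)"

text \<open>The morphism \<open>\<O>\<^bsub>F\<^esub>\<close>, sending the class of \<open>(\<sigma>, f)\<close> to the class of \<open>(\<sigma>, F(f))\<close>; for an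
  orthogonal functor the union below ranges over copies of a single class.\<close>

definition orth_operad_map ::
  "('p, 'b, 'z) cat_scheme \<Rightarrow> ('b \<times> 'b) set \<Rightarrow> ('o, 'a, 'p, 'b) fctr \<Rightarrow>
   ('o, ((nat \<Rightarrow> nat) \<times> 'a list) set, 'p, ((nat \<Rightarrow> nat) \<times> 'b list) set) operad_map" where
  "orth_operad_map D orth' F =
     \<lparr>MC = FO F,
      MO = (\<lambda>t cs X. \<Union>(\<sigma>, fs)\<in>X.
              cong_class (cat_operad D) (orth_rel D orth') (FO F t) (map (FO F) cs)
                (\<sigma>, map (FA F) fs))\<rparr>"


section \<open>Algebras over colored operads\<close>

record ('c, 'x, 'o, 'm) alg =
  AO :: "'c \<Rightarrow> 'o"
  AA :: "'c \<Rightarrow> 'c list \<Rightarrow> 'x \<Rightarrow> 'm"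

text \<open>The structure maps of an algebra, and the components of a morphism of algebras, are
  extensional (\<open>undefined\<close> outside of the colors and operations), so that algebras and their
  morphisms are determined by the data they consist of.\<close>

definition is_algebra ::
  "('o, 'm, 'w) moncat_scheme \<Rightarrow> ('c, 'x, 'z) operad_scheme \<Rightarrow> ('c, 'x, 'o, 'm) alg \<Rightarrow> bool" where
  "is_algebra M P A \<longleftrightarrow>
     AO A \<in> extensional (Col P) \<and>
     (\<forall>t cs x. x \<notin> Ops P t cs \<longrightarrow> AA A t cs x = undefined) \<and>
     (\<forall>c\<in>Col P. AO A c \<in> Obj M) \<and>
     (\<forall>t cs. \<forall>x\<in>Ops P t cs. AA A t cs x \<in> hom M (tens M (map (AO A) cs)) (AO A t)) \<and>
     (\<forall>t cs \<sigma>. \<forall>x\<in>Ops P t cs. \<sigma> permutes {..<length cs} \<longrightarrow>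
        AA A t (permute_list \<sigma> cs) (Act P t cs \<sigma> x) =
        Comp M (AA A t cs x) (perm_iso M (length cs) \<sigma> (map (AO A) cs))) \<and>
     (\<forall>t ds css x ys. composable P t ds css x ys \<longrightarrow>
        AA A t (concat css) (Gam P t ds css x ys) =
        Comp M (AA A t ds x)
          (Comp M (tens_arr M (map (\<lambda>i. AA A (ds ! i) (css ! i) (ys ! i)) [0..<length ds]))
            (concat_iso M (map (map (AO A)) css)))) \<and>
     (\<forall>t\<in>Col P. AA A t [t] (One P t) = RUnit M (AO A t))"

type_synonym ('c, 'x, 'o, 'm) alg_arr =
  "('c, 'x, 'o, 'm) alg \<times> ('c, 'x, 'o, 'm) alg \<times> ('c \<Rightarrow> 'm)"

definition is_algebra_morphism ::
  "('o, 'm, 'w) moncat_scheme \<Rightarrow> ('c, 'x, 'z) operad_scheme \<Rightarrow>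
   ('c, 'x, 'o, 'm) alg \<Rightarrow> ('c, 'x, 'o, 'm) alg \<Rightarrow> ('c \<Rightarrow> 'm) \<Rightarrow> bool" where
  "is_algebra_morphism M P A B \<psi> \<longleftrightarrow>
     \<psi> \<in> extensional (Col P) \<and>
     (\<forall>c\<in>Col P. \<psi> c \<in> hom M (AO A c) (AO B c)) \<and>
     (\<forall>t cs. \<forall>x\<in>Ops P t cs.
        Comp M (\<psi> t) (AA A t cs x) = Comp M (AA B t cs x) (tens_arr M (map \<psi> cs)))"

definition Alg ::
  "('o, 'm, 'w) moncat_scheme \<Rightarrow> ('c, 'x, 'z) operad_scheme \<Rightarrow>
   (('c, 'x, 'o, 'm) alg, ('c, 'x, 'o, 'm) alg_arr) cat" where
  "Alg M P =
     \<lparr>Obj = {A. is_algebra M P A},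
      Arr = {(A, B, \<psi>). is_algebra M P A \<and> is_algebra M P B \<and> is_algebra_morphism M P A B \<psi>},
      Dom = (\<lambda>(A, B, \<psi>). A),
      Cod = (\<lambda>(A, B, \<psi>). B),
      Id = (\<lambda>A. (A, A, \<lambda>c\<in>Col P. Id M (AO A c))),
      Comp = (\<lambda>(B', D, \<chi>) (A, B, \<psi>). (A, D, \<lambda>c\<in>Col P. Comp M (\<chi> c) (\<psi> c)))\<rparr>"

definition pullback_alg ::
  "('c, 'x, 'z) operad_scheme \<Rightarrow> ('c, 'x, 'd, 'y) operad_map \<Rightarrow>
   ('d, 'y, 'o, 'm) alg \<Rightarrow> ('c, 'x, 'o, 'm) alg" where
  "pullback_alg P \<phi> B =
     \<lparr>AO = (\<lambda>c\<in>Col P. AO B (MC \<phi> c)),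
      AA = (\<lambda>t cs x. if x \<in> Ops P t cs
              then AA B (MC \<phi> t) (map (MC \<phi>) cs) (MO \<phi> t cs x) else undefined)\<rparr>"

definition pullback_functor ::
  "('c, 'x, 'z) operad_scheme \<Rightarrow> ('c, 'x, 'd, 'y) operad_map \<Rightarrow>
   (('d, 'y, 'o, 'm) alg, ('d, 'y, 'o, 'm) alg_arr,
    ('c, 'x, 'o, 'm) alg, ('c, 'x, 'o, 'm) alg_arr) fctr" where
  "pullback_functor P \<phi> =
     \<lparr>FO = pullback_alg P \<phi>,
      FA = (\<lambda>(A, B, \<psi>). (pullback_alg P \<phi> A, pullback_alg P \<phi> B, \<lambda>c\<in>Col P. \<psi> (MC \<phi> c)))\<rparr>"


section \<open>Localization\<close>

text \<open>\<open>L : C \<rightarrow> D\<close> is the strict localization of the small category \<open>C\<close> at \<open>W\<close>: it inverts \<open>W\<close>, and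
  every functor to a small category which inverts \<open>W\<close> factors through \<open>L\<close>, strictly and uniquely.
  Since \<open>'u\<close> is infinite in the application, the usual category of zigzags is again
  \<open>'u\<close>-small, so such an \<open>L\<close> exists and is unique up to unique isomorphism under \<open>C\<close>.\<close>

definition is_localization ::
  "('u, 'u) cat \<Rightarrow> 'u set \<Rightarrow> ('u, 'u) cat \<Rightarrow> ('u, 'u, 'u, 'u) fctr \<Rightarrow> bool" where
  "is_localization C W D L \<longleftrightarrow>
     category D \<and> is_functor C D L \<and> (\<forall>w\<in>W. is_iso D (FA L w)) \<and>
     (\<forall>(E :: ('u, 'u) cat) F. category E \<and> is_functor C E F \<and> (\<forall>w\<in>W. is_iso E (FA F w)) \<longrightarrow>
        (\<exists>G. is_functor D E G \<and> functor_eq C (G \<circ>\<^sub>F L) F \<and>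
           (\<forall>G'. is_functor D E G' \<and> functor_eq C (G' \<circ>\<^sub>F L) F \<longrightarrow> functor_eq D G' G)))"


section \<open>\<open>cat_operad\<close> and \<open>orth_operad\<close> are colored operads, functors induce operad morphisms\<close>

lemma locate_block_pos: "i < length ks \<Longrightarrow> j < ks ! i \<Longrightarrow> locate ks (block_pos ks i j) = (i, j)"
proof (induction ks arbitrary: i)
  case (Cons k ks)
  then show ?case by (cases i) (auto simp: block_pos_def)
qed simp

lemma block_pos_less: "i < length ks \<Longrightarrow> j < ks ! i \<Longrightarrow> block_pos ks i j < sum_list ks"
proof (induction ks arbitrary: i)
  case (Cons k ks)
  then show ?case by (cases i) (auto simp: block_pos_def)
qed simp

lemma block_pos_cases:
  assumes "p < sum_list ks"
  obtains i j where "i < length ks" "j < ks ! i" "p = block_pos ks i j"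
proof -
  have "\<exists>i j. i < length ks \<and> j < ks ! i \<and> p = block_pos ks i j" using assms
  proof (induction ks arbitrary: p)
    case (Cons k ks)
    show ?case
    proof (cases "p < k")
      case True
      then show ?thesis by (intro exI[of _ 0] exI[of _ p]) (simp add: block_pos_def)
    next
      case False
      then obtain i j where "i < length ks" "j < ks ! i" "p - k = block_pos ks i j"
        using Cons.IH[of "p - k"] Cons.prems by (metis add_diff_inverse_nat nat_add_left_cancel_less sum_list.Cons)
      then show ?thesis using False
        by (intro exI[of _ "Suc i"] exI[of _ j]) (auto simp: block_pos_def)
    qed
  qed simp
  then show ?thesis using that by blast
qed

lemma concat_nth: "i < length xss \<Longrightarrow> j < length (xss ! i) \<Longrightarrow>
    concat xss ! block_pos (map length xss) i j = xss ! i ! j"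
proof (induction xss arbitrary: i)
  case (Cons xs xss)
  then show ?case by (cases i) (auto simp: block_pos_def nth_append)
qed simp

lemma block_pos_concat:
  "i < length kss \<Longrightarrow> j < length (kss ! i) \<Longrightarrow>
    block_pos (concat kss) (block_pos (map length kss) i j) l =
    block_pos (map sum_list kss) i (block_pos (kss ! i) j l)"
proof (induction kss arbitrary: i)
  case (Cons ks kss)
  then show ?case by (cases i) (auto simp: block_pos_def)
qed simp

lemma sum_perm_pos: "i < length ks \<Longrightarrow> j < ks ! i \<Longrightarrow>
   sum_perm ks \<tau>s (block_pos ks i j) = block_pos ks i ((\<tau>s ! i) j)"
  by (simp add: sum_perm_def block_pos_less locate_block_pos)

lemma block_perm_pos: "i < length ks \<Longrightarrow> j < ks ! i \<Longrightarrow>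
   block_perm ks \<sigma> (block_pos ks i j) = block_pos (permute_list (inv \<sigma>) ks) (\<sigma> i) j"
  by (simp add: block_perm_def block_pos_less locate_block_pos)

lemma permutes_nat_less: "\<sigma> permutes {..<n::nat} \<Longrightarrow> i < n \<Longrightarrow> \<sigma> i < n"
  using permutes_in_image[of \<sigma> "{..<n}" i] by auto

lemma permute_inv_nth:
  assumes "\<sigma> permutes {..<length ks}" "i < length ks"
  shows "permute_list (inv \<sigma>) ks ! \<sigma> i = ks ! i"
  using assms by (simp add: permute_list_def permutes_nat_less permutes_inverses)

lemma sum_list_permute: "\<sigma> permutes {..<length ks} \<Longrightarrow> sum_list (permute_list \<sigma> ks) = sum_list (ks :: nat list)"
  by (metis mset_permute_list sum_mset_sum_list)

lemma permutesI_nat: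
  assumes "\<And>i. i < n \<Longrightarrow> f i < n" "\<And>i j. i < n \<Longrightarrow> j < n \<Longrightarrow> f i = f j \<Longrightarrow> i = j"
    "\<And>i. \<not> i < n \<Longrightarrow> f i = (i::nat)"
  shows "f permutes {..<n}"
proof (rule bij_imp_permutes)
  have "inj_on f {..<n}" using assms(2) by (auto simp: inj_on_def)
  moreover have "f ` {..<n} \<subseteq> {..<n}" using assms(1) by auto
  ultimately show "bij_betw f {..<n} {..<n}"
    by (simp add: bij_betw_def endo_inj_surj)
qed (use assms(3) in auto)

lemma block_pos_eqD:
  assumes "block_pos ks i j = block_pos ks i' j'" "i < length ks" "j < ks ! i" "i' < length ks" "j' < ks ! i'"
  shows "i = i' \<and> j = j'"
  by (metis assms locate_block_pos prod.inject)

lemma sum_perm_permutes: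
  assumes "\<And>i. i < length ks \<Longrightarrow> \<tau>s ! i permutes {..<ks ! i}"
  shows "sum_perm ks \<tau>s permutes {..<sum_list ks}"
proof (rule permutesI_nat)
  fix p assume "p < sum_list ks"
  then show "sum_perm ks \<tau>s p < sum_list ks"
    by (elim block_pos_cases) (simp add: sum_perm_pos block_pos_less permutes_nat_less assms)
next
  fix p q assume "p < sum_list ks" "q < sum_list ks" and eq: "sum_perm ks \<tau>s p = sum_perm ks \<tau>s q"
  then obtain i j i' j' where p: "i < length ks" "j < ks ! i" "p = block_pos ks i j"
    and q: "i' < length ks" "j' < ks ! i'" "q = block_pos ks i' j'" by (metis block_pos_cases)
  have "i = i' \<and> (\<tau>s!i) j = (\<tau>s!i') j'"
    using eq p q by (intro block_pos_eqD[of ks]) (simp_all add: sum_perm_pos permutes_nat_less assms)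
  then show "p = q" using p q assms[of i] permutes_inj[of "\<tau>s!i"] by (auto dest: injD)
qed (auto simp: sum_perm_def)

lemma block_perm_permutes:
  assumes "\<sigma> permutes {..<length ks}"
  shows "block_perm ks \<sigma> permutes {..<sum_list ks}"
proof (rule permutesI_nat)
  have s: "sum_list (permute_list (inv \<sigma>) ks) = sum_list ks"
    by (simp add: sum_list_permute assms permutes_inv)
  fix p assume "p < sum_list ks"
  then obtain i j where p: "i < length ks" "j < ks ! i" "p = block_pos ks i j" by (metis block_pos_cases)
  have "block_pos (permute_list (inv \<sigma>) ks) (\<sigma> i) j < sum_list (permute_list (inv \<sigma>) ks)"
    using p assms by (intro block_pos_less) (simp_all add: permutes_nat_less permute_inv_nth)
  then show "block_perm ks \<sigma> p < sum_list ks" using p s by (simp add: block_perm_pos)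
next
  fix p q assume "p < sum_list ks" "q < sum_list ks" and eq: "block_perm ks \<sigma> p = block_perm ks \<sigma> q"
  then obtain i j i' j' where p: "i < length ks" "j < ks ! i" "p = block_pos ks i j"
    and q: "i' < length ks" "j' < ks ! i'" "q = block_pos ks i' j'" by (metis block_pos_cases)
  have "\<sigma> i = \<sigma> i' \<and> j = j'"
    using eq p q assms
    by (intro block_pos_eqD[of "permute_list (inv \<sigma>) ks"])
      (simp_all add: block_perm_pos permutes_nat_less permute_inv_nth)
  then show "p = q" using p q permutes_inj[OF assms] by (auto dest: injD)
qed (auto simp: block_perm_def)

lemma assoc_comp_pos:
  assumes "i < length ks" "j < ks ! i" "\<tau>s ! i permutes {..<ks ! i}"
  shows "assoc_comp ks \<sigma> \<tau>s (block_pos ks i j) = block_pos (permute_list (inv \<sigma>) ks) (\<sigma> i) ((\<tau>s ! i) j)"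
  using assms by (simp add: assoc_comp_def sum_perm_pos block_perm_pos permutes_nat_less)

lemma assoc_comp_permutes:
  assumes "\<sigma> permutes {..<length ks}" "\<And>i. i < length ks \<Longrightarrow> \<tau>s ! i permutes {..<ks ! i}"
  shows "assoc_comp ks \<sigma> \<tau>s permutes {..<sum_list ks}"
  unfolding assoc_comp_def using block_perm_permutes sum_perm_permutes assms by (intro permutes_compose) auto

lemma permutes_eqI:
  assumes "f permutes {..<sum_list ks}" "g permutes {..<sum_list ks}"
    "\<And>i j. i < length ks \<Longrightarrow> j < ks ! i \<Longrightarrow> f (block_pos ks i j) = g (block_pos ks i j)"
  shows "f = g"
proof
  fix p show "f p = g p"
  proof (cases "p < sum_list ks")
    case True then show ?thesis by (elim block_pos_cases) (simp add: assms(3))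
  next
    case False then show ?thesis using permutes_not_in[OF assms(1), of p] permutes_not_in[OF assms(2), of p] by simp
  qed
qed

lemma permute_assoc_comp_concat:
  assumes s: "\<sigma> permutes {..<length xss}" and l: "length \<tau>s = length xss"
    and t: "\<And>i. i < length xss \<Longrightarrow> \<tau>s ! i permutes {..<length (xss ! i)}"
  shows "permute_list (inv (assoc_comp (map length xss) \<sigma> \<tau>s)) (concat xss) =
    concat (permute_list (inv \<sigma>) (map2 (\<lambda>\<tau> xs. permute_list (inv \<tau>) xs) \<tau>s xss))" (is "?l = concat ?yss")
proof -
  let ?ks = "map length xss" let ?\<rho> = "assoc_comp ?ks \<sigma> \<tau>s"
  have len: "map length ?yss = permute_list (inv \<sigma>) ?ks"
    by (subst permute_list_map[symmetric])
      (auto simp: l s permutes_inv intro!: nth_equalityI arg_cong[where f="permute_list _"])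
  have rho: "?\<rho> permutes {..<sum_list ?ks}" using s t by (intro assoc_comp_permutes) auto
  show ?thesis
  proof (rule nth_equalityI)
    show L: "length ?l = length (concat ?yss)"
      by (simp add: length_concat len del: map_map) (simp add: s permutes_inv sum_list_permute)
    fix q assume "q < length ?l"
    then have q: "q < sum_list ?ks" by (simp add: length_concat)
    define p where "p = inv ?\<rho> q"
    have p: "p < sum_list ?ks" "?\<rho> p = q"
      using rho q permutes_inv[OF rho] permutes_nat_less permutes_inverses(1)[OF rho] by (auto simp: p_def)
    from p(1) obtain i j where ij: "i < length xss" "j < length (xss ! i)" "p = block_pos ?ks i j"
      by (elim block_pos_cases) auto
    have q2: "q = block_pos (map length ?yss) (\<sigma> i) ((\<tau>s ! i) j)"
      using assoc_comp_pos[of i ?ks j \<tau>s \<sigma>] ij p(2) t[of i] by (simp add: len)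
    have yi: "?yss ! (\<sigma> i) = permute_list (inv (\<tau>s ! i)) (xss ! i)"
      by (subst permute_inv_nth) (use ij l s in auto)
    have "concat ?yss ! q = ?yss ! (\<sigma> i) ! ((\<tau>s ! i) j)"
      unfolding q2 by (rule concat_nth) (use ij l s t yi in \<open>auto simp: permutes_nat_less\<close>)
    also have "\<dots> = xss ! i ! j" by (simp add: yi permute_inv_nth ij t)
    also have "\<dots> = concat xss ! p" using ij concat_nth by metis
    also have "\<dots> = ?l ! q" using q by (simp add: permute_list_def p_def length_concat)
    finally show "?l ! q = concat ?yss ! q" ..
  qed
qed

definition comp_arrs where "comp_arrs C fs ys = concat (map2 (\<lambda>f y. map (Comp C f) (snd y)) fs ys)"

lemma comp_arrs_len: "length fs = length ys \<Longrightarrow> length (comp_arrs C fs ys) = sum_list (map (length \<circ> snd) ys)"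
  unfolding comp_arrs_def by (induction fs ys rule: list_induct2) auto

lemma comp_arrs_nth:
  assumes "length fs = n" "length ys = n" "i < n" "length ks = n"
    "\<And>i. i < n \<Longrightarrow> length (snd (ys ! i)) = ks ! i" "j < ks ! i"
  shows "comp_arrs C fs ys ! block_pos ks i j = Comp C (fs ! i) (snd (ys ! i) ! j)"
proof -
  let ?xss = "map2 (\<lambda>f y. map (Comp C f) (snd y)) fs ys"
  have ks: "ks = map length ?xss" using assms by (intro nth_equalityI) auto
  show ?thesis unfolding comp_arrs_def ks using assms by (subst concat_nth) auto
qed

lemma comp_arrs_len': 
  assumes "length fs = n" "length ys = n" "length ks = n"
    "\<And>i. i < n \<Longrightarrow> length (snd (ys ! i)) = ks ! i"
  shows "length (comp_arrs C fs ys) = sum_list ks"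
proof -
  have "ks = map (length \<circ> snd) ys" using assms by (intro nth_equalityI) auto
  then show ?thesis using comp_arrs_len[of fs ys C] assms by simp
qed

lemma list_eq_blocks:
  assumes "length xs = sum_list ks" "length ys = sum_list ks"
    "\<And>i j. i < length ks \<Longrightarrow> j < ks ! i \<Longrightarrow> xs ! block_pos ks i j = ys ! block_pos ks i j"
  shows "xs = ys"
  using assms by (intro nth_equalityI) (auto elim!: block_pos_cases)

lemma cat_operad_simps [simp]:
  "Col (cat_operad C) = Obj C"
  "((\<sigma>, fs) \<in> Ops (cat_operad C) t cs) = (t \<in> Obj C \<and> set cs \<subseteq> Obj C \<and> \<sigma> permutes {..<length cs} \<and>
               length fs = length cs \<and> (\<forall>i<length cs. fs ! i \<in> hom C (cs ! i) t))"
  "Act (cat_operad C) t cs \<sigma>' (\<sigma>, fs) = (\<sigma> \<circ> \<sigma>', permute_list \<sigma>' fs)"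
  "Gam (cat_operad C) t ds css (\<sigma>, fs) ys = (assoc_comp (map length css) \<sigma> (map fst ys), comp_arrs C fs ys)"
  "One (cat_operad C) t = (id, [Id C t])"
  by (auto simp: cat_operad_def assoc_comp_def comp_arrs_def)

lemma cat_operad_ops:
  "x \<in> Ops (cat_operad C) t cs \<longleftrightarrow> (t \<in> Obj C \<and> set cs \<subseteq> Obj C \<and> fst x permutes {..<length cs} \<and>
               length (snd x) = length cs \<and> (\<forall>i<length cs. snd x ! i \<in> hom C (cs ! i) t))"
  by (cases x) simp

lemma cat_operad_comp:
  "composable (cat_operad C) t ds css x ys \<longleftrightarrow>
    t \<in> Obj C \<and> set ds \<subseteq> Obj C \<and> fst x permutes {..<length ds} \<and> length (snd x) = length ds \<and>
    (\<forall>i<length ds. snd x ! i \<in> hom C (ds ! i) t) \<and> length css = length ds \<and> length ys = length ds \<and>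
    (\<forall>i<length ds. ds ! i \<in> Obj C \<and> set (css ! i) \<subseteq> Obj C \<and> fst (ys ! i) permutes {..<length (css ! i)} \<and>
       length (snd (ys ! i)) = length (css ! i) \<and>
       (\<forall>j<length (css ! i). snd (ys ! i) ! j \<in> hom C (css ! i ! j) (ds ! i)))"
  by (auto simp: composable_def cat_operad_ops)

lemma permute_inv_permute:
  assumes "\<sigma> permutes {..<length xs}"
  shows "permute_list (inv \<sigma>) (permute_list \<sigma> xs) = xs"
proof -
  have "permute_list (\<sigma> \<circ> inv \<sigma>) xs = permute_list (inv \<sigma>) (permute_list \<sigma> xs)"
    by (rule permute_list_compose) (use assms permutes_inv in auto)
  then show ?thesis by (simp add: permutes_inv_o[OF assms])
qed

lemma permute_list_nth': "\<sigma> permutes {..<length xs} \<Longrightarrow> i < length xs \<Longrightarrow> permute_list \<sigma> xs ! i = xs ! \<sigma> i"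
  by (simp add: permute_list_def)

lemma permute_concat:
  assumes s: "\<sigma> permutes {..<length xss}"
  shows "permute_list (block_perm (permute_list \<sigma> (map length xss)) \<sigma>) (concat xss) = concat (permute_list \<sigma> xss)"
proof (rule list_eq_blocks[of _ "permute_list \<sigma> (map length xss)"])
  let ?ks' = "permute_list \<sigma> (map length xss)"
  show "length (permute_list (block_perm (permute_list \<sigma> (map length xss)) \<sigma>) (concat xss)) = sum_list (permute_list \<sigma> (map length xss))"
    using s by (simp add: length_concat sum_list_permute)
  show "length (concat (permute_list \<sigma> xss)) = sum_list (permute_list \<sigma> (map length xss))"
    using s by (simp add: length_concat permute_list_map)
  fix i j assume i: "i < length ?ks'" and j: "j < ?ks' ! i"
  have j2: "j < length (xss ! \<sigma> i)" using i j s by (simp add: permute_list_nth' permutes_nat_less)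
  have bp: "block_pos ?ks' i j < length (concat xss)"
    using block_pos_less[OF i j] s by (simp add: sum_list_permute length_concat)
  have "permute_list (block_perm ?ks' \<sigma>) (concat xss) ! block_pos ?ks' i j
      = concat xss ! block_perm ?ks' \<sigma> (block_pos ?ks' i j)"
    using bp by (simp add: permute_list_def)
  also have "\<dots> = concat xss ! block_pos (map length xss) (\<sigma> i) j"
    using i j s by (simp add: block_perm_pos permute_inv_permute)
  also have "\<dots> = xss ! \<sigma> i ! j" using i j2 s by (intro concat_nth) (auto simp: permutes_nat_less)
  also have "\<dots> = concat (permute_list \<sigma> xss) ! block_pos (map length (permute_list \<sigma> xss)) i j"
    using i j2 s by (subst concat_nth) (auto simp: permute_list_nth')
  finally show "permute_list (block_perm ?ks' \<sigma>) (concat xss) ! block_pos ?ks' i j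
     = concat (permute_list \<sigma> xss) ! block_pos ?ks' i j" using s by (simp add: permute_list_map)
qed

lemma permute_concat_sum:
  assumes l: "length \<tau>s = length xss" and t: "\<And>i. i < length xss \<Longrightarrow> \<tau>s ! i permutes {..<length (xss ! i)}"
  shows "permute_list (sum_perm (map length xss) \<tau>s) (concat xss) = concat (map2 permute_list \<tau>s xss)"
proof (rule list_eq_blocks[of _ "map length xss"])
  have e: "map length (map2 permute_list \<tau>s xss) = map length xss" using l by (intro nth_equalityI) auto
  show "length (permute_list (sum_perm (map length xss) \<tau>s) (concat xss)) = sum_list (map length xss)"
    by (simp add: length_concat)
  show "length (concat (map2 permute_list \<tau>s xss)) = sum_list (map length xss)"
    by (simp add: length_concat e del: map_map)
  fix i j assume i: "i < length (map length xss)" and j: "j < map length xss ! i"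
  have bp: "block_pos (map length xss) i j < length (concat xss)"
    using block_pos_less[OF i j] by (simp add: length_concat)
  have "permute_list (sum_perm (map length xss) \<tau>s) (concat xss) ! block_pos (map length xss) i j
    = concat xss ! block_pos (map length xss) i ((\<tau>s!i) j)"
    using bp i j by (simp add: permute_list_def sum_perm_pos)
  also have "\<dots> = xss ! i ! ((\<tau>s!i) j)" using i j t by (intro concat_nth) (auto simp: permutes_nat_less)
  also have "\<dots> = concat (map2 permute_list \<tau>s xss) ! block_pos (map length (map2 permute_list \<tau>s xss)) i j"
    using i j t l by (subst concat_nth) (auto simp: permute_list_nth')
  finally show "permute_list (sum_perm (map length xss) \<tau>s) (concat xss) ! block_pos (map length xss) i j =
    concat (map2 permute_list \<tau>s xss) ! block_pos (map length xss) i j" by (simp only: e)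
qed

context category begin

lemma cat_Gam_in:
  assumes c: "composable (cat_operad C) t ds css x ys"
  shows "Gam (cat_operad C) t ds css x ys \<in> Ops (cat_operad C) t (concat css)"
proof -
  obtain \<sigma> fs where x: "x = (\<sigma>, fs)" by (cases x)
  let ?ks = "map length css"
  note c = c[unfolded cat_operad_comp x, simplified]
  have 1: "set (concat css) \<subseteq> Obj C"
  proof
    fix a assume "a \<in> set (concat css)"
    then obtain cs where "cs \<in> set css" "a \<in> set cs" by auto
    then obtain i where "i < length css" "a \<in> set (css ! i)" by (metis in_set_conv_nth)
    then show "a \<in> Obj C" using c by auto
  qed
  have 2: "assoc_comp ?ks \<sigma> (map fst ys) permutes {..<length (concat css)}"
    using assoc_comp_permutes[of \<sigma> ?ks "map fst ys"] c by (simp add: length_concat)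
  have 3: "length (comp_arrs C fs ys) = length (concat css)"
    using c by (subst comp_arrs_len'[of _ "length ds" _ ?ks]) (auto simp: length_concat)
  have 4: "comp_arrs C fs ys ! p \<in> hom C (concat css ! p) t" if "p < length (concat css)" for p
  proof -
    obtain i j where ij: "i < length css" "j < length (css ! i)" "p = block_pos ?ks i j"
      using \<open>p < length (concat css)\<close> by (auto simp: length_concat elim!: block_pos_cases)
    have "comp_arrs C fs ys ! p = fs ! i \<cdot> (snd (ys ! i) ! j)"
      unfolding ij using ij c by (intro comp_arrs_nth[of _ "length ds"]) auto
    moreover have "concat css ! p = css ! i ! j" unfolding ij using ij by (intro concat_nth)
    moreover have "fs ! i \<cdot> (snd (ys ! i) ! j) \<in> hom C (css ! i ! j) t"
      using c ij by (metis Comp_in)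
    ultimately show ?thesis by simp
  qed
  show ?thesis using 1 2 3 4 c by (simp add: x)
qed

lemma cat_Gam_Act_left:
  assumes c: "composable (cat_operad C) t ds css x ys" and s: "\<sigma> permutes {..<length ds}"
  shows "Gam (cat_operad C) t (permute_list \<sigma> ds) (permute_list \<sigma> css) (Act (cat_operad C) t ds \<sigma> x) (permute_list \<sigma> ys) =
      Act (cat_operad C) t (concat css) (block_perm (permute_list \<sigma> (map length css)) \<sigma>) (Gam (cat_operad C) t ds css x ys)"
proof -
  obtain \<rho> fs where x: "x = (\<rho>, fs)" by (cases x)
  note c = c[unfolded cat_operad_comp x, simplified]
  let ?ks = "map length css" let ?ks' = "permute_list \<sigma> ?ks"
  have ks': "map length (permute_list \<sigma> css) = ?ks'" using s c by (simp add: permute_list_map)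
  have "assoc_comp ?ks' (\<rho> \<circ> \<sigma>) (permute_list \<sigma> (map fst ys)) = assoc_comp ?ks \<rho> (map fst ys) \<circ> block_perm ?ks' \<sigma>"
  proof (rule permutes_eqI[of _ ?ks'])
    have sk: "sum_list ?ks' = sum_list ?ks" using s c by (simp add: sum_list_permute)
    show "assoc_comp ?ks' (\<rho> \<circ> \<sigma>) (permute_list \<sigma> (map fst ys)) permutes {..<sum_list ?ks'}"
      using s c by (intro assoc_comp_permutes permutes_compose) (auto simp: permute_list_nth' permutes_nat_less)
    have "assoc_comp ?ks \<rho> (map fst ys) permutes {..<sum_list ?ks'}" "block_perm ?ks' \<sigma> permutes {..<sum_list ?ks'}"
      unfolding sk using c apply (intro assoc_comp_permutes) apply auto[2]
      unfolding sk[symmetric] using s c by (intro block_perm_permutes) auto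
    then show "assoc_comp ?ks \<rho> (map fst ys) \<circ> block_perm ?ks' \<sigma> permutes {..<sum_list ?ks'}"
      by (metis permutes_compose)
    fix i j assume i: "i < length ?ks'" and j: "j < ?ks' ! i"
    have si: "\<sigma> i < length ds" using i c s by (simp add: permutes_nat_less)
    have j2: "j < ?ks ! \<sigma> i" using i j s c by (simp add: permute_list_nth')
    have inv: "permute_list (inv (\<rho> \<circ> \<sigma>)) ?ks' = permute_list (inv \<rho>) ?ks"
    proof -
      have "inv (\<rho> \<circ> \<sigma>) = inv \<sigma> \<circ> inv \<rho>" using s c by (metis o_inv_distrib permutes_bij)
      moreover have "permute_list (inv \<sigma> \<circ> inv \<rho>) ?ks' = permute_list (inv \<rho>) (permute_list (inv \<sigma>) ?ks')"
        by (rule permute_list_compose) (use s c permutes_inv in auto)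
      ultimately show ?thesis using s c by (simp add: permute_inv_permute)
    qed
    have "assoc_comp ?ks' (\<rho> \<circ> \<sigma>) (permute_list \<sigma> (map fst ys)) (block_pos ?ks' i j)
       = block_pos (permute_list (inv \<rho>) ?ks) (\<rho> (\<sigma> i)) (fst (ys ! \<sigma> i) j)"
      using i j s c si by (subst assoc_comp_pos) (auto simp: inv permute_list_nth')
    also have "\<dots> = assoc_comp ?ks \<rho> (map fst ys) (block_pos ?ks (\<sigma> i) j)"
      using si j2 c by (subst assoc_comp_pos) auto
    also have "\<dots> = (assoc_comp ?ks \<rho> (map fst ys) \<circ> block_perm ?ks' \<sigma>) (block_pos ?ks' i j)"
      using i j s c by (simp add: block_perm_pos permute_inv_permute)
    finally show "assoc_comp ?ks' (\<rho> \<circ> \<sigma>) (permute_list \<sigma> (map fst ys)) (block_pos ?ks' i j) =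
       (assoc_comp ?ks \<rho> (map fst ys) \<circ> block_perm ?ks' \<sigma>) (block_pos ?ks' i j)" .
  qed
  moreover have "comp_arrs C (permute_list \<sigma> fs) (permute_list \<sigma> ys) = permute_list (block_perm ?ks' \<sigma>) (comp_arrs C fs ys)"
  proof -
    let ?xss = "map2 (\<lambda>f y. map (Comp C f) (snd y)) fs ys"
    have l: "map length ?xss = ?ks" using c by (intro nth_equalityI) auto
    have "map2 (\<lambda>f y. map (Comp C f) (snd y)) (permute_list \<sigma> fs) (permute_list \<sigma> ys) = permute_list \<sigma> ?xss"
      using s c by (intro nth_equalityI) (auto simp: permute_list_nth' permutes_nat_less)
    then show ?thesis using permute_concat[of \<sigma> ?xss] s c unfolding l comp_arrs_def by simp
  qed
  moreover have "map fst (permute_list \<sigma> ys) = permute_list \<sigma> (map fst ys)"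
    by (rule permute_list_map[symmetric]) (use s c in auto)
  ultimately show ?thesis unfolding x cat_operad_simps ks' by (simp only: cat_operad_simps)
qed

lemma cat_Gam_Act_right:
  assumes c: "composable (cat_operad C) t ds css x ys" and lt: "length \<tau>s = length ds"
    and t: "\<And>i. i < length ds \<Longrightarrow> \<tau>s ! i permutes {..<length (css ! i)}"
  shows "Gam (cat_operad C) t ds (map2 permute_list \<tau>s css) x
        (map (\<lambda>i. Act (cat_operad C) (ds ! i) (css ! i) (\<tau>s ! i) (ys ! i)) [0..<length ds]) =
      Act (cat_operad C) t (concat css) (sum_perm (map length css) \<tau>s) (Gam (cat_operad C) t ds css x ys)"
proof -
  obtain \<rho> fs where x: "x = (\<rho>, fs)" by (cases x)
  note c = c[unfolded cat_operad_comp x, simplified]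
  let ?ks = "map length css"
  let ?ys' = "map (\<lambda>i. Act (cat_operad C) (ds ! i) (css ! i) (\<tau>s ! i) (ys ! i)) [0..<length ds]"
  have act: "Act (cat_operad C) a b \<sigma> y = (fst y \<circ> \<sigma>, permute_list \<sigma> (snd y))" for a b \<sigma> y
    by (cases y) simp
  have ks': "map length (map2 permute_list \<tau>s css) = ?ks" using lt c by (intro nth_equalityI) auto
  have "assoc_comp ?ks \<rho> (map fst ?ys') = assoc_comp ?ks \<rho> (map fst ys) \<circ> sum_perm ?ks \<tau>s"
  proof (rule permutes_eqI[of _ ?ks])
    show "assoc_comp ?ks \<rho> (map fst ?ys') permutes {..<sum_list ?ks}"
      using c t by (intro assoc_comp_permutes) (auto simp: act permutes_compose)
    show "assoc_comp ?ks \<rho> (map fst ys) \<circ> sum_perm ?ks \<tau>s permutes {..<sum_list ?ks}"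
      using c t by (intro permutes_compose assoc_comp_permutes sum_perm_permutes) auto
    fix i j assume i: "i < length ?ks" and j: "j < ?ks ! i"
    show "assoc_comp ?ks \<rho> (map fst ?ys') (block_pos ?ks i j) = (assoc_comp ?ks \<rho> (map fst ys) \<circ> sum_perm ?ks \<tau>s) (block_pos ?ks i j)"
    proof -
      have 1: "fst (ys ! i) \<circ> \<tau>s ! i permutes {..<?ks ! i}"
        using i c t[of i] permutes_compose[of "\<tau>s ! i" "{..<?ks ! i}" "fst (ys ! i)"] by simp
      have 2: "(\<tau>s ! i) j < ?ks ! i" using i j c t[of i] permutes_nat_less[of "\<tau>s ! i" "?ks ! i" j] by simp
      have "assoc_comp ?ks \<rho> (map fst ?ys') (block_pos ?ks i j) = block_pos (permute_list (inv \<rho>) ?ks) (\<rho> i) ((map fst ?ys' ! i) j)"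
        using i j c 1 by (intro assoc_comp_pos) (auto simp: act)
      also have "\<dots> = block_pos (permute_list (inv \<rho>) ?ks) (\<rho> i) ((map fst ys ! i) ((\<tau>s ! i) j))"
        using i c by (simp add: act)
      also have "\<dots> = assoc_comp ?ks \<rho> (map fst ys) (block_pos ?ks i ((\<tau>s ! i) j))"
        using i c 2 by (intro assoc_comp_pos[symmetric]) auto
      also have "\<dots> = (assoc_comp ?ks \<rho> (map fst ys) \<circ> sum_perm ?ks \<tau>s) (block_pos ?ks i j)"
        using i j by (simp add: sum_perm_pos)
      finally show ?thesis .
    qed
  qed
  moreover have "comp_arrs C fs ?ys' = permute_list (sum_perm ?ks \<tau>s) (comp_arrs C fs ys)"
  proof -
    let ?xss = "map2 (\<lambda>f y. map (Comp C f) (snd y)) fs ys"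
    have l: "map length ?xss = ?ks" using c by (intro nth_equalityI) auto
    have "map2 (\<lambda>f y. map (Comp C f) (snd y)) fs ?ys' = map2 permute_list \<tau>s ?xss"
      using lt t c by (intro nth_equalityI) (auto simp: act permute_list_map)
    then show ?thesis using permute_concat_sum[of \<tau>s ?xss] lt t c unfolding l comp_arrs_def by simp
  qed
  ultimately show ?thesis unfolding x cat_operad_simps ks' by (simp only: cat_operad_simps)
qed

lemma cat_Gam_Gam:
  assumes c: "composable (cat_operad C) t ds css x ys" 
    and lb: "length bsss = length ds" and lz: "length zss = length ds"
    and z: "\<And>i. i < length ds \<Longrightarrow> composable (cat_operad C) (ds ! i) (css ! i) (bsss ! i) (ys ! i) (zss ! i)"
  shows "Gam (cat_operad C) t (concat css) (concat bsss) (Gam (cat_operad C) t ds css x ys) (concat zss) =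
      Gam (cat_operad C) t ds (map concat bsss) x
        (map (\<lambda>i. Gam (cat_operad C) (ds ! i) (css ! i) (bsss ! i) (ys ! i) (zss ! i)) [0..<length ds])"
proof -
  obtain \<sigma> fs where x: "x = (\<sigma>, fs)" by (cases x)
  note c = c[unfolded cat_operad_comp x, simplified]
  note z = z[unfolded cat_operad_comp]
  let ?ks = "map length css" let ?kss = "map (map length) bsss"
  define \<tau>s where "\<tau>s = map fst ys"
  define Z where "Z = map fst (concat zss)"
  define Y where "Y = map (\<lambda>i. Gam (cat_operad C) (ds ! i) (css ! i) (bsss ! i) (ys ! i) (zss ! i)) [0..<length ds]"
  have gam: "Gam (cat_operad C) a b d y w = (assoc_comp (map length d) (fst y) (map fst w), comp_arrs C (snd y) w)" for a b d y w
    by (cases y) simp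
  have ks: "map length ?kss = ?ks" using c z lb by (intro nth_equalityI) auto
  have K: "map length (concat bsss) = concat ?kss" by (simp add: map_concat)
  have S: "map length (map concat bsss) = map sum_list ?kss" by (simp add: length_concat)
  have zlen: "map length zss = ?ks" using c z lz by (intro nth_equalityI) auto
  have Zn: "Z ! block_pos ?ks i j = fst (zss ! i ! j)" "block_pos ?ks i j < length (concat zss)"
    "concat zss ! block_pos ?ks i j = zss ! i ! j"
    if "i < length ds" "j < length (css ! i)" for i j
  proof -
    have le: "length (zss ! i) = length (css ! i)" using z that by auto
    show cc: "concat zss ! block_pos ?ks i j = zss ! i ! j"
      using concat_nth[of i zss j] that lz le unfolding zlen by simp
    show l: "block_pos ?ks i j < length (concat zss)"
      using block_pos_less[of i ?ks j] that c by (simp add: length_concat zlen)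
    show "Z ! block_pos ?ks i j = fst (zss ! i ! j)" unfolding Z_def using l cc by simp
  qed
  have gk: "assoc_comp ?ks \<sigma> \<tau>s permutes {..<length (concat ?kss)}"
    using assoc_comp_permutes[of \<sigma> ?ks \<tau>s] c by (simp add: \<tau>s_def length_concat ks del: map_map)
  have tot: "sum_list (concat ?kss) = sum_list (map sum_list ?kss)"
    by (induction bsss) auto
  have pZ: "Z ! p permutes {..<concat ?kss ! p}" if "p < length (concat ?kss)" for p
  proof -
    from that obtain i j where ij: "i < length ds" "j < length (css ! i)" "p = block_pos ?ks i j"
      using c by (auto simp: length_concat ks simp del: map_map elim!: block_pos_cases)
    have "concat ?kss ! p = ?kss ! i ! j"
      using concat_nth[of i ?kss j] ij z[of i] lb unfolding ks by simp
    then show ?thesis using ij Zn[of i j] z[of i] lb by simp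
  qed
  have pY: "map fst Y ! i = assoc_comp (?kss ! i) (\<tau>s ! i) (map fst (zss ! i))"
     "assoc_comp (?kss ! i) (\<tau>s ! i) (map fst (zss ! i)) permutes {..<sum_list (?kss ! i)}" if "i < length ds" for i
    using that c lb z[of i] apply (simp add: Y_def gam \<tau>s_def)
    using that c lb z[of i] by (intro assoc_comp_permutes) (auto simp: \<tau>s_def)
  have inv: "permute_list (inv (assoc_comp ?ks \<sigma> \<tau>s)) (concat ?kss)
     = concat (permute_list (inv \<sigma>) (map2 (\<lambda>\<tau> xs. permute_list (inv \<tau>) xs) \<tau>s ?kss))"
    using permute_assoc_comp_concat[of \<sigma> ?kss \<tau>s] c lb z unfolding ks by (simp add: \<tau>s_def)
  let ?kss' = "permute_list (inv \<sigma>) (map2 (\<lambda>\<tau> xs. permute_list (inv \<tau>) xs) \<tau>s ?kss)"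
  have len': "map length ?kss' = permute_list (inv \<sigma>) ?ks"
    by (subst permute_list_map[symmetric]) (use c lb z in \<open>auto simp: \<tau>s_def permutes_inv intro!: nth_equalityI arg_cong[where f="permute_list _"]\<close>)
  have sum': "map sum_list ?kss' = permute_list (inv \<sigma>) (map sum_list ?kss)"
    by (subst permute_list_map[symmetric]) (use c lb z in \<open>auto simp: \<tau>s_def permutes_inv sum_list_permute intro!: nth_equalityI arg_cong[where f="permute_list _"]\<close>)
  have k': "?kss' ! \<sigma> i = permute_list (inv (\<tau>s ! i)) (?kss ! i)" if "i < length ds" for i
    by (subst permute_inv_nth) (use that lb c in \<open>auto simp: \<tau>s_def\<close>)
  have P: "assoc_comp (concat ?kss) (assoc_comp ?ks \<sigma> \<tau>s) Z = assoc_comp (map sum_list ?kss) \<sigma> (map fst Y)"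
  proof (rule permutes_eqI[of _ "concat ?kss"])
    show "assoc_comp (concat ?kss) (assoc_comp ?ks \<sigma> \<tau>s) Z permutes {..<sum_list (concat ?kss)}"
      using gk pZ by (intro assoc_comp_permutes)
    show "assoc_comp (map sum_list ?kss) \<sigma> (map fst Y) permutes {..<sum_list (concat ?kss)}"
      unfolding tot using c lb pY by (intro assoc_comp_permutes) auto
    fix p l assume p: "p < length (concat ?kss)" and l: "l < concat ?kss ! p"
    then obtain i j where ij: "i < length ds" "j < length (css ! i)" "p = block_pos ?ks i j"
      using c by (auto simp: length_concat ks simp del: map_map elim!: block_pos_cases)
    have kk: "concat ?kss ! p = ?kss ! i ! j"
      using concat_nth[of i ?kss j] ij z[of i] lb unfolding ks by simp
    have "assoc_comp (concat ?kss) (assoc_comp ?ks \<sigma> \<tau>s) Z (block_pos (concat ?kss) p l)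
       = block_pos (concat ?kss') (assoc_comp ?ks \<sigma> \<tau>s p) ((Z!p) l)"
      unfolding inv[symmetric] using p l pZ by (intro assoc_comp_pos)
    also have "assoc_comp ?ks \<sigma> \<tau>s p = block_pos (map length ?kss') (\<sigma> i) ((\<tau>s ! i) j)"
      unfolding len' ij using ij c by (intro assoc_comp_pos) (auto simp: \<tau>s_def)
    also have "block_pos (concat ?kss') \<dots> ((Z!p) l) =
        block_pos (map sum_list ?kss') (\<sigma> i) (block_pos (?kss' ! \<sigma> i) ((\<tau>s ! i) j) ((Z!p) l))"
      using ij c lb z[of i] k'[of i]
      by (intro block_pos_concat) (auto simp: permutes_nat_less \<tau>s_def)
    also have "\<dots> = block_pos (permute_list (inv \<sigma>) (map sum_list ?kss)) (\<sigma> i)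
        (block_pos (permute_list (inv (\<tau>s ! i)) (?kss ! i)) ((\<tau>s ! i) j) (fst (zss ! i ! j) l))"
      using ij k'[of i] Zn[of i j] by (simp only: sum')
    also have "block_pos (permute_list (inv (\<tau>s ! i)) (?kss ! i)) ((\<tau>s ! i) j) (fst (zss ! i ! j) l)
       = assoc_comp (?kss ! i) (\<tau>s ! i) (map fst (zss ! i)) (block_pos (?kss ! i) j l)"
      using ij lb l kk z[of i] by (subst assoc_comp_pos) auto
    also have "block_pos (permute_list (inv \<sigma>) (map sum_list ?kss)) (\<sigma> i) \<dots>
       = assoc_comp (map sum_list ?kss) \<sigma> (map fst Y) (block_pos (map sum_list ?kss) i (block_pos (?kss ! i) j l))"
    proof -
      have "block_pos (?kss ! i) j l < sum_list (?kss ! i)"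
        using ij lb l kk z[of i] by (intro block_pos_less) auto
      then show ?thesis using ij lb pY[of i] by (subst assoc_comp_pos) auto
    qed
    also have "block_pos (map sum_list ?kss) i (block_pos (?kss ! i) j l) = block_pos (concat ?kss) p l"
      unfolding ij ks[symmetric] using ij lb z[of i] by (intro block_pos_concat[symmetric]) auto
    finally show "assoc_comp (concat ?kss) (assoc_comp ?ks \<sigma> \<tau>s) Z (block_pos (concat ?kss) p l) =
       assoc_comp (map sum_list ?kss) \<sigma> (map fst Y) (block_pos (concat ?kss) p l)" .
  qed
  have G: "comp_arrs C (comp_arrs C fs ys) (concat zss) = comp_arrs C fs Y"
  proof (rule list_eq_blocks[of _ "concat ?kss"])
    have zl: "length (snd (concat zss ! p)) = concat ?kss ! p" if "p < length (concat ?kss)" for p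
    proof -
      from that obtain i j where ij: "i < length ds" "j < length (css ! i)" "p = block_pos ?ks i j"
        using c by (auto simp: length_concat ks simp del: map_map elim!: block_pos_cases)
      have "concat ?kss ! p = ?kss ! i ! j"
        using concat_nth[of i ?kss j] ij z[of i] lb unfolding ks by simp
      then show ?thesis using ij Zn[of i j] z[of i] lb by simp
    qed
    have lg: "length (comp_arrs C fs ys) = length (concat ?kss)"
      using c by (subst comp_arrs_len'[of _ "length ds" _ ?ks]) (auto simp: length_concat ks simp del: map_map)
    have lzz: "length (concat zss) = length (concat ?kss)" by (simp add: length_concat ks zlen del: map_map)
    have Yl: "length (snd (Y ! i)) = sum_list (?kss ! i)" if "i < length ds" for i
      using that lb z[of i] unfolding Y_def
      by (simp add: gam) (subst comp_arrs_len'[of _ "length (css ! i)" _ "map length (bsss!i)"]; simp)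
    show "length (comp_arrs C (comp_arrs C fs ys) (concat zss)) = sum_list (concat ?kss)"
      using lg lzz zl by (intro comp_arrs_len') auto
    show "length (comp_arrs C fs Y) = sum_list (concat ?kss)"
      unfolding tot using c lb Yl by (intro comp_arrs_len'[of _ "length ds"]) (auto simp: Y_def)
    fix p l assume p: "p < length (concat ?kss)" and l: "l < concat ?kss ! p"
    then obtain i j where ij: "i < length ds" "j < length (css ! i)" "p = block_pos ?ks i j"
      using c by (auto simp: length_concat ks simp del: map_map elim!: block_pos_cases)
    have kk: "concat ?kss ! p = ?kss ! i ! j"
      using concat_nth[of i ?kss j] ij z[of i] lb unfolding ks by simp
    have "comp_arrs C (comp_arrs C fs ys) (concat zss) ! block_pos (concat ?kss) p l = comp_arrs C fs ys ! p \<cdot> (snd (concat zss ! p) ! l)"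
      using lg lzz zl p l by (intro comp_arrs_nth) auto
    also have "\<dots> = (fs ! i \<cdot> (snd (ys ! i) ! j)) \<cdot> (snd (zss ! i ! j) ! l)"
      unfolding ij using Zn ij c by (subst comp_arrs_nth[of _ "length ds"]) auto
    also have "\<dots> = fs ! i \<cdot> ((snd (ys ! i) ! j) \<cdot> (snd (zss ! i ! j) ! l))"
      using c z[of i] ij l kk lb by (intro Comp_assoc) auto
    also have "\<dots> = fs ! i \<cdot> (snd (Y ! i) ! block_pos (?kss ! i) j l)"
    proof -
      have "comp_arrs C (snd (ys ! i)) (zss ! i) ! block_pos (?kss ! i) j l = (snd (ys ! i) ! j) \<cdot> (snd (zss ! i ! j) ! l)"
        using z[of i] ij l kk lb by (intro comp_arrs_nth[of _ "length (css!i)"]) auto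
      then show ?thesis using ij by (simp add: Y_def gam)
    qed
    also have "\<dots> = comp_arrs C fs Y ! block_pos (map sum_list ?kss) i (block_pos (?kss ! i) j l)"
    proof -
      have "block_pos (?kss ! i) j l < sum_list (?kss ! i)"
        using ij lb l kk z[of i] by (intro block_pos_less) auto
      then show ?thesis using ij lb c Yl by (subst comp_arrs_nth[of _ "length ds"]) (auto simp: Y_def)
    qed
    also have "block_pos (map sum_list ?kss) i (block_pos (?kss ! i) j l) = block_pos (concat ?kss) p l"
      unfolding ij ks[symmetric] using ij lb z[of i] by (intro block_pos_concat[symmetric]) auto
    finally show "comp_arrs C (comp_arrs C fs ys) (concat zss) ! block_pos (concat ?kss) p l = comp_arrs C fs Y ! block_pos (concat ?kss) p l" .
  qed
  have "Gam (cat_operad C) t (concat css) (concat bsss) (Gam (cat_operad C) t ds css x ys) (concat zss)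
     = Gam (cat_operad C) t ds (map concat bsss) x Y"
    unfolding x cat_operad_simps K S using P G by (simp only: \<tau>s_def Z_def)
  then show ?thesis unfolding Y_def .
qed

lemma cat_Gam_One_left:
  assumes x: "x \<in> Ops (cat_operad C) t cs"
  shows "Gam (cat_operad C) t [t] [cs] (One (cat_operad C) t) [x] = x"
proof -
  note x = x[unfolded cat_operad_ops]
  have "assoc_comp [length cs] id [fst x] = fst x"
  proof (rule permutes_eqI[of _ "[length cs]"])
    show "assoc_comp [length cs] id [fst x] permutes {..<sum_list [length cs]}"
      using x by (intro assoc_comp_permutes) (auto simp: permutes_id)
    show "fst x permutes {..<sum_list [length cs]}" using x by simp
    fix i j assume "i < length [length cs]" "j < [length cs] ! i"
    then show "assoc_comp [length cs] id [fst x] (block_pos [length cs] i j) = fst x (block_pos [length cs] i j)"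
      using x by (subst assoc_comp_pos) (auto simp: inv_id block_pos_def)
  qed
  moreover have "comp_arrs C [Id C t] [x] = snd x"
    using x by (auto simp: comp_arrs_def in_set_conv_nth intro!: nth_equalityI) (metis Id_Comp)
  ultimately show ?thesis by (simp)
qed

lemma cat_Gam_One_right:
  assumes x: "x \<in> Ops (cat_operad C) t cs"
  shows "Gam (cat_operad C) t cs (map (\<lambda>c. [c]) cs) x (map (One (cat_operad C)) cs) = x"
proof -
  obtain \<sigma> fs where xe: "x = (\<sigma>, fs)" by (cases x)
  note x = x[unfolded cat_operad_ops]
  let ?ks = "map length (map (\<lambda>c. [c]) cs)"
  have ks: "?ks = replicate (length cs) 1" by (induction cs) auto
  have bp: "block_pos (replicate n 1) i 0 = i" if "i < n" for n i
    using that by (simp add: block_pos_def sum_list_replicate)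
  have pl: "permute_list (inv \<sigma>) ?ks = replicate (length cs) 1"
    using x unfolding ks by (intro nth_equalityI) (auto simp: xe permute_list_nth' permutes_inv permutes_nat_less)
  have "assoc_comp ?ks \<sigma> (map fst (map (One (cat_operad C)) cs)) = \<sigma>"
  proof (rule permutes_eqI[of _ ?ks])
    show "assoc_comp ?ks \<sigma> (map fst (map (One (cat_operad C)) cs)) permutes {..<sum_list ?ks}"
      using x by (intro assoc_comp_permutes) (auto simp: permutes_id xe)
    show "\<sigma> permutes {..<sum_list ?ks}" using x unfolding ks by (simp add: xe sum_list_replicate)
    fix i j assume ij: "i < length ?ks" "j < ?ks ! i"
    then have "assoc_comp ?ks \<sigma> (map fst (map (One (cat_operad C)) cs)) (block_pos ?ks i j) = block_pos (permute_list (inv \<sigma>) ?ks) (\<sigma> i) j"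
      by (subst assoc_comp_pos) (auto simp: permutes_id)
    also have "\<dots> = \<sigma> i" unfolding pl using ij x bp by (simp add: xe permutes_nat_less)
    also have "\<dots> = \<sigma> (block_pos ?ks i j)" using ij bp unfolding ks by simp
    finally show "assoc_comp ?ks \<sigma> (map fst (map (One (cat_operad C)) cs)) (block_pos ?ks i j) = \<sigma> (block_pos ?ks i j)" .
  qed
  moreover have "comp_arrs C fs (map (One (cat_operad C)) cs) = fs"
  proof (rule nth_equalityI)
    have l: "length (comp_arrs C fs (map (One (cat_operad C)) cs)) = sum_list ?ks"
      using x by (intro comp_arrs_len'[of _ "length cs"]) (auto simp: xe)
    then show "length (comp_arrs C fs (map (One (cat_operad C)) cs)) = length fs"
      using x unfolding ks by (simp add: xe sum_list_replicate)
    fix i assume "i < length (comp_arrs C fs (map (One (cat_operad C)) cs))"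
    then have i: "i < length cs" using l unfolding ks by (simp add: sum_list_replicate)
    have "comp_arrs C fs (map (One (cat_operad C)) cs) ! block_pos ?ks i 0 = fs ! i \<cdot> Id C (cs ! i)"
      using x i by (subst comp_arrs_nth[of _ "length cs"]) (auto simp: xe)
    also have "\<dots> = fs ! i" using x i by (metis Comp_Id xe snd_conv)
    finally show "comp_arrs C fs (map (One (cat_operad C)) cs) ! i = fs ! i" using bp[OF i] unfolding ks by simp
  qed
  ultimately show ?thesis unfolding xe cat_operad_simps by simp
qed

lemma colored_operad_cat: "colored_operad (cat_operad C)"
proof
  fix x t cs assume x: "x \<in> Ops (cat_operad C) t cs"
  obtain \<rho> fs where xe: "x = (\<rho>, fs)" by (cases x)
  note x' = x[unfolded xe cat_operad_simps]
  show "t \<in> Col (cat_operad C) \<and> set cs \<subseteq> Col (cat_operad C)" using x' by simp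
  show "Act (cat_operad C) t cs id x = x" by (simp add: xe)
  show "Gam (cat_operad C) t [t] [cs] (One (cat_operad C) t) [x] = x" using x by (rule cat_Gam_One_left)
  show "Gam (cat_operad C) t cs (map (\<lambda>c. [c]) cs) x (map (One (cat_operad C)) cs) = x"
    using x by (rule cat_Gam_One_right)
  fix \<sigma> assume s: "\<sigma> permutes {..<length cs}"
  show "Act (cat_operad C) t cs \<sigma> x \<in> Ops (cat_operad C) t (permute_list \<sigma> cs)"
    using x' s by (auto simp: xe permutes_compose permute_list_nth' permutes_nat_less)
  fix \<tau> assume t: "\<tau> permutes {..<length cs}"
  show "Act (cat_operad C) t (permute_list \<sigma> cs) \<tau> (Act (cat_operad C) t cs \<sigma> x) = Act (cat_operad C) t cs (\<sigma> \<circ> \<tau>) x"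
    using x' t by (simp add: xe comp_assoc permute_list_compose)
next
  fix t assume "t \<in> Col (cat_operad C)"
  then show "One (cat_operad C) t \<in> Ops (cat_operad C) t [t]" by (simp add: Id_in permutes_id)
qed (fact cat_Gam_in cat_Gam_Act_left cat_Gam_Act_right cat_Gam_Gam)+

end

lemma ex_list: "(\<And>i. i < n \<Longrightarrow> \<exists>y. Q i y) \<Longrightarrow> \<exists>ys. length ys = n \<and> (\<forall>i<n. Q i (ys ! i))"
  by (rule exI[of _ "map (\<lambda>i. SOME y. Q i y) [0..<n]"]) (auto intro: someI_ex)

context colored_operad begin

lemma cong_ops: "operad_cong P R t cs x y \<Longrightarrow> x \<in> Ops P t cs \<and> y \<in> Ops P t cs"
proof (induction rule: operad_cong.induct)
  case (gam t ds x x' css ys ys')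
  then show ?case by (auto simp: composable_def intro!: Gam_in)
qed (auto intro: Act_in)

lemma class_eq: "operad_cong P R t cs x y \<Longrightarrow> cong_class P R t cs x = cong_class P R t cs y"
  unfolding cong_class_def by (blast intro: operad_cong.sym operad_cong.trans)

lemma class_mem: "y \<in> cong_class P R t cs x \<longleftrightarrow> operad_cong P R t cs x y"
  by (simp add: cong_class_def)

lemma quot_Act:
  assumes "x \<in> Ops P t cs" "\<sigma> permutes {..<length cs}"
  shows "Act (quotient_operad P R) t cs \<sigma> (cong_class P R t cs x) = cong_class P R t (permute_list \<sigma> cs) (Act P t cs \<sigma> x)"
proof -
  have "cong_class P R t (permute_list \<sigma> cs) (Act P t cs \<sigma> y) = cong_class P R t (permute_list \<sigma> cs) (Act P t cs \<sigma> x)"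
    if "operad_cong P R t cs x y" for y
    by (rule class_eq[OF operad_cong.act[OF operad_cong.sym[OF that] assms(2)]])
  then have "(\<Union>y\<in>cong_class P R t cs x. cong_class P R t (permute_list \<sigma> cs) (Act P t cs \<sigma> y)) = cong_class P R t (permute_list \<sigma> cs) (Act P t cs \<sigma> x)"
    using operad_cong.refl[OF assms(1), of R] unfolding cong_class_def[of _ _ _ cs x] by blast
  then show ?thesis by (simp add: quotient_operad_def)
qed

lemma quot_Gam:
  assumes c: "composable P t ds css x ys"
  shows "Gam (quotient_operad P R) t ds css (cong_class P R t ds x)
     (map (\<lambda>i. cong_class P R (ds ! i) (css ! i) (ys ! i)) [0..<length ds]) = cong_class P R t (concat css) (Gam P t ds css x ys)"
proof -
  let ?Ys = "map (\<lambda>i. cong_class P R (ds ! i) (css ! i) (ys ! i)) [0..<length ds]"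
  note c = c[unfolded composable_def]
  have "cong_class P R t (concat css) (Gam P t ds css x' ys') = cong_class P R t (concat css) (Gam P t ds css x ys)"
    if "operad_cong P R t ds x x'" "list_all2 (\<in>) ys' ?Ys" for x' ys'
    by (rule class_eq, rule operad_cong.gam)
      (use that c in \<open>auto simp: list_all2_conv_all_nth class_mem intro: operad_cong.sym\<close>)
  moreover have "operad_cong P R t ds x x" "list_all2 (\<in>) ys ?Ys"
    using c by (auto simp: list_all2_conv_all_nth class_mem intro: operad_cong.refl)
  ultimately have "(\<Union>x'\<in>cong_class P R t ds x. \<Union>ys'\<in>{ys'. list_all2 (\<in>) ys' ?Ys}. cong_class P R t (concat css) (Gam P t ds css x' ys'))
     = cong_class P R t (concat css) (Gam P t ds css x ys)"
    unfolding cong_class_def[of _ _ _ ds x] by blast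
  then show ?thesis by (simp add: quotient_operad_def)
qed

lemma quot_simps [simp]:
  "Col (quotient_operad P R) = Col P"
  "Ops (quotient_operad P R) t cs = cong_class P R t cs ` Ops P t cs"
  "One (quotient_operad P R) t = cong_class P R t [t] (One P t)"
  by (simp_all add: quotient_operad_def)

lemma quot_composable:
  assumes "composable (quotient_operad P R) t ds css X Ys"
  obtains x ys where "composable P t ds css x ys" "X = cong_class P R t ds x"
    "Ys = map (\<lambda>i. cong_class P R (ds ! i) (css ! i) (ys ! i)) [0..<length ds]"
proof -
  obtain x where x: "x \<in> Ops P t ds" "X = cong_class P R t ds x" using assms by (auto simp: composable_def)
  have "\<exists>ys. length ys = length ds \<and> (\<forall>i<length ds. ys ! i \<in> Ops P (ds ! i) (css ! i) \<and> Ys ! i = cong_class P R (ds ! i) (css ! i) (ys ! i))"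
    using assms by (intro ex_list) (auto simp: composable_def)
  then obtain ys where ys: "length ys = length ds" "\<forall>i<length ds. ys ! i \<in> Ops P (ds ! i) (css ! i) \<and> Ys ! i = cong_class P R (ds ! i) (css ! i) (ys ! i)"
    by blast
  show thesis using assms x ys by (intro that[of x ys]) (auto simp: composable_def intro!: nth_equalityI)
qed

lemma quot_composable': "composable P t ds css x ys \<Longrightarrow>
  composable (quotient_operad P R) t ds css (cong_class P R t ds x)
     (map (\<lambda>i. cong_class P R (ds ! i) (css ! i) (ys ! i)) [0..<length ds])"
  by (auto simp: composable_def)

lemma colored_operad_quot: "colored_operad (quotient_operad P R)"
proof
  let ?Q = "quotient_operad P R"
  fix X t cs assume "X \<in> Ops ?Q t cs"
  then obtain x where x: "x \<in> Ops P t cs" "X = cong_class P R t cs x" by auto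
  show "t \<in> Col ?Q \<and> set cs \<subseteq> Col ?Q" using Ops_col x by auto
  show "Act ?Q t cs id X = X" using x quot_Act[OF x(1), of id] Act_id by (simp add: permutes_id)
  have t: "t \<in> Col P" using Ops_col x by auto
  show "Gam ?Q t [t] [cs] (One ?Q t) [X] = X"
    using quot_Gam[of t "[t]" "[cs]" "One P t" "[x]" R] x One_in t Gam_One_left[of x t cs] by (simp add: composable_def)
  show "Gam ?Q t cs (map (\<lambda>c. [c]) cs) X (map (One ?Q) cs) = X"
  proof -
    have c: "composable P t cs (map (\<lambda>c. [c]) cs) x (map (One P) cs)"
      using x Ops_col[OF x(1)] by (auto simp: composable_def intro!: One_in)
    have e: "map (One ?Q) cs = map (\<lambda>i. cong_class P R (cs ! i) (map (\<lambda>c. [c]) cs ! i) (map (One P) cs ! i)) [0..<length cs]"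
      by (intro nth_equalityI) auto
    have "concat (map (\<lambda>c. [c]) cs) = cs" by simp
    then show ?thesis unfolding e x(2) quot_Gam[OF c] using Gam_One_right[OF x(1)] by simp
  qed
  fix \<sigma> assume s: "\<sigma> permutes {..<length cs}"
  show "Act ?Q t cs \<sigma> X \<in> Ops ?Q t (permute_list \<sigma> cs)" using x s by (simp add: quot_Act Act_in)
  fix \<tau> assume tt: "\<tau> permutes {..<length cs}"
  have "permute_list \<tau> (permute_list \<sigma> cs) = permute_list (\<sigma> \<circ> \<tau>) cs" using tt by (simp add: permute_list_compose)
  then show "Act ?Q t (permute_list \<sigma> cs) \<tau> (Act ?Q t cs \<sigma> X) = Act ?Q t cs (\<sigma> \<circ> \<tau>) X"
    using x s tt by (simp add: quot_Act Act_in permutes_compose Act_Act)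
next
  let ?Q = "quotient_operad P R"
  fix t assume "t \<in> Col ?Q" then show "One ?Q t \<in> Ops ?Q t [t]" using One_in by simp
next
  let ?Q = "quotient_operad P R"
  fix t ds css X Ys assume "composable ?Q t ds css X Ys"
  then obtain x ys where c: "composable P t ds css x ys" and X: "X = cong_class P R t ds x" and
    Y: "Ys = map (\<lambda>i. cong_class P R (ds ! i) (css ! i) (ys ! i)) [0..<length ds]" by (rule quot_composable)
  note l = c[unfolded composable_def]
  show "Gam ?Q t ds css X Ys \<in> Ops ?Q t (concat css)" unfolding X Y quot_Gam[OF c] using Gam_in[OF c] by simp
  { fix \<sigma> assume s: "\<sigma> permutes {..<length ds}"
    have c': "composable P t (permute_list \<sigma> ds) (permute_list \<sigma> css) (Act P t ds \<sigma> x) (permute_list \<sigma> ys)"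
      using l s by (auto simp: composable_def Act_in permute_list_nth' permutes_nat_less)
    have bp: "block_perm (permute_list \<sigma> (map length css)) \<sigma> permutes {..<length (concat css)}"
      using block_perm_permutes[of \<sigma> "permute_list \<sigma> (map length css)"] s l by (simp add: length_concat sum_list_permute)
    have "permute_list \<sigma> Ys = map (\<lambda>i. cong_class P R (permute_list \<sigma> ds ! i) (permute_list \<sigma> css ! i) (permute_list \<sigma> ys ! i)) [0..<length (permute_list \<sigma> ds)]"
      using s l unfolding Y by (intro nth_equalityI) (auto simp: permute_list_nth' permutes_nat_less)
    then show "Gam ?Q t (permute_list \<sigma> ds) (permute_list \<sigma> css) (Act ?Q t ds \<sigma> X) (permute_list \<sigma> Ys) =
      Act ?Q t (concat css) (block_perm (permute_list \<sigma> (map length css)) \<sigma>) (Gam ?Q t ds css X Ys)"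
      using l s permute_concat[of \<sigma> css] bp
      by (simp only: X quot_Act quot_Gam[OF c'] Y quot_Gam[OF c] Gam_in[OF c] Gam_Act_left[OF c s]) }
  { fix \<tau>s assume lt: "length \<tau>s = length ds" and t: "\<And>i. i < length ds \<Longrightarrow> \<tau>s ! i permutes {..<length (css ! i)}"
    let ?ys = "map (\<lambda>i. Act P (ds ! i) (css ! i) (\<tau>s ! i) (ys ! i)) [0..<length ds]"
    have c': "composable P t ds (map2 permute_list \<tau>s css) x ?ys"
      using l t lt by (auto simp: composable_def Act_in)
    have bp: "sum_perm (map length css) \<tau>s permutes {..<length (concat css)}"
      using sum_perm_permutes[of "map length css" \<tau>s] t l by (simp add: length_concat)
    have e: "map (\<lambda>i. Act ?Q (ds ! i) (css ! i) (\<tau>s ! i) (Ys ! i)) [0..<length ds] =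
       map (\<lambda>i. cong_class P R (ds ! i) (map2 permute_list \<tau>s css ! i) (?ys ! i)) [0..<length ds]"
      using lt l t unfolding Y by (intro nth_equalityI) (auto simp: quot_Act)
    have pc: "permute_list (sum_perm (map length css) \<tau>s) (concat css) = concat (map2 permute_list \<tau>s css)"
      using lt t l by (intro permute_concat_sum) auto
    show "Gam ?Q t ds (map2 permute_list \<tau>s css) X (map (\<lambda>i. Act ?Q (ds ! i) (css ! i) (\<tau>s ! i) (Ys ! i)) [0..<length ds]) =
      Act ?Q t (concat css) (sum_perm (map length css) \<tau>s) (Gam ?Q t ds css X Ys)"
      unfolding e X quot_Gam[OF c'] unfolding Y quot_Gam[OF c] quot_Act[OF Gam_in[OF c] bp]
      using Gam_Act_right[OF c lt t] pc by simp }
  { fix bsss Zss assume lb: "length bsss = length ds" and lz: "length Zss = length ds"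
      and cz: "\<And>i. i < length ds \<Longrightarrow> composable ?Q (ds ! i) (css ! i) (bsss ! i) (Ys ! i) (Zss ! i)"
    have "\<exists>zss. length zss = length ds \<and> (\<forall>i<length ds. \<exists>y. operad_cong P R (ds ! i) (css ! i) (ys ! i) y \<and> composable P (ds ! i) (css ! i) (bsss ! i) y (zss ! i) \<and>
       Zss ! i = map (\<lambda>j. cong_class P R (css ! i ! j) (bsss ! i ! j) (zss ! i ! j)) [0..<length (css ! i)])"
    proof (rule ex_list)
      fix i assume i: "i < length ds"
      obtain y zs where yz: "composable P (ds ! i) (css ! i) (bsss ! i) y zs" "Ys ! i = cong_class P R (ds ! i) (css ! i) y"
         "Zss ! i = map (\<lambda>j. cong_class P R (css ! i ! j) (bsss ! i ! j) (zs ! j)) [0..<length (css ! i)]"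
        by (rule quot_composable[OF cz[OF i]])
      have "y \<in> cong_class P R (ds ! i) (css ! i) y" using yz(1) by (auto simp: class_mem composable_def intro: operad_cong.refl)
      then have "operad_cong P R (ds ! i) (css ! i) (ys ! i) y" using yz(2) i unfolding Y by (auto simp: class_mem)
      then show "\<exists>zs y. operad_cong P R (ds ! i) (css ! i) (ys ! i) y \<and> composable P (ds ! i) (css ! i) (bsss ! i) y zs \<and>
         Zss ! i = map (\<lambda>j. cong_class P R (css ! i ! j) (bsss ! i ! j) (zs ! j)) [0..<length (css ! i)]"
        using yz by blast
    qed
    then obtain zss where zl: "length zss = length ds" and z': "\<And>i. i < length ds \<Longrightarrow> \<exists>y. operad_cong P R (ds ! i) (css ! i) (ys ! i) y \<and> composable P (ds ! i) (css ! i) (bsss ! i) y (zss ! i) \<and>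
       Zss ! i = map (\<lambda>j. cong_class P R (css ! i ! j) (bsss ! i ! j) (zss ! i ! j)) [0..<length (css ! i)]" by blast
    have z: "composable P (ds ! i) (css ! i) (bsss ! i) (ys ! i) (zss ! i)"
       "Zss ! i = map (\<lambda>j. cong_class P R (css ! i ! j) (bsss ! i ! j) (zss ! i ! j)) [0..<length (css ! i)]" if "i < length ds" for i
      using z'[OF that] l that by (auto simp: composable_def)
    have zlen: "map length zss = map length css" using zl l z by (intro nth_equalityI) (auto simp: composable_def)
    have blen: "map length bsss = map length css" using lb l z by (intro nth_equalityI) (auto simp: composable_def)
    have Zlen: "map length Zss = map length css" using lz l z by (intro nth_equalityI) (auto)
    let ?P = "\<lambda>p. p < length (concat css)"
    have nths: "concat css ! p = css ! i ! j" "concat zss ! p = zss ! i ! j" "concat bsss ! p = bsss ! i ! j" "concat Zss ! p = Zss ! i ! j"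
      if "i < length ds" "j < length (css ! i)" "p = block_pos (map length css) i j" for p i j
    proof -
      have "length (zss ! i) = length (css ! i)" "length (bsss ! i) = length (css ! i)" "length (Zss ! i) = length (css ! i)"
        using that z[of i] by (auto simp: composable_def)
      then show "concat css ! p = css ! i ! j" "concat zss ! p = zss ! i ! j" "concat bsss ! p = bsss ! i ! j" "concat Zss ! p = Zss ! i ! j"
        using that l lb lz zl concat_nth[of i css j] concat_nth[of i zss j] concat_nth[of i bsss j] concat_nth[of i Zss j]
        unfolding zlen blen Zlen by auto
    qed
    have lens: "length (concat zss) = length (concat css)" "length (concat bsss) = length (concat css)" "length (concat Zss) = length (concat css)"
      by (simp_all add: length_concat zlen blen Zlen)
    have cases: "\<exists>i j. i < length ds \<and> j < length (css ! i) \<and> p = block_pos (map length css) i j" if pp: "p < length (concat css)" for p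
    proof -
      obtain i j where "i < length (map length css)" "j < map length css ! i" "p = block_pos (map length css) i j"
        by (rule block_pos_cases[of p "map length css"]) (use pp in \<open>auto simp: length_concat\<close>)
      then show ?thesis using l by auto
    qed
    have c1: "composable P t (concat css) (concat bsss) (Gam P t ds css x ys) (concat zss)"
      unfolding composable_def
    proof (intro conjI allI impI)
      fix p assume "p < length (concat css)"
      then obtain i j where "i < length ds" "j < length (css ! i)" "p = block_pos (map length css) i j" using cases by blast
      then show "concat zss ! p \<in> Ops P (concat css ! p) (concat bsss ! p)"
        using nths[of i j p] z[of i] by (simp add: composable_def)
    qed (use Gam_in[OF c] lens in auto)
    have e1: "concat Zss = map (\<lambda>p. cong_class P R (concat css ! p) (concat bsss ! p) (concat zss ! p)) [0..<length (concat css)]"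
    proof (rule nth_equalityI)
      fix p assume "p < length (concat Zss)"
      then have p: "p < length (concat css)" using lens by simp
      then obtain i j where "i < length ds" "j < length (css ! i)" "p = block_pos (map length css) i j" using cases by blast
      then show "concat Zss ! p = map (\<lambda>p. cong_class P R (concat css ! p) (concat bsss ! p) (concat zss ! p)) [0..<length (concat css)] ! p"
        using nths[of i j p] z[of i] p by simp
    qed (simp add: lens)
    let ?ys = "map (\<lambda>i. Gam P (ds ! i) (css ! i) (bsss ! i) (ys ! i) (zss ! i)) [0..<length ds]"
    have c2: "composable P t ds (map concat bsss) x ?ys"
      using l lb z by (auto simp: composable_def intro!: Gam_in)
    have e2: "map (\<lambda>i. Gam ?Q (ds ! i) (css ! i) (bsss ! i) (Ys ! i) (Zss ! i)) [0..<length ds] =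
       map (\<lambda>i. cong_class P R (ds ! i) (map concat bsss ! i) (?ys ! i)) [0..<length ds]"
      using lb z unfolding Y by (intro nth_equalityI) (auto simp: quot_Gam)
    have cc: "concat (map concat bsss) = concat (concat bsss)" by (induction bsss) auto
    show "Gam ?Q t (concat css) (concat bsss) (Gam ?Q t ds css X Ys) (concat Zss) =
      Gam ?Q t ds (map concat bsss) X (map (\<lambda>i. Gam ?Q (ds ! i) (css ! i) (bsss ! i) (Ys ! i) (Zss ! i)) [0..<length ds])"
      unfolding X e2 quot_Gam[OF c2] unfolding Y quot_Gam[OF c] e1 quot_Gam[OF c1] cc
      using Gam_Gam[OF c lb zl z(1)] by simp }
qed

end

lemma colored_operad_orth: "category C \<Longrightarrow> colored_operad (orth_operad C orth)"
  unfolding orth_operad_def by (intro colored_operad.colored_operad_quot category.colored_operad_cat)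

lemma pushforward_orthogonal:
  assumes "orthogonal_category C orth" "is_functor C D L" "category D"
  shows "orthogonal_category D (pushforward_orth D L orth)"
    and "orthogonal_functor C orth D (pushforward_orth D L orth) L"
proof -
  interpret C: orthogonal_category C orth by fact
  interpret D: category D by fact
  have La: "FA L f \<in> Arr D" "Dom D (FA L f) = FO L (Dom C f)" "Cod D (FA L f) = FO L (Cod C f)" if "f \<in> Arr C" for f
    using assms(2) that by (auto simp: is_functor_def hom_def)
  have cmp: "Comp D g f \<in> Arr D \<and> Dom D (Comp D g f) = Dom D f \<and> Cod D (Comp D g f) = Cod D g"
    if "f \<in> Arr D" "g \<in> Arr D" "Cod D f = Dom D g" for f g
    using D.Comp_in[of f "Dom D f" "Cod D f" g "Cod D g"] that by (auto simp: hom_def)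
  have as: "Comp D (Comp D h g) f = Comp D h (Comp D g f)" 
    if "f \<in> Arr D" "g \<in> Arr D" "h \<in> Arr D" "Cod D f = Dom D g" "Cod D g = Dom D h" for f g h
    using that by (intro D.Comp_assoc[of f "Dom D f" "Cod D f" g "Cod D g" h "Cod D h"]) (auto simp: hom_def)
  show "orthogonal_category D (pushforward_orth D L orth)"
  proof
    fix f1 f2 assume "(f1, f2) \<in> pushforward_orth D L orth"
    then obtain g a1 a2 h1 h2 where e: "f1 = Comp D (Comp D g (FA L a1)) h1" "f2 = Comp D (Comp D g (FA L a2)) h2"
      and o: "(a1, a2) \<in> orth" "g \<in> Arr D" "h1 \<in> Arr D" "h2 \<in> Arr D"
        "Dom D g = Cod D (FA L a1)" "Dom D g = Cod D (FA L a2)"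
        "Cod D h1 = Dom D (FA L a1)" "Cod D h2 = Dom D (FA L a2)"
      unfolding pushforward_orth_def by blast
    have a: "a1 \<in> Arr C" "a2 \<in> Arr C" "Cod C a1 = Cod C a2" using C.orth_arr o(1) by auto
    show "f1 \<in> Arr D \<and> f2 \<in> Arr D \<and> Cod D f1 = Cod D f2"
      using o a La unfolding e by (simp add: cmp)
    show "(f2, f1) \<in> pushforward_orth D L orth"
      unfolding pushforward_orth_def e using o C.orth_sym by blast
    fix k assume k: "k \<in> Arr D" "Dom D k = Cod D f1"
    have ck: "Dom D k = Cod D g" using k o a La unfolding e by (simp add: cmp)
    have "Comp D k f1 = Comp D (Comp D (Comp D k g) (FA L a1)) h1" "Comp D k f2 = Comp D (Comp D (Comp D k g) (FA L a2)) h2"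
      unfolding e using o a La k ck by (simp_all add: cmp as)
    then show "(Comp D k f1, Comp D k f2) \<in> pushforward_orth D L orth"
      unfolding pushforward_orth_def using o k ck cmp[of g k]
      by (intro CollectI exI[of _ "Comp D k g"] exI[of _ a1] exI[of _ a2] exI[of _ h1] exI[of _ h2]) auto
  next
    fix f1 f2 k1 k2 assume "(f1, f2) \<in> pushforward_orth D L orth"
    and k: "k1 \<in> Arr D" "k2 \<in> Arr D" "Cod D k1 = Dom D f1" "Cod D k2 = Dom D f2"
    then obtain g a1 a2 h1 h2 where e: "f1 = Comp D (Comp D g (FA L a1)) h1" "f2 = Comp D (Comp D g (FA L a2)) h2"
      and o: "(a1, a2) \<in> orth" "g \<in> Arr D" "h1 \<in> Arr D" "h2 \<in> Arr D"
        "Dom D g = Cod D (FA L a1)" "Dom D g = Cod D (FA L a2)"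
        "Cod D h1 = Dom D (FA L a1)" "Cod D h2 = Dom D (FA L a2)"
      unfolding pushforward_orth_def by blast
    have a: "a1 \<in> Arr C" "a2 \<in> Arr C" "Cod C a1 = Cod C a2" using C.orth_arr o(1) by auto
    have ck: "Cod D k1 = Dom D h1" "Cod D k2 = Dom D h2" using k o a La unfolding e by (simp_all add: cmp)
    have "Comp D f1 k1 = Comp D (Comp D g (FA L a1)) (Comp D h1 k1)" "Comp D f2 k2 = Comp D (Comp D g (FA L a2)) (Comp D h2 k2)"
      unfolding e using o a La k(1,2) ck by (simp_all add: cmp as)
    then show "(Comp D f1 k1, Comp D f2 k2) \<in> pushforward_orth D L orth"
      unfolding pushforward_orth_def using o k(1,2) ck cmp[of k1 h1] cmp[of k2 h2]
      by (intro CollectI exI[of _ g] exI[of _ a1] exI[of _ a2] exI[of _ "Comp D h1 k1"] exI[of _ "Comp D h2 k2"]) auto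
  qed
  show "orthogonal_functor C orth D (pushforward_orth D L orth) L"
    unfolding orthogonal_functor_def
  proof (intro conjI ballI assms, clarify)
    fix f1 f2 assume o: "(f1, f2) \<in> orth"
    have a: "f1 \<in> Arr C" "f2 \<in> Arr C" "Cod C f1 = Cod C f2" using C.orth_arr o by auto
    have id: "Id D x \<in> Arr D \<and> Dom D (Id D x) = x \<and> Cod D (Id D x) = x" if "x \<in> Obj D" for x
      using D.Id_in[OF that] by (simp add: hom_def)
    have ob: "FO L (Dom C f) \<in> Obj D" "FO L (Cod C f) \<in> Obj D" if "f \<in> Arr C" for f
      using La[OF that] D.Dom_in D.Cod_in by metis+
    have e: "Comp D (Comp D (Id D (FO L (Cod C f))) (FA L f)) (Id D (FO L (Dom C f))) = FA L f" if "f \<in> Arr C" for f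
      using D.Comp_Id[of "FA L f" "FO L (Dom C f)" "FO L (Cod C f)"] D.Id_Comp[of "FA L f" "FO L (Dom C f)" "FO L (Cod C f)"] La[OF that]
      by (simp add: hom_def)
    show "(FA L f1, FA L f2) \<in> pushforward_orth D L orth"
      unfolding pushforward_orth_def
      by (intro CollectI exI[of _ "Id D (FO L (Cod C f1))"] exI[of _ f1] exI[of _ f2] exI[of _ "Id D (FO L (Dom C f1))"] exI[of _ "Id D (FO L (Dom C f2))"])
        (use e[of f1] e[of f2] a o La id ob in auto)
  qed
qed

lemma comp_arrs_map:
  assumes F: "is_functor C D F" and l: "length fs = n" "length ys = n"
    and a: "\<And>i. i < n \<Longrightarrow> fs ! i \<in> Arr C"
    "\<And>i j. i < n \<Longrightarrow> j < length (snd (ys ! i)) \<Longrightarrow> snd (ys ! i) ! j \<in> Arr C \<and> Cod C (snd (ys ! i) ! j) = Dom C (fs ! i)"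
  shows "map (FA F) (comp_arrs C fs ys) = comp_arrs D (map (FA F) fs) (map (map_prod id (map (FA F))) ys)"
proof -
  have "map (map (FA F)) (map2 (\<lambda>f y. map (Comp C f) (snd y)) fs ys)
      = map2 (\<lambda>f y. map (Comp D f) (snd y)) (map (FA F) fs) (map (map_prod id (map (FA F))) ys)"
  proof (rule nth_equalityI)
    fix i assume "i < length (map (map (FA F)) (map2 (\<lambda>f y. map (Comp C f) (snd y)) fs ys))"
    then have i: "i < n" using l by simp
    have "map (FA F \<circ> Comp C (fs ! i)) (snd (ys ! i)) = map (Comp D (FA F (fs ! i)) \<circ> FA F) (snd (ys ! i))"
      using F a(1)[OF i] a(2)[OF i] by (intro nth_equalityI) (auto simp: is_functor_def)
    then show "map (map (FA F)) (map2 (\<lambda>f y. map (Comp C f) (snd y)) fs ys) ! i =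
        map2 (\<lambda>f y. map (Comp D f) (snd y)) (map (FA F) fs) (map (map_prod id (map (FA F))) ys) ! i"
      using i l by simp
  qed (use l in auto)
  then show ?thesis unfolding comp_arrs_def by (metis map_concat)
qed

locale orth_fun = C: orthogonal_category C orth + D: orthogonal_category D orth'
  for C :: "('o, 'a, 'y) cat_scheme" and orth and D :: "('p, 'b, 'z) cat_scheme" and orth' +
  fixes F assumes OF: "orthogonal_functor C orth D orth' F"
begin

lemma F: "is_functor C D F" using OF by (simp add: orthogonal_functor_def)

definition "opF = (\<lambda>x::(nat\<Rightarrow>nat) \<times> 'a list. map_prod id (map (FA F)) x)"

lemma F_hom: "f \<in> hom C a b \<Longrightarrow> FA F f \<in> hom D (FO F a) (FO F b)"
  using F by (auto simp: is_functor_def hom_def)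
lemma F_Obj: "a \<in> Obj C \<Longrightarrow> FO F a \<in> Obj D" using F by (auto simp: is_functor_def)

lemma opF_ops: "x \<in> Ops (cat_operad C) t cs \<Longrightarrow> opF x \<in> Ops (cat_operad D) (FO F t) (map (FO F) cs)"
  by (auto simp: cat_operad_ops opF_def F_hom F_Obj)

lemma opF_act: "x \<in> Ops (cat_operad C) t cs \<Longrightarrow> \<sigma> permutes {..<length cs} \<Longrightarrow>
   opF (Act (cat_operad C) t cs \<sigma> x) = Act (cat_operad D) (FO F t) (map (FO F) cs) \<sigma> (opF x)"
  by (cases x) (auto simp: opF_def permute_list_map)

lemma opF_gam: assumes c: "composable (cat_operad C) t ds css x ys"
  shows "opF (Gam (cat_operad C) t ds css x ys) = Gam (cat_operad D) (FO F t) (map (FO F) ds) (map (map (FO F)) css) (opF x) (map opF ys)"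
proof -
  obtain \<sigma> fs where x: "x = (\<sigma>, fs)" by (cases x)
  note c = c[unfolded cat_operad_comp x, simplified]
  have 1: "map length (map (map (FO F)) css) = map length css" by (induction css) auto
  have 2: "map fst (map opF ys) = map fst ys" by (auto simp: opF_def)
  have 3: "map (FA F) (comp_arrs C fs ys) = comp_arrs D (map (FA F) fs) (map opF ys)"
    unfolding opF_def using c by (intro comp_arrs_map[OF F, of _ "length ds"]) (auto simp: hom_def)
  show ?thesis using 3 unfolding x cat_operad_simps 1 by (simp only: opF_def cat_operad_simps map_prod_simp id_apply) (simp only: cat_operad_simps 1 2[unfolded opF_def] )
qed

abbreviation "PC \<equiv> cat_operad C"
abbreviation "PD \<equiv> cat_operad D"
abbreviation "R \<equiv> orth_rel C orth"
abbreviation "R' \<equiv> orth_rel D orth'"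

sublocale PC: colored_operad PC by (rule C.colored_operad_cat)
sublocale PD: colored_operad PD by (rule D.colored_operad_cat)

lemma opF_cong: "operad_cong PC R t cs x y \<Longrightarrow> operad_cong PD R' (FO F t) (map (FO F) cs) (opF x) (opF y)"
proof (induction rule: operad_cong.induct)
  case (base t cs x y)
  from base(1) obtain f1 f2 where o: "(f1, f2) \<in> orth" and t: "t = Cod C f1" "cs = [Dom C f1, Dom C f2]"
    "x = (id, [f1, f2])" "y = (Transposition.transpose 0 1, [f1, f2])" unfolding orth_rel_def by blast
  have a: "f1 \<in> Arr C" "f2 \<in> Arr C" using C.orth_arr o by auto
  have "R' (FO F t) (map (FO F) cs) (opF x) (opF y)" unfolding orth_rel_def
    by (rule exI[of _ "FA F f1"], rule exI[of _ "FA F f2"])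
      (use o a t OF F_hom[of f1 "Dom C f1" "Cod C f1"] F_hom[of f2 "Dom C f2" "Cod C f2"] in \<open>auto simp: opF_def orthogonal_functor_def hom_def\<close>)
  then show ?case using base opF_ops by (intro operad_cong.base) auto
next
  case (refl x t cs) then show ?case by (intro operad_cong.refl opF_ops)
next
  case (sym t cs x y) then show ?case by (metis operad_cong.sym)
next
  case (trans t cs x y z) then show ?case by (metis operad_cong.trans)
next
  case (act t cs x y \<sigma>)
  have xy: "x \<in> Ops PC t cs" "y \<in> Ops PC t cs" using PC.cong_ops act(1) by auto
  have "map (FO F) (permute_list \<sigma> cs) = permute_list \<sigma> (map (FO F) cs)"
    using act(2) by (simp add: permute_list_map)
  then show ?case unfolding opF_act[OF xy(1) act(2)] opF_act[OF xy(2) act(2)]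
    using operad_cong.act[OF act.IH, of \<sigma>] act(2) by simp
next
  case (gam t ds x x' css ys ys')
  have c: "composable PC t ds css x ys" "composable PC t ds css x' ys'"
  proof -
    have 1: "x \<in> Ops PC t ds \<and> x' \<in> Ops PC t ds" by (rule PC.cong_ops) (use gam in blast)
    have 2: "ys ! i \<in> Ops PC (ds ! i) (css ! i) \<and> ys' ! i \<in> Ops PC (ds ! i) (css ! i)" if "i < length ds" for i
      by (rule PC.cong_ops) (use gam that in blast)
    show "composable PC t ds css x ys" "composable PC t ds css x' ys'" using 1 2 gam unfolding composable_def by blast+
  qed
  have "operad_cong PD R' (FO F t) (concat (map (map (FO F)) css))
     (Gam PD (FO F t) (map (FO F) ds) (map (map (FO F)) css) (opF x) (map opF ys))
     (Gam PD (FO F t) (map (FO F) ds) (map (map (FO F)) css) (opF x') (map opF ys'))"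
    by (rule operad_cong.gam) (use gam in auto)
  then show ?case unfolding opF_gam[OF c(1)] opF_gam[OF c(2)] by (simp add: map_concat)
qed

abbreviation "\<phi> \<equiv> orth_operad_map D orth' F"

lemma MO_class: assumes x: "x \<in> Ops PC t cs"
  shows "MO \<phi> t cs (cong_class PC R t cs x) = cong_class PD R' (FO F t) (map (FO F) cs) (opF x)"
proof -
  have "MO \<phi> t cs (cong_class PC R t cs x) = (\<Union>y\<in>cong_class PC R t cs x. cong_class PD R' (FO F t) (map (FO F) cs) (opF y))"
    by (auto simp: orth_operad_map_def opF_def map_prod_def)
  also have "\<dots> = cong_class PD R' (FO F t) (map (FO F) cs) (opF x)"
  proof -
    have "cong_class PD R' (FO F t) (map (FO F) cs) (opF y) = cong_class PD R' (FO F t) (map (FO F) cs) (opF x)"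
      if "y \<in> cong_class PC R t cs x" for y
      using that by (intro PD.class_eq opF_cong operad_cong.sym[of _ _ _ _ x]) (simp add: PC.class_mem)
    moreover have "x \<in> cong_class PC R t cs x" using x by (simp add: PC.class_mem operad_cong.refl)
    ultimately show ?thesis by blast
  qed
  finally show ?thesis .
qed

lemma operad_morphism: "operad_morphism (orth_operad C orth) (orth_operad D orth') \<phi>"
  unfolding operad_morphism_def orth_operad_def
proof (intro conjI allI ballI impI)
  have MC [simp]: "MC \<phi> = FO F" by (simp add: orth_operad_map_def)
  let ?QC = "quotient_operad PC R" let ?QD = "quotient_operad PD R'"
  fix c assume "c \<in> Col ?QC" then show "MC \<phi> c \<in> Col ?QD" using F_Obj by simp
next
  fix t assume t: "t \<in> Col (quotient_operad PC R)"
  have [simp]: "MC \<phi> = FO F" by (simp add: orth_operad_map_def)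
  have "opF (One PC t) = One PD (FO F t)" using F t by (simp add: opF_def is_functor_def)
  then show "MO \<phi> t [t] (One (quotient_operad PC R) t) = One (quotient_operad PD R') (MC \<phi> t)"
    using t PC.One_in[of t] by (simp add: MO_class del: cat_operad_simps(2,5))
next
  have [simp]: "MC \<phi> = FO F" by (simp add: orth_operad_map_def)
  fix t cs X assume "X \<in> Ops (quotient_operad PC R) t cs"
  then obtain x where x: "x \<in> Ops PC t cs" and X: "X = cong_class PC R t cs x" by auto
  show "MO \<phi> t cs X \<in> Ops (quotient_operad PD R') (MC \<phi> t) (map (MC \<phi>) cs)"
    unfolding X MO_class[OF x] using opF_ops[OF x] by simp
  fix \<sigma> assume s: "\<sigma> permutes {..<length cs}"
  show "MO \<phi> t (permute_list \<sigma> cs) (Act (quotient_operad PC R) t cs \<sigma> X) =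
        Act (quotient_operad PD R') (MC \<phi> t) (map (MC \<phi>) cs) \<sigma> (MO \<phi> t cs X)"
    unfolding X PC.quot_Act[OF x s] MO_class[OF x] MO_class[OF PC.Act_in[OF x s]] 
    using PD.quot_Act[OF opF_ops[OF x], of \<sigma> R'] s opF_act[OF x s] by (simp add: permute_list_map)
next
  have [simp]: "MC \<phi> = FO F" by (simp add: orth_operad_map_def)
  fix t ds css X Ys assume "composable (quotient_operad PC R) t ds css X Ys"
  then obtain x ys where c: "composable PC t ds css x ys" and X: "X = cong_class PC R t ds x" and
    Y: "Ys = map (\<lambda>i. cong_class PC R (ds ! i) (css ! i) (ys ! i)) [0..<length ds]" by (rule PC.quot_composable)
  have l: "length ys = length ds" "length css = length ds" "x \<in> Ops PC t ds" "\<And>i. i < length ds \<Longrightarrow> ys ! i \<in> Ops PC (ds ! i) (css ! i)"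
    using c by (auto simp: composable_def)
  have cD: "composable PD (FO F t) (map (FO F) ds) (map (map (FO F)) css) (opF x) (map opF ys)"
    using l by (simp add: composable_def opF_ops)
  have e: "map (\<lambda>i. MO \<phi> (ds ! i) (css ! i) (Ys ! i)) [0..<length ds] =
    map (\<lambda>i. cong_class PD R' (map (FO F) ds ! i) (map (map (FO F)) css ! i) (map opF ys ! i)) [0..<length (map (FO F) ds)]"
    using l unfolding Y by (intro nth_equalityI) (auto simp: MO_class)
  show "MO \<phi> t (concat css) (Gam (quotient_operad PC R) t ds css X Ys) =
        Gam (quotient_operad PD R') (MC \<phi> t) (map (MC \<phi>) ds) (map (map (MC \<phi>)) css) (MO \<phi> t ds X)
          (map (\<lambda>i. MO \<phi> (ds ! i) (css ! i) (Ys ! i)) [0..<length ds])"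
    unfolding e unfolding X Y PC.quot_Gam[OF c] MO_class[OF l(3)] MO_class[OF PC.Gam_in[OF c]]
    using PD.quot_Gam[OF cD, of R'] opF_gam[OF c] by (simp add: map_concat)
qed

end

section \<open>Algebras form a category, and pullback is a functor\<close>

context symmetric_monoidal_category begin

lemma tens_in: "set xs \<subseteq> Obj M \<Longrightarrow> tens M xs \<in> Obj M"
  by (induction xs) (auto simp: Unit_in TO_in)

lemma tens_arr_Id: "set xs \<subseteq> Obj M \<Longrightarrow> tens_arr M (map (Id M) xs) = Id M (tens M xs)"
  by (induction xs) (auto simp: tens_in TA_Id)

lemma tens_arr_in': "(\<And>c. c \<in> set cs \<Longrightarrow> \<psi> c \<in> hom M (a c) (b c)) \<Longrightarrow> tens_arr M (map \<psi> cs) \<in> hom M (tens M (map a cs)) (tens M (map b cs))"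
  by (induction cs) (auto intro: Id_in Unit_in TA_in)

lemma tens_arr_comp: "(\<And>c. c \<in> set cs \<Longrightarrow> \<psi> c \<in> hom M (a c) (b c) \<and> \<chi> c \<in> hom M (b c) (d c)) \<Longrightarrow>
   tens_arr M (map (\<lambda>c. \<chi> c \<cdot> \<psi> c) cs) = tens_arr M (map \<chi> cs) \<cdot> tens_arr M (map \<psi> cs)"
proof (induction cs)
  case Nil show ?case using Comp_Id[OF Id_in[OF Unit_in]] by simp
next
  case (Cons c cs)
  have "TA M (\<chi> c \<cdot> \<psi> c) (tens_arr M (map \<chi> cs) \<cdot> tens_arr M (map \<psi> cs))
    = TA M (\<chi> c) (tens_arr M (map \<chi> cs)) \<cdot> TA M (\<psi> c) (tens_arr M (map \<psi> cs))"
    by (rule TA_Comp[where a="a c" and b="b c" and c="d c" and a'="tens M (map a cs)" and b'="tens M (map b cs)" and c'="tens M (map d cs)"])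
      (use Cons.prems in \<open>auto intro!: tens_arr_in'\<close>)
  then show ?case using Cons by simp
qed

lemma inverse_in: "is_iso M f \<Longrightarrow> inverse_arr M f \<in> hom M (Cod M f) (Dom M f)"
proof -
  assume "is_iso M f"
  then obtain g where g: "is_inverse M f g" by (auto simp: is_iso_def)
  have "g' = g" if "is_inverse M f g'" for g'
  proof -
    have f: "f \<in> hom M (Dom M f) (Cod M f)" using g by (auto simp: is_inverse_def hom_def)
    have gg: "g \<in> hom M (Cod M f) (Dom M f)" "g' \<in> hom M (Cod M f) (Dom M f)"  using g that by (auto simp: is_inverse_def)
    have "g' = g' \<cdot> (f \<cdot> g)" using g gg Comp_Id by (simp add: is_inverse_def)
    also have "\<dots> = (g' \<cdot> f) \<cdot> g" using Comp_assoc[OF gg(1) f gg(2)] by simp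
    also have "\<dots> = g" using that gg Id_Comp by (simp add: is_inverse_def)
    finally show ?thesis .
  qed
  then have "inverse_arr M f = g" using g unfolding inverse_arr_def by blast
  then show ?thesis using g by (simp add: is_inverse_def)
qed

lemma append_iso_in: "set xs \<subseteq> Obj M \<Longrightarrow> set ys \<subseteq> Obj M \<Longrightarrow>
   append_iso M xs ys \<in> hom M (tens M (xs @ ys)) (TO M (tens M xs) (tens M ys))"
proof (induction xs)
  case Nil
  then show ?case using inverse_in[OF LUnit_iso[of "tens M ys"]] LUnit_in[of "tens M ys"] tens_in[of ys]
    by (simp add: hom_def)
next
  case (Cons x xs)
  have o: "x \<in> Obj M" "tens M xs \<in> Obj M" "tens M ys \<in> Obj M" using Cons tens_in by auto
  have 1: "inverse_arr M (Assoc M x (tens M xs) (tens M ys)) \<in> hom M (TO M x (TO M (tens M xs) (tens M ys))) (TO M (TO M x (tens M xs)) (tens M ys))"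
    using inverse_in[OF Assoc_iso[OF o]] Assoc_in[OF o] by (simp add: hom_def)
  have 2: "TA M (Id M x) (append_iso M xs ys) \<in> hom M (TO M x (tens M (xs @ ys))) (TO M x (TO M (tens M xs) (tens M ys)))"
    using Cons o by (intro TA_in Id_in) auto
  show ?case using Comp_in[OF 2 1] by simp
qed

lemma concat_iso_in: "\<forall>xs\<in>set xss. set xs \<subseteq> Obj M \<Longrightarrow>
   concat_iso M xss \<in> hom M (tens M (concat xss)) (tens M (map (tens M) xss))"
proof (induction xss)
  case Nil then show ?case by (simp add: Id_in Unit_in)
next
  case (Cons xs xss)
  have 1: "append_iso M xs (concat xss) \<in> hom M (tens M (xs @ concat xss)) (TO M (tens M xs) (tens M (concat xss)))"
    using Cons by (intro append_iso_in) auto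
  have 2: "TA M (Id M (tens M xs)) (concat_iso M xss) \<in> hom M (TO M (tens M xs) (tens M (concat xss))) (TO M (tens M xs) (tens M (map (tens M) xss)))"
    using Cons by (intro TA_in Id_in tens_in) auto
  show ?case using Comp_in[OF 1 2] by simp
qed

lemma set_delete: "set (delete_nth k xs) \<subseteq> set xs"
  by (auto simp: delete_nth_def dest: in_set_takeD in_set_dropD)

lemma insert_iso_in: "set xs \<subseteq> Obj M \<Longrightarrow> k < length xs \<Longrightarrow>
   insert_iso M k xs \<in> hom M (TO M (xs ! k) (tens M (delete_nth k xs))) (tens M xs)"
proof (induction M\<equiv>M k xs rule: insert_iso.induct)
  case (1 xs)
  then show ?case using tens_in[of xs] Id_in by (cases xs) (auto simp: delete_nth_def)
next
  case (3 k x xs)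
  let ?y = "xs ! k" let ?r = "tens M (delete_nth k xs)"
  have o: "x \<in> Obj M" "?y \<in> Obj M" "?r \<in> Obj M" using 3 set_delete[of k xs] by (auto intro!: tens_in)
  have IH: "insert_iso M k xs \<in> hom M (TO M ?y ?r) (tens M xs)" using 3 by auto
  have a: "inverse_arr M (Assoc M ?y x ?r) \<in> hom M (TO M ?y (TO M x ?r)) (TO M (TO M ?y x) ?r)"
    using inverse_in[OF Assoc_iso[OF o(2,1,3)]] Assoc_in[OF o(2,1,3)] by (simp add: hom_def)
  have b: "TA M (Braid M ?y x) (Id M ?r) \<in> hom M (TO M (TO M ?y x) ?r) (TO M (TO M x ?y) ?r)"
    using Braid_in[OF o(2,1)] Id_in[OF o(3)] TA_in by (simp)
  have c: "Assoc M x ?y ?r \<in> hom M (TO M (TO M x ?y) ?r) (TO M x (TO M ?y ?r))"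
    using Assoc_in[OF o] by (simp)
  have d: "TA M (Id M x) (insert_iso M k xs) \<in> hom M (TO M x (TO M ?y ?r)) (TO M x (tens M xs))"
    using IH Id_in[OF o(1)] TA_in by (simp)
  show ?case using Comp_in[OF Comp_in[OF Comp_in[OF a b] c] d] by (simp add: Let_def delete_nth_def)
qed simp

lemma permute_list_Suc:
  assumes s: "\<sigma> permutes {..<Suc n}" and l: "length xs = Suc n"
  shows "permute_list \<sigma> xs = xs ! \<sigma> 0 # permute_list (delete_perm \<sigma>) (delete_nth (\<sigma> 0) xs)"
    and "delete_perm \<sigma> ` {..<n} \<subseteq> {..<n}" and "inj_on (delete_perm \<sigma>) {..<n}"
proof -
  have s0: "\<sigma> 0 < Suc n" using s permutes_nat_less by blast
  have si: "\<sigma> (Suc i) < Suc n" "\<sigma> (Suc i) \<noteq> \<sigma> 0" if "i < n" for i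
    using s permutes_nat_less[of \<sigma> "Suc n" "Suc i"] that permutes_inj[OF s] by (auto dest: injD)
  show "delete_perm \<sigma> ` {..<n} \<subseteq> {..<n}" using si s0 by (force simp: delete_perm_def)
  show "inj_on (delete_perm \<sigma>) {..<n}"
  proof
    fix i j assume "i \<in> {..<n}" "j \<in> {..<n}" "delete_perm \<sigma> i = delete_perm \<sigma> j"
    then have "\<sigma> (Suc i) = \<sigma> (Suc j)" using si[of i] si[of j] s0 by (auto simp: delete_perm_def split: if_splits)
    then show "i = j" using permutes_inj[OF s] by (auto dest: injD)
  qed
  have ld: "length (delete_nth (\<sigma> 0) xs) = n" using s0 l by (simp add: delete_nth_def)
  show "permute_list \<sigma> xs = xs ! \<sigma> 0 # permute_list (delete_perm \<sigma>) (delete_nth (\<sigma> 0) xs)"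
  proof (rule nth_equalityI)
    fix i assume "i < length (permute_list \<sigma> xs)"
    then have i: "i < Suc n" using l by simp
    show "permute_list \<sigma> xs ! i = (xs ! \<sigma> 0 # permute_list (delete_perm \<sigma>) (delete_nth (\<sigma> 0) xs)) ! i"
    proof (cases i)
      case 0 then show ?thesis using l by (simp add: permute_list_def del: upt_Suc)
    next
      case (Suc k)
      then show ?thesis using i l ld si[of k] s0
        by (auto simp: permute_list_def delete_perm_def delete_nth_def nth_append min_def simp del: upt_Suc)
    qed
  qed (simp add: l ld)
qed

end

context symmetric_monoidal_category begin

lemma perm_iso_in: "set xs \<subseteq> Obj M \<Longrightarrow> length xs = n \<Longrightarrow> inj_on \<sigma> {..<n} \<Longrightarrow> \<sigma> ` {..<n} \<subseteq> {..<n} \<Longrightarrow>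
  perm_iso M n \<sigma> xs \<in> hom M (tens M (permute_list \<sigma> xs)) (tens M xs)"
proof (induction n arbitrary: \<sigma> xs)
  case 0 then show ?case using Id_in[OF Unit_in] by simp
next
  case (Suc n)
  define \<rho> where "\<rho> = (\<lambda>i. if i < Suc n then \<sigma> i else i)"
  have r: "\<rho> permutes {..<Suc n}" unfolding \<rho>_def
    by (rule permutesI_nat) (use Suc in \<open>auto simp: inj_on_def image_subset_iff\<close>)
  have s0: "\<sigma> 0 < Suc n" using Suc by auto
  have d: "delete_perm \<rho> i = delete_perm \<sigma> i" if "i < n" for i using that by (simp add: \<rho>_def delete_perm_def)
  have ld: "length (delete_nth (\<sigma> 0) xs) = n" using s0 Suc.prems by (simp add: delete_nth_def)
  have pl: "permute_list \<sigma> xs = xs ! \<sigma> 0 # permute_list (delete_perm \<sigma>) (delete_nth (\<sigma> 0) xs)"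
    and i: "inj_on (delete_perm \<sigma>) {..<n}" and im: "delete_perm \<sigma> ` {..<n} \<subseteq> {..<n}"
  proof -
    have "permute_list \<sigma> xs = permute_list \<rho> xs" using Suc.prems by (auto simp: permute_list_def \<rho>_def)
    moreover have "permute_list (delete_perm \<sigma>) (delete_nth (\<sigma> 0) xs) = permute_list (delete_perm \<rho>) (delete_nth (\<sigma> 0) xs)"
      using d ld by (auto simp: permute_list_def)
    ultimately show "permute_list \<sigma> xs = xs ! \<sigma> 0 # permute_list (delete_perm \<sigma>) (delete_nth (\<sigma> 0) xs)"
      using permute_list_Suc(1)[OF r Suc.prems(2)] by (simp add: \<rho>_def)
    show "inj_on (delete_perm \<sigma>) {..<n}" "delete_perm \<sigma> ` {..<n} \<subseteq> {..<n}"
      using permute_list_Suc(2,3)[OF r Suc.prems(2)] d by (auto simp: inj_on_def image_subset_iff)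
  qed
  have o: "xs ! \<sigma> 0 \<in> Obj M" "set (delete_nth (\<sigma> 0) xs) \<subseteq> Obj M" using Suc.prems s0 set_delete[of "\<sigma> 0" xs] by (auto intro!: subsetD[OF Suc.prems(1)])
  have 1: "TA M (Id M (xs ! \<sigma> 0)) (perm_iso M n (delete_perm \<sigma>) (delete_nth (\<sigma> 0) xs)) \<in>
     hom M (TO M (xs ! \<sigma> 0) (tens M (permute_list (delete_perm \<sigma>) (delete_nth (\<sigma> 0) xs)))) (TO M (xs ! \<sigma> 0) (tens M (delete_nth (\<sigma> 0) xs)))"
    using Suc.IH[OF o(2) ld i im] Id_in[OF o(1)] TA_in by (simp)
  have 2: "insert_iso M (\<sigma> 0) xs \<in> hom M (TO M (xs ! \<sigma> 0) (tens M (delete_nth (\<sigma> 0) xs))) (tens M xs)"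
    using Suc.prems s0 by (intro insert_iso_in) auto
  show ?case using Comp_in[OF 1 2] pl by simp
qed

lemma AlgI: "(A, B, \<psi>) \<in> hom (Alg M P) A' B' \<longleftrightarrow> A = A' \<and> B = B' \<and> is_algebra M P A \<and> is_algebra M P B \<and> is_algebra_morphism M P A B \<psi>"
  by (auto simp: Alg_def hom_def)

lemma category_Alg: assumes "colored_operad P" shows "category (Alg M P)"
proof -
  interpret P: colored_operad P by fact
  have id: "is_algebra_morphism M P A A (\<lambda>c\<in>Col P. Id M (AO A c))" if A: "is_algebra M P A" for A
    unfolding is_algebra_morphism_def
  proof (intro conjI ballI allI)
    fix t cs x assume x: "x \<in> Ops P t cs"
    have t: "t \<in> Col P" "set cs \<subseteq> Col P" using P.Ops_col x by auto
    have a: "AA A t cs x \<in> hom M (tens M (map (AO A) cs)) (AO A t)" using A x by (auto simp: is_algebra_def)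
    have e: "map (\<lambda>c\<in>Col P. Id M (AO A c)) cs = map (Id M) (map (AO A) cs)" using t by auto
    have "set (map (AO A) cs) \<subseteq> Obj M" using t A by (auto simp: is_algebra_def)
    then show "(\<lambda>c\<in>Col P. Id M (AO A c)) t \<cdot> AA A t cs x = AA A t cs x \<cdot> tens_arr M (map (\<lambda>c\<in>Col P. Id M (AO A c)) cs)"
      unfolding e using a t tens_arr_Id Id_Comp[OF a] Comp_Id[OF a] by (simp del: map_map)
  qed (use A in \<open>auto simp: is_algebra_def Id_in\<close>)
  have cmp: "is_algebra_morphism M P A D (\<lambda>c\<in>Col P. \<chi> c \<cdot> \<psi> c)"
    if A: "is_algebra M P A" "is_algebra M P B" "is_algebra M P D"
      and m: "is_algebra_morphism M P A B \<psi>" "is_algebra_morphism M P B D \<chi>" for A B D \<psi> \<chi>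
    unfolding is_algebra_morphism_def
  proof (intro conjI ballI allI)
    have h: "\<psi> c \<in> hom M (AO A c) (AO B c)" "\<chi> c \<in> hom M (AO B c) (AO D c)" if "c \<in> Col P" for c
      using m that by (auto simp: is_algebra_morphism_def)
    then show "(\<lambda>c\<in>Col P. \<chi> c \<cdot> \<psi> c) c \<in> hom M (AO A c) (AO D c)" if "c \<in> Col P" for c
      using that Comp_in[OF h] by auto
    fix t cs x assume x: "x \<in> Ops P t cs"
    have t: "t \<in> Col P" "set cs \<subseteq> Col P" using P.Ops_col x by auto
    have a: "AA A t cs x \<in> hom M (tens M (map (AO A) cs)) (AO A t)" "AA B t cs x \<in> hom M (tens M (map (AO B) cs)) (AO B t)"
       "AA D t cs x \<in> hom M (tens M (map (AO D) cs)) (AO D t)" using A x by (auto simp: is_algebra_def)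
    have e: "\<psi> t \<cdot> AA A t cs x = AA B t cs x \<cdot> tens_arr M (map \<psi> cs)" "\<chi> t \<cdot> AA B t cs x = AA D t cs x \<cdot> tens_arr M (map \<chi> cs)"
      using m x by (auto simp: is_algebra_morphism_def)
    have tp: "tens_arr M (map \<psi> cs) \<in> hom M (tens M (map (AO A) cs)) (tens M (map (AO B) cs))"
      "tens_arr M (map \<chi> cs) \<in> hom M (tens M (map (AO B) cs)) (tens M (map (AO D) cs))"
      using h t by (auto intro!: tens_arr_in')
    have e': "map (\<lambda>c\<in>Col P. \<chi> c \<cdot> \<psi> c) cs = map (\<lambda>c. \<chi> c \<cdot> \<psi> c) cs" using t by auto
    have "tens_arr M (map (\<lambda>c. \<chi> c \<cdot> \<psi> c) cs) = tens_arr M (map \<chi> cs) \<cdot> tens_arr M (map \<psi> cs)"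
      using h t by (intro tens_arr_comp[where a="AO A" and b="AO B" and d="AO D"]) auto
    moreover have "(\<chi> t \<cdot> \<psi> t) \<cdot> AA A t cs x = AA D t cs x \<cdot> (tens_arr M (map \<chi> cs) \<cdot> tens_arr M (map \<psi> cs))"
      using Comp_assoc[OF a(1) h(1) h(2)] Comp_assoc[OF tp(1) a(2) h(2)] Comp_assoc[OF tp(1,2) a(3)] e t by simp
    ultimately show "(\<lambda>c\<in>Col P. \<chi> c \<cdot> \<psi> c) t \<cdot> AA A t cs x = AA D t cs x \<cdot> tens_arr M (map (\<lambda>c\<in>Col P. \<chi> c \<cdot> \<psi> c) cs)"
      unfolding e' using t by simp
  qed simp
  have ex: "\<psi> = \<chi>" if "\<psi> \<in> extensional (Col P)" "\<chi> \<in> extensional (Col P)" "\<And>c. c \<in> Col P \<Longrightarrow> \<psi> c = \<chi> c" for \<psi> \<chi> :: "_ \<Rightarrow> 'm"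
    using that by (rule extensionalityI)
  let ?A = "Alg M P"
  have s: "Dom ?A (A, B, \<psi>) = A" "Cod ?A (A, B, \<psi>) = B" "Obj ?A = {A. is_algebra M P A}"
    "Arr ?A = {(A, B, \<psi>). is_algebra M P A \<and> is_algebra M P B \<and> is_algebra_morphism M P A B \<psi>}"
    "Id ?A A = (A, A, \<lambda>c\<in>Col P. Id M (AO A c))" "Comp ?A (B', D, \<chi>) (A, B, \<psi>) = (A, D, \<lambda>c\<in>Col P. Comp M (\<chi> c) (\<psi> c))"
    for A B B' D \<psi> \<chi> by (simp_all add: Alg_def)
  show ?thesis
  proof
    fix f assume "f \<in> Arr ?A" then show "Dom ?A f \<in> Obj ?A" "Cod ?A f \<in> Obj ?A" by (auto simp: s)
  next
    fix a assume "a \<in> Obj ?A" then show "Id ?A a \<in> hom ?A a a" by (auto simp: s AlgI id)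
  next
    fix f a b g c assume "f \<in> hom ?A a b" "g \<in> hom ?A b c"
    then show "Comp ?A g f \<in> hom ?A a c" by (cases f; cases g) (auto simp: s AlgI intro: cmp)
  next
    fix f a b assume "f \<in> hom ?A a b"
    then obtain \<psi> where f: "f = (a, b, \<psi>)" "is_algebra_morphism M P a b \<psi>" by (cases f) (auto simp: AlgI)
    have h: "\<psi> \<in> extensional (Col P)" "c \<in> Col P \<Longrightarrow> \<psi> c \<in> hom M (AO a c) (AO b c)" for c using f by (auto simp: is_algebra_morphism_def)
    show "Comp ?A f (Id ?A a) = f" "Comp ?A (Id ?A b) f = f"
      using h by (auto simp: f s intro!: ex Comp_Id Id_Comp)
  next
    fix f a b g c h d assume "f \<in> hom ?A a b" "g \<in> hom ?A b c" "h \<in> hom ?A c d"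
    then obtain \<psi> \<chi> \<omega> where f: "f = (a, b, \<psi>)" "is_algebra_morphism M P a b \<psi>"
      "g = (b, c, \<chi>)" "is_algebra_morphism M P b c \<chi>" "h = (c, d, \<omega>)" "is_algebra_morphism M P c d \<omega>"
      by (cases f; cases g; cases h) (auto simp: AlgI)
    have hh: "\<psi> i \<in> hom M (AO a i) (AO b i)" "\<chi> i \<in> hom M (AO b i) (AO c i)" "\<omega> i \<in> hom M (AO c i) (AO d i)" if "i \<in> Col P" for i
      using f that by (auto simp: is_algebra_morphism_def)
    have "(\<lambda>i\<in>Col P. (\<lambda>j\<in>Col P. \<omega> j \<cdot> \<chi> j) i \<cdot> \<psi> i) = (\<lambda>i\<in>Col P. \<omega> i \<cdot> (\<lambda>j\<in>Col P. \<chi> j \<cdot> \<psi> j) i)"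
      by (rule ex) (auto intro: Comp_assoc[OF hh])
    then show "Comp ?A (Comp ?A h g) f = Comp ?A h (Comp ?A g f)"
      by (simp add: f s)
  qed
qed

lemma pullback_is_functor:
  assumes P: "colored_operad P" and m: "operad_morphism P Q \<phi>"
  shows "is_functor (Alg M Q) (Alg M P) (pullback_functor P \<phi>)"
proof -
  interpret P: colored_operad P by fact
  let ?pb = "pullback_alg P \<phi>"
  have col: "c \<in> Col P \<Longrightarrow> MC \<phi> c \<in> Col Q" for c using m by (auto simp: operad_morphism_def)
  have op: "x \<in> Ops P t cs \<Longrightarrow> MO \<phi> t cs x \<in> Ops Q (MC \<phi> t) (map (MC \<phi>) cs)" for x t cs using m by (auto simp: operad_morphism_def)
  have AOm: "map (AO (?pb B)) cs = map (AO B) (map (MC \<phi>) cs)" if "set cs \<subseteq> Col P" for B :: "(_,_,'o,'m) alg" and cs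
    using that by (auto simp: pullback_alg_def)
  have AAp: "AA (?pb B) t cs x = AA B (MC \<phi> t) (map (MC \<phi>) cs) (MO \<phi> t cs x)" if "x \<in> Ops P t cs" for B :: "(_,_,'o,'m) alg" and t cs x
    using that by (simp add: pullback_alg_def)
  have AOp: "AO (?pb B) c = AO B (MC \<phi> c)" if "c \<in> Col P" for B :: "(_,_,'o,'m) alg" and c
    using that by (simp add: pullback_alg_def)
  have alg: "is_algebra M P (?pb B)" if B: "is_algebra M Q B" for B
    unfolding is_algebra_def
  proof (intro conjI allI ballI impI)
    show "AO (?pb B) \<in> extensional (Col P)" by (simp add: pullback_alg_def)
    show "AA (?pb B) t cs x = undefined" if "x \<notin> Ops P t cs" for t cs x using that by (simp add: pullback_alg_def)
    show "AO (?pb B) c \<in> Obj M" if "c \<in> Col P" for c using that B col by (auto simp: AOp is_algebra_def)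
    show "AA (?pb B) t [t] (One P t) = RUnit M (AO (?pb B) t)" if t: "t \<in> Col P" for t
      using P.One_in[OF t] AAp[OF P.One_in[OF t]] AOp[OF t] m t B col by (auto simp: operad_morphism_def is_algebra_def)
    fix t cs x assume x: "x \<in> Ops P t cs"
    note t = P.Ops_col[OF x]
    show "AA (?pb B) t cs x \<in> hom M (tens M (map (AO (?pb B)) cs)) (AO (?pb B) t)"
      using B op[OF x] t unfolding AAp[OF x] by (simp add: AOm AOp is_algebra_def del: map_map)
    fix \<sigma> assume s: "\<sigma> permutes {..<length cs}"
    have "MO \<phi> t (permute_list \<sigma> cs) (Act P t cs \<sigma> x) = Act Q (MC \<phi> t) (map (MC \<phi>) cs) \<sigma> (MO \<phi> t cs x)"
      using m x s by (auto simp: operad_morphism_def)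
    moreover have "map (MC \<phi>) (permute_list \<sigma> cs) = permute_list \<sigma> (map (MC \<phi>) cs)" using s by (simp add: permute_list_map)
    moreover have "AA B (MC \<phi> t) (permute_list \<sigma> (map (MC \<phi>) cs)) (Act Q (MC \<phi> t) (map (MC \<phi>) cs) \<sigma> (MO \<phi> t cs x)) =
      AA B (MC \<phi> t) (map (MC \<phi>) cs) (MO \<phi> t cs x) \<cdot> perm_iso M (length (map (MC \<phi>) cs)) \<sigma> (map (AO B) (map (MC \<phi>) cs))"
    proof -
      have "\<sigma> permutes {..<length (map (MC \<phi>) cs)}" using s by simp
      then show ?thesis using B op[OF x] unfolding is_algebra_def by blast
    qed
    ultimately show "AA (?pb B) t (permute_list \<sigma> cs) (Act P t cs \<sigma> x) = AA (?pb B) t cs x \<cdot> perm_iso M (length cs) \<sigma> (map (AO (?pb B)) cs)"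
      unfolding AAp[OF x] AAp[OF P.Act_in[OF x s]] using t by (simp add: AOm del: map_map)
  next
    fix t ds css x ys assume c: "composable P t ds css x ys"
    have l: "length ys = length ds" "length css = length ds" "x \<in> Ops P t ds" "\<And>i. i < length ds \<Longrightarrow> ys ! i \<in> Ops P (ds ! i) (css ! i)"
      using c by (auto simp: composable_def)
    let ?ys = "map (\<lambda>i. MO \<phi> (ds ! i) (css ! i) (ys ! i)) [0..<length ds]"
    have c': "composable Q (MC \<phi> t) (map (MC \<phi>) ds) (map (map (MC \<phi>)) css) (MO \<phi> t ds x) ?ys"
      using l op by (auto simp: composable_def)
    have e: "MO \<phi> t (concat css) (Gam P t ds css x ys) = Gam Q (MC \<phi> t) (map (MC \<phi>) ds) (map (map (MC \<phi>)) css) (MO \<phi> t ds x) ?ys"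
      using m c unfolding operad_morphism_def by blast
    have f: "AA B (MC \<phi> t) (concat (map (map (MC \<phi>)) css)) (Gam Q (MC \<phi> t) (map (MC \<phi>) ds) (map (map (MC \<phi>)) css) (MO \<phi> t ds x) ?ys)
      = AA B (MC \<phi> t) (map (MC \<phi>) ds) (MO \<phi> t ds x) \<cdot> (tens_arr M (map (\<lambda>i. AA B (map (MC \<phi>) ds ! i) (map (map (MC \<phi>)) css ! i) (?ys ! i)) [0..<length (map (MC \<phi>) ds)])
         \<cdot> concat_iso M (map (map (AO B)) (map (map (MC \<phi>)) css)))"
      using B c' unfolding is_algebra_def by blast
    have g: "map (\<lambda>i. AA B (map (MC \<phi>) ds ! i) (map (map (MC \<phi>)) css ! i) (?ys ! i)) [0..<length (map (MC \<phi>) ds)]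
      = map (\<lambda>i. AA (?pb B) (ds ! i) (css ! i) (ys ! i)) [0..<length ds]"
      using l by (auto simp: AAp)
    have h: "map (map (AO (?pb B))) css = map (map (AO B)) (map (map (MC \<phi>)) css)"
    proof (rule nth_equalityI)
      fix i assume "i < length (map (map (AO (?pb B))) css)"
      then have i: "i < length css" "i < length ds" using l by auto
      have "set (css ! i) \<subseteq> Col P" using P.Ops_col[OF l(4)[OF i(2)]] by simp
      then show "map (map (AO (?pb B))) css ! i = map (map (AO B)) (map (map (MC \<phi>)) css) ! i" using i by (simp add: AOm del: map_map)
    qed simp
    show "AA (?pb B) t (concat css) (Gam P t ds css x ys) = AA (?pb B) t ds x \<cdot>
          (tens_arr M (map (\<lambda>i. AA (?pb B) (ds ! i) (css ! i) (ys ! i)) [0..<length ds]) \<cdot> concat_iso M (map (map (AO (?pb B))) css))"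
      unfolding AAp[OF P.Gam_in[OF c]] e AAp[OF l(3)] h g[symmetric] f[symmetric] by (simp only: map_concat)
  qed
  have mor: "is_algebra_morphism M P (?pb A) (?pb B) (\<lambda>c\<in>Col P. \<psi> (MC \<phi> c))" if "is_algebra_morphism M Q A B \<psi>" for A B \<psi>
    unfolding is_algebra_morphism_def
  proof (intro conjI allI ballI)
    fix c assume "c \<in> Col P" then show "(\<lambda>c\<in>Col P. \<psi> (MC \<phi> c)) c \<in> hom M (AO (?pb A) c) (AO (?pb B) c)"
      using that col by (auto simp: AOp is_algebra_morphism_def)
  next
    fix t cs x assume x: "x \<in> Ops P t cs"
    note t = P.Ops_col[OF x]
    have e: "map (\<lambda>c\<in>Col P. \<psi> (MC \<phi> c)) cs = map \<psi> (map (MC \<phi>) cs)" using t by auto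
    show "(\<lambda>c\<in>Col P. \<psi> (MC \<phi> c)) t \<cdot> AA (?pb A) t cs x = AA (?pb B) t cs x \<cdot> tens_arr M (map (\<lambda>c\<in>Col P. \<psi> (MC \<phi> c)) cs)"
      unfolding e AAp[OF x] using that op[OF x] t by (simp add: is_algebra_morphism_def del: map_map)
  qed simp
  have s: "Dom (Alg M Q) (A, B, \<psi>) = A" "Cod (Alg M Q) (A, B, \<psi>) = B" "Obj (Alg M Q) = {A. is_algebra M Q A}"
    "Arr (Alg M Q) = {(A, B, \<psi>). is_algebra M Q A \<and> is_algebra M Q B \<and> is_algebra_morphism M Q A B \<psi>}"
    "Id (Alg M Q) A = (A, A, \<lambda>c\<in>Col Q. Id M (AO A c))" "Comp (Alg M Q) (B', D, \<chi>) (A, B, \<psi>) = (A, D, \<lambda>c\<in>Col Q. Comp M (\<chi> c) (\<psi> c))"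
    for A B B' D \<psi> \<chi> by (simp_all add: Alg_def)
  have s': "Obj (Alg M P) = {A. is_algebra M P A}"
    "Id (Alg M P) A = (A, A, \<lambda>c\<in>Col P. Id M (AO A c))" "Comp (Alg M P) (B', D, \<chi>) (A, B, \<psi>) = (A, D, \<lambda>c\<in>Col P. Comp M (\<chi> c) (\<psi> c))"
    for A B' D B \<psi> \<chi> by (simp_all add: Alg_def)
  have pf: "FO (pullback_functor P \<phi>) = ?pb" "FA (pullback_functor P \<phi>) (A, B, \<psi>) = (?pb A, ?pb B, \<lambda>c\<in>Col P. \<psi> (MC \<phi> c))"
    for A B :: "(_,_,'o,'m) alg" and \<psi> by (simp_all add: pullback_functor_def)
  show ?thesis unfolding is_functor_def
    by (auto simp: s s' pf AlgI alg mor AOp col intro!: restrict_ext)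
qed

end

lemma is_functor_pullback_localization:
  assumes "closed_symmetric_monoidal_category M" "orthogonal_category C orth" "is_localization C W CW L"
  shows "is_functor (Alg M (orth_operad CW (pushforward_orth CW L orth))) (Alg M (orth_operad C orth))
    (pullback_functor (orth_operad C orth) (orth_operad_map CW (pushforward_orth CW L orth) L))"
proof -
  interpret closed_symmetric_monoidal_category M by fact
  have D: "category CW" "is_functor C CW L" using assms(3) by (auto simp: is_localization_def)
  interpret orth_fun C orth CW "pushforward_orth CW L orth" L
    using pushforward_orthogonal[OF assms(2) D(2,1)] assms(2) by (simp add: orth_fun_def orth_fun_axioms_def)
  show ?thesis by (intro pullback_is_functor colored_operad_orth operad_morphism C.category_axioms)
qed

end

theory Submission
  imports Defs
begin

text \<open>The counit of an adjunction is invertible as soon as the right adjoint is fully faithful, so it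
  suffices to show this for the pullback functor. The localization \<open>L\<close> is bijective on
  objects, which gives faithfulness and determines the only possible lift of a morphism of pulled back
  algebras. This lift commutes with the operations coming from \<open>C\<close>; the operations with which it
  commutes are closed under composition and under inverses of unary operations, and \<open>C[W\<inverse>]\<close> is
  generated by the images of arrows of \<open>C\<close> and the inverses of those of \<open>W\<close>.\<close>

text \<open>Nothing is known of the left adjoint beyond the adjunction itself, so all information
  has to be read off the right adjoint. Likewise the localization is given only by its universal
  property among categories on \<open>'u\<close>; facts about its objects and arrows are obtained by
  mapping it into categories built for the purpose. The algebras are kept in operadic form instead
  of being turned into functors to monoids. The price is that iterated tensor products end in the
  unit: a unary operation with input color \<open>a\<close> acts on
  \<open>AO A a \<otimes> Unit M\<close>, so mutually inverse arrows act by maps that are inverse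
  only up to a right unitor and the rebracketing \<open>concat_iso\<close>. Naturality and
  invertibility of \<open>concat_iso\<close> carry the argument through this.\<close>

section \<open>Counits and fully faithful right adjoints\<close>

text \<open>The inverse of the counit at \<open>y\<close> is the lift \<open>\<theta>\<close> of the
  unit at \<open>FO G y\<close> along \<open>G\<close>. One composite is an identity by
  faithfulness, because \<open>G\<close> turns it into a triangle identity; the other by naturality
  of \<open>\<epsilon>\<close> at \<open>\<theta>\<close> and the second triangle identity.\<close>

lemma counit_natural_isomorphism:
  assumes "category A" "category B" and adj: "adjunction A B F G \<eta> \<epsilon>"
    and full: "\<And>x y g. x \<in> Obj B \<Longrightarrow> y \<in> Obj B \<Longrightarrow> g \<in> hom A (FO G x) (FO G y) \<Longrightarrow>
      \<exists>f\<in>hom B x y. FA G f = g"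
    and faithful: "\<And>x y f f'. f \<in> hom B x y \<Longrightarrow> f' \<in> hom B x y \<Longrightarrow> FA G f = FA G f' \<Longrightarrow> f = f'"
  shows "natural_isomorphism B B (F \<circ>\<^sub>F G) id_functor \<epsilon>"
  unfolding natural_isomorphism_def
proof (intro conjI ballI)
  interpret A: category A by fact
  interpret B: category B by fact
  have functors: "is_functor A B F" "is_functor B A G" using adj by (auto simp: adjunction_def)
  have Gc: "FA G (Comp B g f) = Comp A (FA G g) (FA G f)" if "f \<in> hom B a b" "g \<in> hom B b c" for f g a b c
    using functors(2) that by (auto simp: is_functor_def hom_def)
  show "natural_transformation B B (F \<circ>\<^sub>F G) id_functor \<epsilon>"
    using adj by (auto simp: adjunction_def)
  have \<epsilon>h: "\<epsilon> y \<in> hom B (FO F (FO G y)) y" if "y \<in> Obj B" for y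
    using adj that by (auto simp: adjunction_def natural_transformation_def comp_functor_def id_functor_def)
  have \<epsilon>n: "Comp B (\<epsilon> b) (FA F (FA G f)) = Comp B f (\<epsilon> a)" if "f \<in> hom B a b" for f a b
    using adj that by (auto simp: adjunction_def natural_transformation_def comp_functor_def id_functor_def hom_def)
  have \<eta>h: "\<eta> x \<in> hom A x (FO G (FO F x))" if "x \<in> Obj A" for x
    using adj that by (auto simp: adjunction_def natural_transformation_def comp_functor_def id_functor_def)
  have z: "Comp B (\<epsilon> (FO F x)) (FA F (\<eta> x)) = Id B (FO F x)" if "x \<in> Obj A" for x
    using adj that by (auto simp: adjunction_def)
  have z': "Comp A (FA G (\<epsilon> y)) (\<eta> (FO G y)) = Id A (FO G y)" if "y \<in> Obj B" for y
    using adj that by (auto simp: adjunction_def)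
  fix y assume y: "y \<in> Obj B"
  let ?Gy = "FO G y" let ?FGy = "FO F ?Gy"
  have Gy: "?Gy \<in> Obj A" using functors(2) y by (auto simp: is_functor_def)
  have FGy: "?FGy \<in> Obj B" using functors(1) Gy by (auto simp: is_functor_def)
  obtain \<theta> where \<theta>: "\<theta> \<in> hom B y ?FGy" "FA G \<theta> = \<eta> ?Gy"
    using full[OF y FGy \<eta>h[OF Gy]] by blast
  have "Comp B (\<epsilon> y) \<theta> = Id B y"
  proof (rule faithful[of _ y y])
    show "FA G (Comp B (\<epsilon> y) \<theta>) = FA G (Id B y)"
      using Gc[OF \<theta>(1) \<epsilon>h[OF y]] \<theta>(2) z'[OF y] functors(2) y by (simp add: is_functor_def)
  qed (use B.Comp_in[OF \<theta>(1) \<epsilon>h[OF y]] B.Id_in[OF y] in auto)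
  moreover have "Comp B \<theta> (\<epsilon> y) = Id B ?FGy"
    using \<epsilon>n[OF \<theta>(1)] \<theta>(2) z[OF Gy] by simp
  ultimately have "is_inverse B (\<epsilon> y) \<theta>"
    using \<epsilon>h[OF y] \<theta>(1) by (auto simp: is_inverse_def hom_def)
  then show "is_iso B (\<epsilon> y)" by (auto simp: is_iso_def)
qed

section \<open>Consequences of the universal property of the localization\<close>

text \<open>The universal property is applied to \<open>L\<close> itself; both endofunctors agree
  with the one factorization it provides.\<close>

lemma is_localization_unique:
  assumes "is_localization C W D L" "is_functor D D G" "is_functor D D H"
    and "functor_eq C (G \<circ>\<^sub>F L) L" "functor_eq C (H \<circ>\<^sub>F L) L"
  shows "functor_eq D G H"
proof -
  have "\<exists>G0. \<forall>G'. is_functor D D G' \<and> functor_eq C (G' \<circ>\<^sub>F L) L \<longrightarrow> functor_eq D G' G0"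
    using assms(1) unfolding is_localization_def by blast
  then show ?thesis using assms(2-) unfolding functor_eq_def by metis
qed

text \<open>The arrows satisfying \<open>P\<close> form a subcategory through which \<open>L\<close> factors; composing the
  induced functor with the inclusion gives an endofunctor under \<open>C\<close>, which is the identity.\<close>

lemma localization_generated:
  assumes "category C" "W \<subseteq> Arr C" and loc: "is_localization C W D L"
    and P_L: "\<And>f. f \<in> Arr C \<Longrightarrow> P (FA L f)"
    and P_inv: "\<And>w v. w \<in> W \<Longrightarrow> is_inverse D (FA L w) v \<Longrightarrow> P v"
    and P_Comp: "\<And>f g a b c. f \<in> hom D a b \<Longrightarrow> g \<in> hom D b c \<Longrightarrow> P f \<Longrightarrow> P g \<Longrightarrow> P (Comp D g f)"
  shows "Obj D \<subseteq> FO L ` Obj C" and "Arr D \<subseteq> Collect P"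
proof -
  interpret C: category C by fact
  interpret D: category D using loc by (auto simp: is_localization_def)
  have L: "is_functor C D L" using loc by (auto simp: is_localization_def)
  \<comment> \<open>The objects are cut down to the image of \<open>L\<close> as well, so that one
    subcategory yields both claims.\<close>
  define D' where "D' = D\<lparr>Obj := FO L ` Obj C,
    Arr := {f \<in> Arr D. P f \<and> Dom D f \<in> FO L ` Obj C \<and> Cod D f \<in> FO L ` Obj C}\<rparr>"
  have D': "Obj D' = FO L ` Obj C" "Comp D' = Comp D" "Id D' = Id D" "Dom D' = Dom D" "Cod D' = Cod D"
    "Arr D' = {f \<in> Arr D. P f \<and> Dom D f \<in> FO L ` Obj C \<and> Cod D f \<in> FO L ` Obj C}"
    by (simp_all add: D'_def)
  have hom': "f \<in> hom D' a b \<longleftrightarrow> f \<in> hom D a b \<and> P f \<and> a \<in> FO L ` Obj C \<and> b \<in> FO L ` Obj C" for f a b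
    by (auto simp: hom_def D')
  \<comment> \<open>The objects of \<open>D'\<close> are images of objects of \<open>C\<close>, so
    their identities are images of arrows and satisfy \<open>P\<close> already.\<close>
  have P_Id: "P (Id D (FO L c))" if "c \<in> Obj C" for c
    using P_L[of "Id C c"] C.Id_in[OF that] L that by (auto simp: is_functor_def hom_def)
  have LO: "FO L c \<in> Obj D" if "c \<in> Obj C" for c using L that by (auto simp: is_functor_def)
  have cD': "category D'"
  proof
    fix f assume "f \<in> Arr D'" then show "Dom D' f \<in> Obj D'" "Cod D' f \<in> Obj D'" by (auto simp: D')
  next
    fix a assume "a \<in> Obj D'" then show "Id D' a \<in> hom D' a a"
      using P_Id LO D.Id_in by (auto simp: hom') (auto simp: D')
  next
    fix f a b g c assume "f \<in> hom D' a b" "g \<in> hom D' b c"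
    then show "Comp D' g f \<in> hom D' a c" using P_Comp D.Comp_in by (auto simp: hom' D'(2))
  qed (auto simp: hom' D'(2,3) D.Comp_Id D.Id_Comp D.Comp_assoc)
  have fD': "is_functor C D' L"
    using L P_L C.Dom_in C.Cod_in unfolding is_functor_def hom' by (simp add: D')
  have "is_iso D' (FA L w)" if w: "w \<in> W" for w
  proof -
    obtain v where v: "is_inverse D (FA L w) v" using loc w by (auto simp: is_localization_def is_iso_def)
    have "FA L w \<in> hom D' (FO L (Dom C w)) (FO L (Cod C w))"
      using fD' w assms(2) by (auto simp: is_functor_def)
    then have "is_inverse D' (FA L w) v"
      using v P_inv[OF w v] by (auto simp: is_inverse_def hom' D'(2-5)) (auto simp: D' hom_def)
    then show ?thesis by (auto simp: is_iso_def)
  qed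
  then obtain G where G: "is_functor D D' G" "functor_eq C (G \<circ>\<^sub>F L) L"
    using loc cD' fD' unfolding is_localization_def by blast
  \<comment> \<open>The inclusion of \<open>D'\<close> leaves the underlying maps unchanged, so the
    same record \<open>G\<close> serves as the composite.\<close>
  have "is_functor D D G" using G(1) LO unfolding is_functor_def hom' by (auto simp: D')
  moreover have "is_functor D D id_functor" "functor_eq C (id_functor \<circ>\<^sub>F L) L"
    using D.Dom_in by (auto simp: is_functor_def id_functor_def functor_eq_def comp_functor_def hom_def)
  ultimately have "functor_eq D G id_functor" using is_localization_unique[OF loc] G(2) by blast
  then have e: "\<And>a. a \<in> Obj D \<Longrightarrow> FO G a = a" "\<And>f. f \<in> Arr D \<Longrightarrow> FA G f = f"
    by (auto simp: functor_eq_def id_functor_def)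
  show "Obj D \<subseteq> FO L ` Obj C" using G(1) e(1) by (force simp: is_functor_def D'(1))
  show "Arr D \<subseteq> Collect P" using G(1) e(2) by (force simp: is_functor_def hom')
qed

text \<open>The functor from \<open>C\<close> to the indiscrete category on its objects inverts \<open>W\<close>. Its arrows are
  pairs of objects, encoded in \<open>'u\<close>.\<close>

lemma localization_inj_on_Obj:
  fixes C D :: "('u, 'u) cat"
  assumes "infinite (UNIV :: 'u set)" "category C" "W \<subseteq> Arr C" and loc: "is_localization C W D L"
  shows "inj_on (FO L) (Obj C)"
proof -
  interpret C: category C by fact
  have "(card_of (UNIV \<times> UNIV :: ('u \<times> 'u) set), card_of (UNIV :: 'u set)) \<in> ordIso"
    by (rule card_of_Times_same_infinite) fact
  then obtain p :: "'u \<times> 'u \<Rightarrow> 'u" where p: "inj p"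
    using card_of_ordIso[of "UNIV \<times> UNIV :: ('u \<times> 'u) set" "UNIV :: 'u set"] by (auto simp: bij_betw_def)
  then have ip: "inv p (p x) = x" for x by simp
  define E :: "('u, 'u) cat" where "E = \<lparr>Obj = Obj C, Arr = p ` (Obj C \<times> Obj C), Dom = fst \<circ> inv p,
    Cod = snd \<circ> inv p, Id = (\<lambda>a. p (a, a)), Comp = (\<lambda>g f. p (fst (inv p f), snd (inv p g)))\<rparr>"
  have E: "Obj E = Obj C" "Arr E = p ` (Obj C \<times> Obj C)" "Dom E = fst \<circ> inv p" "Cod E = snd \<circ> inv p"
    "Id E = (\<lambda>a. p (a, a))" "Comp E = (\<lambda>g f. p (fst (inv p f), snd (inv p g)))"
    by (simp_all add: E_def)
  have hE: "f \<in> hom E a b \<longleftrightarrow> f = p (a, b) \<and> a \<in> Obj C \<and> b \<in> Obj C" for f a b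
    by (auto simp: hom_def E ip)
  have "category E" by unfold_locales (auto simp: hE, auto simp: E ip)
  moreover define F :: "('u, 'u, 'u, 'u) fctr" where "F = \<lparr>FO = (\<lambda>a. a), FA = (\<lambda>f. p (Dom C f, Cod C f))\<rparr>"
  moreover have "is_functor C E F"
  proof -
    have "Dom C (Comp C g f) = Dom C f" "Cod C (Comp C g f) = Cod C g"
      if "f \<in> Arr C" "g \<in> Arr C" "Cod C f = Dom C g" for f g
      using C.Comp_in[of f "Dom C f" "Cod C f" g "Cod C g"] that by (auto simp: hom_def)
    moreover have "Dom C (Id C a) = a" "Cod C (Id C a) = a" if "a \<in> Obj C" for a
      using C.Id_in[OF that] by (auto simp: hom_def)
    ultimately show ?thesis unfolding is_functor_def hE F_def by (simp add: E ip C.Dom_in C.Cod_in)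
  qed
  moreover have "is_iso E (FA F w)" if "w \<in> W" for w
  proof -
    have "is_inverse E (FA F w) (p (Cod C w, Dom C w))"
      using that assms(3) C.Dom_in C.Cod_in unfolding is_inverse_def hE by (auto simp: E ip F_def)
    then show ?thesis by (auto simp: is_iso_def)
  qed
  ultimately obtain G where "functor_eq C (G \<circ>\<^sub>F L) F"
    using loc unfolding is_localization_def by blast
  \<comment> \<open>\<open>F\<close> is the identity on objects, so the factorization through
    \<open>L\<close> makes \<open>FO G\<close> a left inverse of \<open>FO L\<close>.\<close>
  then show ?thesis by (intro inj_on_inverseI[of _ "FO G"]) (auto simp: functor_eq_def comp_functor_def F_def)
qed

section \<open>Isomorphisms and coherence maps in a symmetric monoidal category\<close>

context category begin

text \<open>Rewrites the head of a right-bracketed composite; \<open>k\<close> is a separate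
  variable so that any known value of \<open>h \<cdot> g\<close> can be supplied.\<close>

lemma Comp_cancel:
  assumes "f \<in> hom C a b" "g \<in> hom C b c" "h \<in> hom C c d" "h \<cdot> g = k"
  shows "h \<cdot> (g \<cdot> f) = k \<cdot> f"
  using Comp_assoc[OF assms(1-3)] assms(4) by simp

end

context symmetric_monoidal_category begin

lemma hom_Obj: "f \<in> hom M a b \<Longrightarrow> a \<in> Obj M \<and> b \<in> Obj M"
  using Dom_in Cod_in by (auto simp: hom_def)

lemma inverse_arr:
  assumes f: "f \<in> hom M a b" and i: "is_iso M f"
  shows "inverse_arr M f \<in> hom M b a" "inverse_arr M f \<cdot> f = Id M a" "f \<cdot> inverse_arr M f = Id M b"
proof -
  obtain g where g: "is_inverse M f g" using i by (auto simp: is_iso_def)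
  have h: "inverse_arr M f \<in> hom M (Cod M f) (Dom M f)" by (rule inverse_in[OF i])
  show "inverse_arr M f \<in> hom M b a" using h f by (simp add: hom_def)
  have g': "g \<in> hom M b a" "g \<cdot> f = Id M a" "f \<cdot> g = Id M b" using g f by (auto simp: is_inverse_def hom_def)
  have "g' = g" if "is_inverse M f g'" for g'
  proof -
    have g'': "g' \<in> hom M b a" "g' \<cdot> f = Id M a" using that f by (auto simp: is_inverse_def hom_def)
    have "g' = g' \<cdot> (f \<cdot> g)" using g' g'' Comp_Id by simp
    also have "\<dots> = g" using Comp_assoc[OF g'(1) f g''(1)] g'' g' Id_Comp by simp
    finally show ?thesis .
  qed
  then have "inverse_arr M f = g" using g unfolding inverse_arr_def by blast
  then show "inverse_arr M f \<cdot> f = Id M a" "f \<cdot> inverse_arr M f = Id M b" using g' by auto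
qed

text \<open>The coherence maps contain inverse unitors and associators, while the naturality axioms
  speak of the maps themselves; this turns such a square around.\<close>

lemma inverse_arr_square:
  assumes f: "f \<in> hom M a b" "is_iso M f" and g: "g \<in> hom M a' b'" "is_iso M g"
    and h: "h \<in> hom M a a'" "k \<in> hom M b b'" and sq: "k \<cdot> f = g \<cdot> h"
  shows "h \<cdot> inverse_arr M f = inverse_arr M g \<cdot> k"
proof -
  note f' = inverse_arr[OF f] and g' = inverse_arr[OF g]
  have "inverse_arr M g \<cdot> k = inverse_arr M g \<cdot> (k \<cdot> (f \<cdot> inverse_arr M f))"
    using f'(3) Comp_Id[OF h(2)] by simp
  also have "\<dots> = inverse_arr M g \<cdot> ((g \<cdot> h) \<cdot> inverse_arr M f)"
    using Comp_assoc[OF f'(1) f(1) h(2)] sq by simp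
  also have "\<dots> = (inverse_arr M g \<cdot> g) \<cdot> (h \<cdot> inverse_arr M f)"
    using Comp_assoc[OF f'(1) h(1) g(1)] Comp_assoc[OF Comp_in[OF f'(1) h(1)] g(1) g'(1)] by simp
  also have "\<dots> = h \<cdot> inverse_arr M f"
    using g'(2) Id_Comp[OF Comp_in[OF f'(1) h(1)]] by simp
  finally show ?thesis by simp
qed

lemma is_iso_Comp:
  assumes f: "f \<in> hom M a b" "is_iso M f" and g: "g \<in> hom M b c" "is_iso M g"
  shows "is_iso M (g \<cdot> f)"
proof -
  note f' = inverse_arr[OF f] and g' = inverse_arr[OF g]
  have "(inverse_arr M f \<cdot> inverse_arr M g) \<cdot> (g \<cdot> f) = Id M a"
    using Comp_assoc[OF Comp_in[OF f(1) g(1)] g'(1) f'(1)] Comp_cancel[OF f(1) g(1) g'(1,2)] Id_Comp[OF f(1)] f'(2) by simp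
  moreover have "(g \<cdot> f) \<cdot> (inverse_arr M f \<cdot> inverse_arr M g) = Id M c"
    using Comp_assoc[OF Comp_in[OF g'(1) f'(1)] f(1) g(1)] Comp_cancel[OF g'(1) f'(1) f(1) f'(3)] Id_Comp[OF g'(1)] g'(3) by simp
  ultimately have "is_inverse M (g \<cdot> f) (inverse_arr M f \<cdot> inverse_arr M g)"
    using Comp_in[OF f(1) g(1)] Comp_in[OF g'(1) f'(1)] unfolding is_inverse_def by (auto simp: hom_def)
  then show ?thesis by (auto simp: is_iso_def)
qed

lemma is_iso_Id: "a \<in> Obj M \<Longrightarrow> is_iso M (Id M a)"
  using Id_in[of a] Comp_Id[of "Id M a" a a] by (auto simp: is_iso_def is_inverse_def hom_def)

lemma is_iso_inverse_arr:
  assumes "f \<in> hom M a b" "is_iso M f"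
  shows "is_iso M (inverse_arr M f)"
  using inverse_arr[OF assms] assms(1) unfolding is_iso_def is_inverse_def
  by (intro exI[of _ f]) (auto simp: hom_def)

lemma is_iso_TA:
  assumes f: "f \<in> hom M a b" "is_iso M f" and g: "g \<in> hom M c d" "is_iso M g"
  shows "is_iso M (f \<boxtimes> g)"
proof -
  note f' = inverse_arr[OF f] and g' = inverse_arr[OF g]
  have "is_inverse M (f \<boxtimes> g) (inverse_arr M f \<boxtimes> inverse_arr M g)"
    using TA_in[OF f(1) g(1)] TA_in[OF f'(1) g'(1)]
      TA_Comp[OF f(1) f'(1) g(1) g'(1)] TA_Comp[OF f'(1) f(1) g'(1) g(1)] f' g' TA_Id hom_Obj[OF f(1)] hom_Obj[OF g(1)]
    unfolding is_inverse_def by (auto simp: hom_def)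
  then show ?thesis by (auto simp: is_iso_def)
qed

lemma is_iso_append_iso: "set xs \<subseteq> Obj M \<Longrightarrow> set ys \<subseteq> Obj M \<Longrightarrow> is_iso M (append_iso M xs ys)"
proof (induction xs)
  case Nil
  then show ?case using is_iso_inverse_arr[OF LUnit_in LUnit_iso] tens_in[of ys] by simp
next
  case (Cons x xs)
  have o: "x \<in> Obj M" "tens M xs \<in> Obj M" "tens M ys \<in> Obj M" using Cons tens_in by auto
  have a: "append_iso M xs ys \<in> hom M (tens M (xs @ ys)) (tens M xs \<otimes> tens M ys)"
    using Cons by (intro append_iso_in) auto
  show ?case unfolding append_iso.simps
    by (rule is_iso_Comp[OF TA_in[OF Id_in a]])
      (use o a Cons in \<open>auto intro!: is_iso_TA Id_in is_iso_Id is_iso_inverse_arr[OF Assoc_in] Assoc_iso inverse_arr(1) Assoc_in\<close>)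
qed

text \<open>Needed for a single block \<open>[[x]]\<close>: composing unary operations inserts this
  rebracketing, and reversing an operation requires undoing it.\<close>

lemma is_iso_concat_iso: "\<forall>xs\<in>set xss. set xs \<subseteq> Obj M \<Longrightarrow> is_iso M (concat_iso M xss)"
proof (induction xss)
  case Nil then show ?case by (simp add: is_iso_Id Unit_in)
next
  case (Cons xs xss)
  have a: "append_iso M xs (concat xss) \<in> hom M (tens M (xs @ concat xss)) (tens M xs \<otimes> tens M (concat xss))"
    "is_iso M (append_iso M xs (concat xss))"
    using Cons by (intro append_iso_in is_iso_append_iso; auto)+
  have c: "concat_iso M xss \<in> hom M (tens M (concat xss)) (tens M (map (tens M) xss))" "is_iso M (concat_iso M xss)"
    using Cons by (auto intro: concat_iso_in)
  have o: "tens M xs \<in> Obj M" using Cons tens_in by auto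
  show ?case using is_iso_Comp[OF a TA_in[OF Id_in[OF o] c(1)] is_iso_TA[OF Id_in[OF o] is_iso_Id[OF o] c]] by simp
qed

text \<open>List induction reduces the claim to naturality of \<open>LUnit\<close> and
  \<open>Assoc\<close>, both turned around by \<open>inverse_arr_square\<close>.\<close>

lemma append_iso_natural:
  assumes "\<And>c. c \<in> set xs \<union> set ys \<Longrightarrow> \<psi> c \<in> hom M (a c) (b c)"
  shows "(tens_arr M (map \<psi> xs) \<boxtimes> tens_arr M (map \<psi> ys)) \<cdot> append_iso M (map a xs) (map a ys) =
    append_iso M (map b xs) (map b ys) \<cdot> tens_arr M (map \<psi> (xs @ ys))"
  using assms
proof (induction xs)
  case Nil
  have h: "tens_arr M (map \<psi> ys) \<in> hom M (tens M (map a ys)) (tens M (map b ys))"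
    using Nil by (intro tens_arr_in') auto
  note o = hom_Obj[OF h]
  show ?case
    using inverse_arr_square[OF LUnit_in LUnit_iso LUnit_in LUnit_iso TA_in[OF Id_in[OF Unit_in] h] h] LUnit_natural[OF h] o by simp
next
  case (Cons x xs)
  let ?X = "tens M (map a xs)" and ?X' = "tens M (map b xs)" and ?Y = "tens M (map a ys)" and ?Y' = "tens M (map b ys)"
  let ?x = "\<psi> x" and ?f = "tens_arr M (map \<psi> xs)" and ?g = "tens_arr M (map \<psi> ys)" and ?fg = "tens_arr M (map \<psi> (xs @ ys))"
  let ?K = "append_iso M (map a xs) (map a ys)" and ?K' = "append_iso M (map b xs) (map b ys)"
  let ?A = "inverse_arr M (Assoc M (a x) ?X ?Y)" and ?A' = "inverse_arr M (Assoc M (b x) ?X' ?Y')"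
  have h: "?x \<in> hom M (a x) (b x)" "?f \<in> hom M ?X ?X'" "?g \<in> hom M ?Y ?Y'"
    using Cons.prems by (auto intro: tens_arr_in')
  have fg: "?fg \<in> hom M (tens M (map a (xs @ ys))) (tens M (map b (xs @ ys)))"
    using Cons.prems by (intro tens_arr_in') auto
  note o = hom_Obj[OF h(1)] hom_Obj[OF h(2)] hom_Obj[OF h(3)]
  have oc: "a c \<in> Obj M \<and> b c \<in> Obj M" if "c \<in> set xs \<union> set ys" for c using Cons.prems hom_Obj that by (metis UnCI UnE insertCI list.set(2))
  have K: "?K \<in> hom M (tens M (map a (xs @ ys))) (?X \<otimes> ?Y)" "?K' \<in> hom M (tens M (map b (xs @ ys))) (?X' \<otimes> ?Y')"
    using append_iso_in[of "map a xs" "map a ys"] append_iso_in[of "map b xs" "map b ys"] oc by auto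
  have IH: "(?f \<boxtimes> ?g) \<cdot> ?K = ?K' \<cdot> ?fg" using Cons by auto
  have A: "?A \<in> hom M (a x \<otimes> (?X \<otimes> ?Y)) ((a x \<otimes> ?X) \<otimes> ?Y)" "?A' \<in> hom M (b x \<otimes> (?X' \<otimes> ?Y')) ((b x \<otimes> ?X') \<otimes> ?Y')"
    using o by (auto intro!: inverse_arr Assoc_in Assoc_iso)
  have I: "Id M (a x) \<in> hom M (a x) (a x)" "Id M (b x) \<in> hom M (b x) (b x)" using o Id_in by auto
  have An: "((?x \<boxtimes> ?f) \<boxtimes> ?g) \<cdot> ?A = ?A' \<cdot> (?x \<boxtimes> (?f \<boxtimes> ?g))"
    using inverse_arr_square[OF Assoc_in Assoc_iso Assoc_in Assoc_iso TA_in[OF TA_in[OF h(1,2)] h(3)] TA_in[OF h(1) TA_in[OF h(2,3)]]]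
      Assoc_natural[OF h] o by simp
  have "((?x \<boxtimes> ?f) \<boxtimes> ?g) \<cdot> (?A \<cdot> (Id M (a x) \<boxtimes> ?K)) = (?A' \<cdot> (?x \<boxtimes> (?f \<boxtimes> ?g))) \<cdot> (Id M (a x) \<boxtimes> ?K)"
    by (rule Comp_cancel[OF TA_in[OF I(1) K(1)] A(1) TA_in[OF TA_in[OF h(1,2)] h(3)] An])
  also have "\<dots> = ?A' \<cdot> ((?x \<boxtimes> (?f \<boxtimes> ?g)) \<cdot> (Id M (a x) \<boxtimes> ?K))"
    by (rule Comp_assoc[OF TA_in[OF I(1) K(1)] TA_in[OF h(1) TA_in[OF h(2,3)]] A(2)])
  also have "(?x \<boxtimes> (?f \<boxtimes> ?g)) \<cdot> (Id M (a x) \<boxtimes> ?K) = (Id M (b x) \<boxtimes> ?K') \<cdot> (?x \<boxtimes> ?fg)"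
    using TA_Comp[OF I(1) h(1) K(1) TA_in[OF h(2,3)]] TA_Comp[OF h(1) I(2) fg K(2)] Comp_Id[OF h(1)] Id_Comp[OF h(1)] IH by simp
  also have "?A' \<cdot> \<dots> = (?A' \<cdot> (Id M (b x) \<boxtimes> ?K')) \<cdot> (?x \<boxtimes> ?fg)"
    using Comp_assoc[OF TA_in[OF h(1) fg] TA_in[OF I(2) K(2)] A(2)] by simp
  finally show ?case by simp
qed

text \<open>This lets the components of an algebra morphism pass the rebracketing in the composition
  axiom of algebras. Each block contributes one \<open>append_iso\<close> square and one interchange
  of tensor and composition.\<close>

lemma concat_iso_natural:
  assumes "\<And>c. c \<in> set (concat css) \<Longrightarrow> \<psi> c \<in> hom M (a c) (b c)"
  shows "tens_arr M (map (\<lambda>cs. tens_arr M (map \<psi> cs)) css) \<cdot> concat_iso M (map (map a) css) =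
    concat_iso M (map (map b) css) \<cdot> tens_arr M (map \<psi> (concat css))"
  using assms
proof (induction css)
  case Nil show ?case by simp
next
  case (Cons cs css)
  let ?f = "tens_arr M (map \<psi> cs)" and ?g = "tens_arr M (map (\<lambda>cs. tens_arr M (map \<psi> cs)) css)"
  let ?h = "tens_arr M (map \<psi> (concat css))"
  let ?X = "tens M (map a cs)" and ?X' = "tens M (map b cs)" and ?Y = "tens M (map a (concat css))" and ?Y' = "tens M (map b (concat css))"
  let ?Z = "tens M (map (\<lambda>cs. tens M (map a cs)) css)" and ?Z' = "tens M (map (\<lambda>cs. tens M (map b cs)) css)"
  let ?K = "append_iso M (map a cs) (map a (concat css))" and ?K' = "append_iso M (map b cs) (map b (concat css))"
  let ?c = "concat_iso M (map (map a) css)" and ?c' = "concat_iso M (map (map b) css)"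
  have h: "?f \<in> hom M ?X ?X'" "?h \<in> hom M ?Y ?Y'" "?g \<in> hom M ?Z ?Z'"
    using Cons.prems by (auto intro!: tens_arr_in')
  have fh: "tens_arr M (map \<psi> (cs @ concat css)) \<in> hom M (tens M (map a (cs @ concat css))) (tens M (map b (cs @ concat css)))"
    using Cons.prems by (intro tens_arr_in') auto
  have oc: "a c \<in> Obj M \<and> b c \<in> Obj M" if "c \<in> set (concat (cs # css))" for c using Cons.prems[OF that] hom_Obj by blast
  have K: "?K \<in> hom M (tens M (map a (cs @ concat css))) (?X \<otimes> ?Y)" "?K' \<in> hom M (tens M (map b (cs @ concat css))) (?X' \<otimes> ?Y')"
    using append_iso_in[of "map a cs" "map a (concat css)"] append_iso_in[of "map b cs" "map b (concat css)"] oc by (auto simp: image_subset_iff)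
  have c: "?c \<in> hom M ?Y ?Z" "?c' \<in> hom M ?Y' ?Z'"
    using concat_iso_in[of "map (map a) css"] concat_iso_in[of "map (map b) css"] oc by (auto simp: map_concat[symmetric] comp_def)
  have IH: "?g \<cdot> ?c = ?c' \<cdot> ?h" using Cons by auto
  have I: "Id M ?X \<in> hom M ?X ?X" "Id M ?X' \<in> hom M ?X' ?X'" using hom_Obj[OF h(1)] Id_in by auto
  have "(?f \<boxtimes> ?g) \<cdot> ((Id M ?X \<boxtimes> ?c) \<cdot> ?K) = ((?f \<boxtimes> ?g) \<cdot> (Id M ?X \<boxtimes> ?c)) \<cdot> ?K"
    using Comp_assoc[OF K(1) TA_in[OF I(1) c(1)] TA_in[OF h(1,3)]] by simp
  also have "(?f \<boxtimes> ?g) \<cdot> (Id M ?X \<boxtimes> ?c) = (Id M ?X' \<boxtimes> ?c') \<cdot> (?f \<boxtimes> ?h)"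
    using TA_Comp[OF I(1) h(1) c(1) h(3)] TA_Comp[OF h(1) I(2) h(2) c(2)] Comp_Id[OF h(1)] Id_Comp[OF h(1)] IH by simp
  also have "\<dots> \<cdot> ?K = (Id M ?X' \<boxtimes> ?c') \<cdot> ((?f \<boxtimes> ?h) \<cdot> ?K)"
    by (rule Comp_assoc[OF K(1) TA_in[OF h(1,2)] TA_in[OF I(2) c(2)]])
  also have "(?f \<boxtimes> ?h) \<cdot> ?K = ?K' \<cdot> tens_arr M (map \<psi> (cs @ concat css))"
    using Cons.prems by (intro append_iso_natural) auto
  also have "(Id M ?X' \<boxtimes> ?c') \<cdot> \<dots> = ((Id M ?X' \<boxtimes> ?c') \<cdot> ?K') \<cdot> tens_arr M (map \<psi> (cs @ concat css))"
    using Comp_assoc[OF fh K(2) TA_in[OF I(2) c(2)]] by simp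
  finally show ?case by (simp add: map_concat[symmetric])
qed

end

section \<open>Operations that commute with a family of maps\<close>

text \<open>The last clause of \<open>is_algebra_morphism\<close>, isolated for a single operation
  so that the set of operations satisfying it can be closed step by step.\<close>

definition commutes ::
  "('o, 'm, 'w) moncat_scheme \<Rightarrow> ('c, 'x, 'o, 'm) alg \<Rightarrow> ('c, 'x, 'o, 'm) alg \<Rightarrow> ('c \<Rightarrow> 'm) \<Rightarrow>
   'c \<Rightarrow> 'c list \<Rightarrow> 'x \<Rightarrow> bool" where
  "commutes M A B \<psi> t cs x \<longleftrightarrow>
     Comp M (\<psi> t) (AA A t cs x) = Comp M (AA B t cs x) (tens_arr M (map \<psi> cs))"

context symmetric_monoidal_category begin

text \<open>\<open>e\<close> is a split epimorphism with section \<open>s\<close>.\<close>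

lemma right_cancel:
  assumes "s \<in> hom M c b" "e \<in> hom M b c" "e \<cdot> s = Id M c" "g \<in> hom M c d" "g' \<in> hom M c d" "g \<cdot> e = g' \<cdot> e"
  shows "g = g'"
proof -
  have "g = (g \<cdot> e) \<cdot> s"
    using Comp_assoc[OF assms(1,2,4)] assms(3) Comp_Id[OF assms(4)] by simp
  also have "\<dots> = g'"
    unfolding assms(6) using Comp_assoc[OF assms(1,2,5)] assms(3) Comp_Id[OF assms(5)] by simp
  finally show ?thesis .
qed

lemma AO_in: "is_algebra M P A \<Longrightarrow> c \<in> Col P \<Longrightarrow> AO A c \<in> Obj M"
  by (simp add: is_algebra_def)

lemma AA_in: "is_algebra M P A \<Longrightarrow> x \<in> Ops P t cs \<Longrightarrow> AA A t cs x \<in> hom M (tens M (map (AO A) cs)) (AO A t)"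
  by (simp add: is_algebra_def)

lemma AA_Gam: "is_algebra M P A \<Longrightarrow> composable P t ds css x ys \<Longrightarrow>
  AA A t (concat css) (Gam P t ds css x ys) = AA A t ds x \<cdot>
    (tens_arr M (map (\<lambda>i. AA A (ds ! i) (css ! i) (ys ! i)) [0..<length ds]) \<cdot> concat_iso M (map (map (AO A)) css))"
  unfolding is_algebra_def by blast

text \<open>The composition axiom writes the action of the composite as three factors. The family
  slides past the action of \<open>x\<close>, then past those of the \<open>ys\<close> by
  functoriality of the tensor product, then past \<open>concat_iso\<close> by naturality.\<close>

lemma commutes_Gam:
  assumes P: "colored_operad P" and A: "is_algebra M P A" and B: "is_algebra M P B"
    and \<psi>: "\<And>c. c \<in> Col P \<Longrightarrow> \<psi> c \<in> hom M (AO A c) (AO B c)"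
    and c: "composable P t ds css x ys"
    and x: "commutes M A B \<psi> t ds x"
    and ys: "\<And>i. i < length ds \<Longrightarrow> commutes M A B \<psi> (ds ! i) (css ! i) (ys ! i)"
  shows "commutes M A B \<psi> t (concat css) (Gam P t ds css x ys)"
proof -
  interpret P: colored_operad P by fact
  have l: "length css = length ds" "x \<in> Ops P t ds" "\<And>i. i < length ds \<Longrightarrow> ys ! i \<in> Ops P (ds ! i) (css ! i)"
    using c by (auto simp: composable_def)
  have col: "t \<in> Col P" "set ds \<subseteq> Col P" "\<And>i. i < length ds \<Longrightarrow> set (css ! i) \<subseteq> Col P"
    using P.Ops_col l by blast+
  have ccol: "cs \<in> set css \<Longrightarrow> set cs \<subseteq> Col P" for cs using col(3) l(1) by (metis in_set_conv_nth)
  let ?n = "[0..<length ds]"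
  let ?a = "\<lambda>i. AA A (ds ! i) (css ! i) (ys ! i)" and ?b = "\<lambda>i. AA B (ds ! i) (css ! i) (ys ! i)"
  let ?p = "\<lambda>i. \<psi> (ds ! i)" and ?q = "\<lambda>i. tens_arr M (map \<psi> (css ! i))"
  let ?S = "\<lambda>i. tens M (map (AO A) (css ! i))" and ?S' = "\<lambda>i. tens M (map (AO B) (css ! i))"
  let ?T = "\<lambda>i. AO A (ds ! i)" and ?T' = "\<lambda>i. AO B (ds ! i)"
  let ?K = "concat_iso M (map (map (AO A)) css)" and ?K' = "concat_iso M (map (map (AO B)) css)"
  have h: "?a i \<in> hom M (?S i) (?T i)" "?b i \<in> hom M (?S' i) (?T' i)" "?p i \<in> hom M (?T i) (?T' i)" "?q i \<in> hom M (?S i) (?S' i)"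
    if "i < length ds" for i
    using AA_in[OF A l(3)[OF that]] AA_in[OF B l(3)[OF that]] \<psi>[of "ds ! i"] \<psi> col(2) col(3)[OF that] nth_mem[OF that]
    by (auto intro!: tens_arr_in')
  \<comment> \<open>All lists become maps over the same list of positions, the form to which
    \<open>tens_arr_in'\<close> and \<open>tens_arr_comp\<close> apply.\<close>
  have ds: "map \<psi> ds = map ?p ?n" "map (AO A) ds = map ?T ?n" "map (AO B) ds = map ?T' ?n" 
    by (intro nth_equalityI; simp)+
  have S: "map (tens M) (map (map (AO A)) css) = map ?S ?n" "map (tens M) (map (map (AO B)) css) = map ?S' ?n"
    "map (\<lambda>cs. tens_arr M (map \<psi> cs)) css = map ?q ?n"
    using l(1) by (intro nth_equalityI; simp)+
  have ax: "AA A t ds x \<in> hom M (tens M (map ?T ?n)) (AO A t)" "AA B t ds x \<in> hom M (tens M (map ?T' ?n)) (AO B t)"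
    using AA_in[OF A l(2)] AA_in[OF B l(2)] ds by auto
  have ta: "tens_arr M (map ?a ?n) \<in> hom M (tens M (map ?S ?n)) (tens M (map ?T ?n))"
    "tens_arr M (map ?b ?n) \<in> hom M (tens M (map ?S' ?n)) (tens M (map ?T' ?n))"
    "tens_arr M (map ?p ?n) \<in> hom M (tens M (map ?T ?n)) (tens M (map ?T' ?n))"
    "tens_arr M (map ?q ?n) \<in> hom M (tens M (map ?S ?n)) (tens M (map ?S' ?n))"
    by (rule tens_arr_in'; use h in simp)+
  have ob: "\<forall>xs\<in>set (map (map (AO A)) css). set xs \<subseteq> Obj M" "\<forall>xs\<in>set (map (map (AO B)) css). set xs \<subseteq> Obj M"
    using ccol by (auto intro!: AO_in[OF A] AO_in[OF B])
  have K: "?K \<in> hom M (tens M (map (AO A) (concat css))) (tens M (map ?S ?n))" "?K' \<in> hom M (tens M (map (AO B) (concat css))) (tens M (map ?S' ?n))"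
    using concat_iso_in[OF ob(1)] concat_iso_in[OF ob(2)] unfolding S by (simp_all add: map_concat)
  have tp: "tens_arr M (map \<psi> (concat css)) \<in> hom M (tens M (map (AO A) (concat css))) (tens M (map (AO B) (concat css)))"
    using ccol \<psi> by (intro tens_arr_in') auto
  have sq: "tens_arr M (map ?p ?n) \<cdot> tens_arr M (map ?a ?n) = tens_arr M (map ?b ?n) \<cdot> tens_arr M (map ?q ?n)"
  proof -
    have "tens_arr M (map ?p ?n) \<cdot> tens_arr M (map ?a ?n) = tens_arr M (map (\<lambda>i. ?p i \<cdot> ?a i) ?n)"
      by (rule tens_arr_comp[symmetric, where a="?S" and b="?T" and d="?T'"]) (use h in auto)
    also have "map (\<lambda>i. ?p i \<cdot> ?a i) ?n = map (\<lambda>i. ?b i \<cdot> ?q i) ?n"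
      using ys by (auto simp: commutes_def)
    also have "tens_arr M \<dots> = tens_arr M (map ?b ?n) \<cdot> tens_arr M (map ?q ?n)"
      by (rule tens_arr_comp[where a="?S" and b="?S'" and d="?T'"]) (use h in auto)
    finally show ?thesis .
  qed
  have Kn: "tens_arr M (map ?q ?n) \<cdot> ?K = ?K' \<cdot> tens_arr M (map \<psi> (concat css))"
    using concat_iso_natural[of css \<psi> "AO A" "AO B"] ccol \<psi> unfolding S(3) by (auto simp: subset_iff)
  have "\<psi> t \<cdot> (AA A t ds x \<cdot> (tens_arr M (map ?a ?n) \<cdot> ?K)) = (\<psi> t \<cdot> AA A t ds x) \<cdot> (tens_arr M (map ?a ?n) \<cdot> ?K)"
    using Comp_assoc[OF Comp_in[OF K(1) ta(1)] ax(1) \<psi>[OF col(1)]] by simp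
  also have "\<psi> t \<cdot> AA A t ds x = AA B t ds x \<cdot> tens_arr M (map ?p ?n)"
    using x unfolding commutes_def ds .
  also have "\<dots> \<cdot> (tens_arr M (map ?a ?n) \<cdot> ?K) = AA B t ds x \<cdot> (tens_arr M (map ?p ?n) \<cdot> (tens_arr M (map ?a ?n) \<cdot> ?K))"
    by (rule Comp_assoc[OF Comp_in[OF K(1) ta(1)] ta(3) ax(2)])
  also have "tens_arr M (map ?p ?n) \<cdot> (tens_arr M (map ?a ?n) \<cdot> ?K) = (tens_arr M (map ?b ?n) \<cdot> tens_arr M (map ?q ?n)) \<cdot> ?K"
    by (rule Comp_cancel[OF K(1) ta(1,3) sq])
  also have "\<dots> = tens_arr M (map ?b ?n) \<cdot> (?K' \<cdot> tens_arr M (map \<psi> (concat css)))"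
    using Comp_assoc[OF K(1) ta(4,2)] Kn by simp
  also have "\<dots> = (tens_arr M (map ?b ?n) \<cdot> ?K') \<cdot> tens_arr M (map \<psi> (concat css))"
    using Comp_assoc[OF tp K(2) ta(2)] by simp
  also have "AA B t ds x \<cdot> \<dots> = (AA B t ds x \<cdot> (tens_arr M (map ?b ?n) \<cdot> ?K')) \<cdot> tens_arr M (map \<psi> (concat css))"
    using Comp_assoc[OF tp Comp_in[OF K(2) ta(2)] ax(2)] by simp
  finally show ?thesis unfolding commutes_def AA_Gam[OF A c] AA_Gam[OF B c] .
qed

text \<open>If \<open>v\<close> is inverse to \<open>u\<close>, precomposition with \<open>A(u)\<close> is injective, because \<open>A(u) \<circ> A(v)\<close> is
  the right unitor, and after precomposition the claim for \<open>v\<close> is the claim for \<open>u\<close>.\<close>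

lemma commutes_inverse:
  assumes P: "colored_operad P" and A: "is_algebra M P A" and B: "is_algebra M P B"
    and \<psi>: "\<And>c. c \<in> Col P \<Longrightarrow> \<psi> c \<in> hom M (AO A c) (AO B c)"
    and u: "u \<in> Ops P b [a]" and v: "v \<in> Ops P a [b]"
    and vu: "Gam P a [b] [[a]] v [u] = One P a" and uv: "Gam P b [a] [[b]] u [v] = One P b"
    and cu: "commutes M A B \<psi> b [a] u"
  shows "commutes M A B \<psi> a [b] v"
proof -
  interpret P: colored_operad P by fact
  have col: "a \<in> Col P" "b \<in> Col P" using P.Ops_col[OF u] by auto
  have c: "composable P a [b] [[a]] v [u]" "composable P b [a] [[b]] u [v]"
    using u v by (auto simp: composable_def)
  let ?i = "Id M (Unit M)"
  have i: "?i \<in> hom M (Unit M) (Unit M)" by (rule Id_in[OF Unit_in])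
  have ob: "AO A c \<in> Obj M" "AO B c \<in> Obj M" if "c \<in> Col P" for c using AO_in[OF A that] AO_in[OF B that] by auto
  \<comment> \<open>These are the composition axioms for \<open>vu\<close> and \<open>uv\<close>.
    The factor \<open>?i\<close> is there because \<open>tens_arr\<close> of a single arrow still
    ends with the identity of the unit.\<close>
  have g: "AA E a [b] v \<cdot> ((AA E b [a] u \<boxtimes> ?i) \<cdot> concat_iso M [[AO E a]]) = RUnit M (AO E a)"
    "AA E b [a] u \<cdot> ((AA E a [b] v \<boxtimes> ?i) \<cdot> concat_iso M [[AO E b]]) = RUnit M (AO E b)"
    if E: "is_algebra M P E" for E
    using AA_Gam[OF E c(1)] AA_Gam[OF E c(2)] vu uv E col unfolding is_algebra_def by simp_all
  have AAh: "AA E b [a] u \<in> hom M (AO E a \<otimes> Unit M) (AO E b)" "AA E a [b] v \<in> hom M (AO E b \<otimes> Unit M) (AO E a)"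
    if E: "is_algebra M P E" for E
    using AA_in[OF E u] AA_in[OF E v] by simp_all
  note uA = AAh(1)[OF A] and vA = AAh(2)[OF A] and uB = AAh(1)[OF B] and vB = AAh(2)[OF B]
  have K: "concat_iso M [[x]] \<in> hom M (x \<otimes> Unit M) ((x \<otimes> Unit M) \<otimes> Unit M)" "is_iso M (concat_iso M [[x]])"
    if "x \<in> Obj M" for x
    using concat_iso_in[of "[[x]]"] is_iso_concat_iso[of "[[x]]"] that by auto
  let ?K = "concat_iso M [[AO A a]]" and ?L = "concat_iso M [[AO A b]]" and ?K' = "concat_iso M [[AO B a]]"
  note Ka = K(1)[OF ob(1)[OF col(1)]] and Kb = K(1)[OF ob(1)[OF col(2)]] and KB = K(1)[OF ob(2)[OF col(1)]]
  note Ki = inverse_arr[OF K[OF ob(1)[OF col(1)]]]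
  note \<rho>i = inverse_arr[OF RUnit_in[OF ob(1)[OF col(2)]] RUnit_iso[OF ob(1)[OF col(2)]]]
  let ?e = "(AA A b [a] u \<boxtimes> ?i) \<cdot> ?K"
  \<comment> \<open>By \<open>g(2)\<close>, removing the right unitor makes \<open>s\<close> a
    section of the action of \<open>u\<close>. Tensoring it with the unit and undoing
    \<open>?K\<close> then gives a section of \<open>?e\<close>.\<close>
  define s where "s = ((AA A a [b] v \<boxtimes> ?i) \<cdot> ?L) \<cdot> inverse_arr M (RUnit M (AO A b))"
  have s: "s \<in> hom M (AO A b) (AO A a \<otimes> Unit M)" unfolding s_def
    by (intro Comp_in[OF \<rho>i(1)] Comp_in[OF Kb] TA_in[OF vA i])
  have us: "AA A b [a] u \<cdot> s = Id M (AO A b)" unfolding s_def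
    using Comp_cancel[OF \<rho>i(1) Comp_in[OF Kb TA_in[OF vA i]] uA g(2)[OF A]] \<rho>i(3) by simp
  have "(AA A b [a] u \<boxtimes> ?i) \<cdot> (s \<boxtimes> ?i) = Id M (AO A b \<otimes> Unit M)"
    using TA_Comp[OF s uA i i] us Comp_Id[OF i] TA_Id[OF ob(1)[OF col(2)] Unit_in] by simp
  moreover have "?e \<cdot> (inverse_arr M ?K \<cdot> (s \<boxtimes> ?i)) = (AA A b [a] u \<boxtimes> ?i) \<cdot> (s \<boxtimes> ?i)"
    using Comp_assoc[OF Comp_in[OF TA_in[OF s i] Ki(1)] Ka TA_in[OF uA i]]
      Comp_cancel[OF TA_in[OF s i] Ki(1) Ka Ki(3)] Id_Comp[OF TA_in[OF s i]] by simp
  ultimately have es: "?e \<cdot> (inverse_arr M ?K \<cdot> (s \<boxtimes> ?i)) = Id M (AO A b \<otimes> Unit M)" by simp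
  have p: "\<psi> a \<in> hom M (AO A a) (AO B a)" "\<psi> b \<in> hom M (AO A b) (AO B b)" using \<psi> col by auto
  have eh: "?e \<in> hom M (AO A a \<otimes> Unit M) (AO A b \<otimes> Unit M)" by (rule Comp_in[OF Ka TA_in[OF uA i]])
  have pi: "\<psi> a \<boxtimes> ?i \<in> hom M (AO A a \<otimes> Unit M) (AO B a \<otimes> Unit M)" "\<psi> b \<boxtimes> ?i \<in> hom M (AO A b \<otimes> Unit M) (AO B b \<otimes> Unit M)"
    using p i TA_in by auto
  have Kn: "((\<psi> a \<boxtimes> ?i) \<boxtimes> ?i) \<cdot> ?K = ?K' \<cdot> (\<psi> a \<boxtimes> ?i)"
    using concat_iso_natural[of "[[a]]" \<psi> "AO A" "AO B"] p by (simp del: concat_iso.simps)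
  have up: "\<psi> b \<cdot> AA A b [a] u = AA B b [a] u \<cdot> (\<psi> a \<boxtimes> ?i)" using cu by (simp add: commutes_def)
  have "(\<psi> b \<boxtimes> ?i) \<cdot> ?e = ((\<psi> b \<cdot> AA A b [a] u) \<boxtimes> ?i) \<cdot> ?K"
    using Comp_assoc[OF Ka TA_in[OF uA i] pi(2)] TA_Comp[OF uA p(2) i i] Comp_Id[OF i] by simp
  also have "\<dots> = ((AA B b [a] u \<boxtimes> ?i) \<cdot> ((\<psi> a \<boxtimes> ?i) \<boxtimes> ?i)) \<cdot> ?K"
    unfolding up using TA_Comp[OF pi(1) uB i i] Comp_Id[OF i] by simp
  also have "\<dots> = ((AA B b [a] u \<boxtimes> ?i) \<cdot> ?K') \<cdot> (\<psi> a \<boxtimes> ?i)"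
    using Comp_assoc[OF Ka TA_in[OF pi(1) i] TA_in[OF uB i]] Comp_assoc[OF pi(1) KB TA_in[OF uB i]] Kn by simp
  finally have en: "(\<psi> b \<boxtimes> ?i) \<cdot> ?e = ((AA B b [a] u \<boxtimes> ?i) \<cdot> ?K') \<cdot> (\<psi> a \<boxtimes> ?i)" .
  \<comment> \<open>Composed with \<open>?e\<close>, either side collapses to a right unitor by
    \<open>g(1)\<close>, and naturality of \<open>RUnit\<close> compares the two.\<close>
  have "(AA B a [b] v \<cdot> (\<psi> b \<boxtimes> ?i)) \<cdot> ?e = RUnit M (AO B a) \<cdot> (\<psi> a \<boxtimes> ?i)"
    using Comp_assoc[OF eh pi(2) vB] en Comp_cancel[OF pi(1) Comp_in[OF KB TA_in[OF uB i]] vB g(1)[OF B]] by simp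
  also have "\<dots> = \<psi> a \<cdot> RUnit M (AO A a)" by (rule RUnit_natural[OF p(1)])
  also have "\<dots> = (\<psi> a \<cdot> AA A a [b] v) \<cdot> ?e"
    using Comp_assoc[OF eh vA p(1)] g(1)[OF A] by simp
  finally have "AA B a [b] v \<cdot> (\<psi> b \<boxtimes> ?i) = \<psi> a \<cdot> AA A a [b] v"
    by (rule right_cancel[OF Comp_in[OF TA_in[OF s i] Ki(1)] eh es Comp_in[OF pi(2) vB] Comp_in[OF vA p(1)]])
  then show ?thesis by (simp add: commutes_def)
qed

end

section \<open>Unary operations and decomposition in operads of categories\<close>

context category begin

lemma cat_operad_unary: "(id, [f]) \<in> Ops (cat_operad C) b [a] \<longleftrightarrow> f \<in> hom C a b"
  using Dom_in Cod_in by (auto simp: hom_def permutes_id)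

lemma cat_Gam_unary:
  assumes "f \<in> hom C a b" "g \<in> hom C b c"
  shows "Gam (cat_operad C) c [b] [[a]] (id, [g]) [(id, [f])] = (id, [g \<cdot> f])"
  \<comment> \<open>The permutation part of \<open>Gam\<close> sees only lengths and permutations,
    so it can be copied from the composite with a unit.\<close>
  using cat_Gam_One_right[of "(id, [g])" c "[b]"] assms(2)
  by (simp add: cat_operad_unary comp_arrs_def del: cat_operad_simps(2))

text \<open>Concentrates the permutation in a factor whose arrows are all identities of the output
  \<open>t\<close>; the arrows \<open>gs\<close> are left to unary operations.\<close>

lemma cat_operad_decompose:
  assumes x: "(\<sigma>, gs) \<in> Ops (cat_operad C) t ds"
  defines "n \<equiv> length ds"
  shows "composable (cat_operad C) t (replicate n t) (map (\<lambda>d. [d]) ds) (\<sigma>, replicate n (Id C t)) (map (\<lambda>g. (id, [g])) gs)"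
    and "Gam (cat_operad C) t (replicate n t) (map (\<lambda>d. [d]) ds) (\<sigma>, replicate n (Id C t)) (map (\<lambda>g. (id, [g])) gs) = (\<sigma>, gs)"
proof -
  note x' = x[unfolded cat_operad_simps]
  show "composable (cat_operad C) t (replicate n t) (map (\<lambda>d. [d]) ds) (\<sigma>, replicate n (Id C t)) (map (\<lambda>g. (id, [g])) gs)"
    using x' Id_in unfolding composable_def n_def by (auto simp: permutes_id)
  \<comment> \<open>Units and the operations \<open>(id, [g])\<close> have the same permutation
    part, so the right unit law already determines the permutation of this composite.\<close>
  have "map fst (map (One (cat_operad C)) ds) = map fst (map (\<lambda>g. (id, [g])) gs)"
    using x' by (intro nth_equalityI) auto
  then have 1: "assoc_comp (map length (map (\<lambda>d. [d]) ds)) \<sigma> (map fst (map (\<lambda>g. (id, [g])) gs)) = \<sigma>"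
    using cat_Gam_One_right[OF x] by simp
  have "comp_arrs C (replicate n (Id C t)) (map (\<lambda>g. (id, [g])) gs) = map (Comp C (Id C t)) gs"
    using x' unfolding comp_arrs_def n_def by (simp add: zip_replicate1 take_map comp_def)
  also have "\<dots> = gs" by (rule map_idI) (use x' Id_Comp in \<open>metis in_set_conv_nth\<close>)
  finally show "Gam (cat_operad C) t (replicate n t) (map (\<lambda>d. [d]) ds) (\<sigma>, replicate n (Id C t)) (map (\<lambda>g. (id, [g])) gs) = (\<sigma>, gs)"
    using 1 by simp
qed

end

lemma Col_orth_operad: "Col (orth_operad C orth) = Obj C"
  by (simp add: orth_operad_def quotient_operad_def)

context orth_fun begin

abbreviation "QC \<equiv> orth_operad C orth"
abbreviation "QD \<equiv> orth_operad D orth'"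

text \<open>An operation \<open>(\<sigma>, (g\<^sub>1, \<dots>, g\<^sub>n))\<close> is the composite of \<open>(\<sigma>, (id, \<dots>, id))\<close>, which comes from \<open>C\<close>
  because \<open>F\<close> is surjective on objects, with the unary operations \<open>g\<^sub>i\<close>.\<close>

lemma is_algebra_morphism_if_commutes:
  assumes M: "symmetric_monoidal_category M" and A: "is_algebra M QD A" and B: "is_algebra M QD B"
    and surj: "Obj D \<subseteq> FO F ` Obj C"
    and \<psi>: "\<psi> \<in> extensional (Obj D)" "\<And>d. d \<in> Obj D \<Longrightarrow> \<psi> d \<in> hom M (AO A d) (AO B d)"
    and image: "\<And>t cs x. x \<in> Ops PC t cs \<Longrightarrow>
      commutes M A B \<psi> (FO F t) (map (FO F) cs) (cong_class PD R' (FO F t) (map (FO F) cs) (opF x))"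
    and unary: "\<And>a b f. f \<in> hom D a b \<Longrightarrow> commutes M A B \<psi> b [a] (cong_class PD R' b [a] (id, [f]))"
  shows "is_algebra_morphism M QD A B \<psi>"
  unfolding is_algebra_morphism_def
proof (intro conjI allI ballI)
  interpret M: symmetric_monoidal_category M by fact
  have Q: "colored_operad QD" by (rule colored_operad_orth[OF D.category_axioms])
  have Col: "Col QD = Obj D" by (rule Col_orth_operad)
  show "\<psi> \<in> extensional (Col QD)" "c \<in> Col QD \<Longrightarrow> \<psi> c \<in> hom M (AO A c) (AO B c)" for c
    using \<psi> unfolding Col by auto
  fix t ds X assume "X \<in> Ops QD t ds"
  then obtain \<sigma> gs where x: "(\<sigma>, gs) \<in> Ops PD t ds" and X: "X = cong_class PD R' t ds (\<sigma>, gs)"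
    by (auto simp: orth_operad_def)
  note x' = x[unfolded cat_operad_simps]
  let ?n = "length ds" and ?css = "map (\<lambda>d. [d]) ds" and ?ys = "map (\<lambda>g. (id, [g])) gs"
  let ?Ys = "map (\<lambda>i. cong_class PD R' (replicate ?n t ! i) (?css ! i) (?ys ! i)) [0..<length (replicate ?n t)]"
  note c = D.cat_operad_decompose[OF x]
  \<comment> \<open>Only the output color has to be lifted to \<open>C\<close>: every input of the
    first factor is \<open>t\<close> too.\<close>
  obtain s where s: "s \<in> Obj C" "t = FO F s" using surj x' by auto
  have "(\<sigma>, replicate ?n (Id C s)) \<in> Ops PC s (replicate ?n s)" using x' s C.Id_in by auto
  from image[OF this] have 1: "commutes M A B \<psi> t (replicate ?n t) (cong_class PD R' t (replicate ?n t) (\<sigma>, replicate ?n (Id D t)))"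
    using s F by (simp add: opF_def is_functor_def)
  have 2: "commutes M A B \<psi> (replicate ?n t ! i) (?css ! i) (?Ys ! i)" if "i < length (replicate ?n t)" for i
    using that x' unary[of "gs ! i" "ds ! i" t] by simp
  have "commutes M A B \<psi> t (concat ?css) (Gam QD t (replicate ?n t) ?css (cong_class PD R' t (replicate ?n t) (\<sigma>, replicate ?n (Id D t))) ?Ys)"
    by (rule M.commutes_Gam[OF Q A B _ _ 1 2])
      (use \<psi>(2) PD.quot_composable'[OF c(1), of R'] in \<open>simp_all add: Col orth_operad_def\<close>)
  then have "commutes M A B \<psi> t ds X"
    unfolding orth_operad_def PD.quot_Gam[OF c(1), of R'] c(2) X by simp
  then show "Comp M (\<psi> t) (AA A t ds X) = Comp M (AA B t ds X) (tens_arr M (map \<psi> ds))"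
    unfolding commutes_def .
qed

lemma orth_operad_unary:
  "f \<in> hom D a b \<Longrightarrow> cong_class PD R' b [a] (id, [f]) \<in> Ops QD b [a]"
  unfolding orth_operad_def by (simp add: D.cat_operad_unary del: cat_operad_simps(2))

lemma orth_operad_Gam_unary:
  assumes "f \<in> hom D a b" "g \<in> hom D b c"
  shows "Gam QD c [b] [[a]] (cong_class PD R' c [b] (id, [g])) [cong_class PD R' b [a] (id, [f])] =
    cong_class PD R' c [a] (id, [Comp D g f])"
  using PD.quot_Gam[of c "[b]" "[[a]]" "(id, [g])" "[(id, [f])]" R'] assms
  by (simp add: orth_operad_def composable_def D.cat_operad_unary D.cat_Gam_unary del: cat_operad_simps)

lemma commutes_unary_Comp:
  assumes M: "symmetric_monoidal_category M" and A: "is_algebra M QD A" and B: "is_algebra M QD B"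
    and \<psi>: "\<And>d. d \<in> Obj D \<Longrightarrow> \<psi> d \<in> hom M (AO A d) (AO B d)"
    and f: "f \<in> hom D a b" and g: "g \<in> hom D b c"
    and cf: "commutes M A B \<psi> b [a] (cong_class PD R' b [a] (id, [f]))"
    and cg: "commutes M A B \<psi> c [b] (cong_class PD R' c [b] (id, [g]))"
  shows "commutes M A B \<psi> c [a] (cong_class PD R' c [a] (id, [Comp D g f]))"
proof -
  interpret M: symmetric_monoidal_category M by fact
  have "commutes M A B \<psi> c (concat [[a]]) (Gam QD c [b] [[a]] (cong_class PD R' c [b] (id, [g])) [cong_class PD R' b [a] (id, [f])])"
    by (rule M.commutes_Gam[OF colored_operad_orth[OF D.category_axioms] A B _ _ cg])
      (use \<psi> cf orth_operad_unary[OF f] orth_operad_unary[OF g] in \<open>auto simp: composable_def orth_operad_def\<close>)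
  then show ?thesis using orth_operad_Gam_unary[OF f g] by simp
qed

text \<open>Classes of unary operations compose like arrows of \<open>D\<close>, so an inverse arrow
  gives a two-sided operadic inverse.\<close>

lemma commutes_unary_inverse:
  assumes M: "symmetric_monoidal_category M" and A: "is_algebra M QD A" and B: "is_algebra M QD B"
    and \<psi>: "\<And>d. d \<in> Obj D \<Longrightarrow> \<psi> d \<in> hom M (AO A d) (AO B d)"
    and f: "f \<in> hom D a b" and g: "is_inverse D f g"
    and cf: "commutes M A B \<psi> b [a] (cong_class PD R' b [a] (id, [f]))"
  shows "commutes M A B \<psi> a [b] (cong_class PD R' a [b] (id, [g]))"
proof -
  interpret M: symmetric_monoidal_category M by fact
  have g': "g \<in> hom D b a" "Comp D g f = Id D a" "Comp D f g = Id D b"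
    using f g by (auto simp: is_inverse_def hom_def)
  have One: "One QD d = cong_class PD R' d [d] (id, [Id D d])" for d by (simp add: orth_operad_def)
  show ?thesis
    by (rule M.commutes_inverse[OF colored_operad_orth[OF D.category_axioms] A B _ orth_operad_unary[OF f] orth_operad_unary[OF g'(1)] _ _ cf])
      (use \<psi> orth_operad_Gam_unary[OF f g'(1)] orth_operad_Gam_unary[OF g'(1) f] g' One in \<open>simp_all add: orth_operad_def\<close>)
qed

end

section \<open>Full faithfulness of the pullback functor\<close>

lemma pullback_functor_full:
  fixes M :: "('o, 'm, 'z) moncat_scheme" and C CW :: "('u, 'u) cat"
  assumes "infinite (UNIV :: 'u set)" and M: "symmetric_monoidal_category M" and C: "orthogonal_category C orth"
    and W: "W \<subseteq> Arr C" and loc: "is_localization C W CW L"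
  defines "\<O>C \<equiv> orth_operad C orth"
    and "\<O>CW \<equiv> orth_operad CW (pushforward_orth CW L orth)"
    and "\<O>L \<equiv> orth_operad_map CW (pushforward_orth CW L orth) L"
  assumes A: "is_algebra M \<O>CW A" and B: "is_algebra M \<O>CW B"
    and \<phi>: "is_algebra_morphism M \<O>C (pullback_alg \<O>C \<O>L A) (pullback_alg \<O>C \<O>L B) \<phi>"
  shows "\<exists>\<psi>. is_algebra_morphism M \<O>CW A B \<psi> \<and> (\<lambda>c\<in>Obj C. \<psi> (FO L c)) = \<phi>"
proof -
  have D: "category CW" and L: "is_functor C CW L" using loc by (auto simp: is_localization_def)
  interpret orth_fun C orth CW "pushforward_orth CW L orth" L
    using pushforward_orthogonal[OF C L D] C by (simp add: orth_fun_def orth_fun_axioms_def)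
  interpret M: symmetric_monoidal_category M by fact
  have inj: "inj_on (FO L) (Obj C)"
    by (rule localization_inj_on_Obj[OF assms(1) C.category_axioms W loc])
  \<comment> \<open>For the constantly true predicate the generation lemma only keeps its claim
    about objects.\<close>
  have surj: "Obj CW \<subseteq> FO L ` Obj C"
    by (rule localization_generated(1)[OF C.category_axioms W loc, of "\<lambda>_. True"]) auto
  \<comment> \<open>Injectivity of \<open>L\<close> on objects gives \<open>\<psi>L\<close>;
    surjectivity lets \<open>\<psi>h\<close> reach every color.\<close>
  define \<psi> where "\<psi> = (\<lambda>d\<in>Obj CW. \<phi> (inv_into (Obj C) (FO L) d))"
  have \<psi>L: "\<psi> (FO L c) = \<phi> c" if "c \<in> Obj C" for c
    using that inj F_Obj by (simp add: \<psi>_def)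
  have AO: "AO (pullback_alg \<O>C \<O>L E) c = AO E (FO L c)" if "c \<in> Obj C" for c and E :: "(_, _, 'o, 'm) alg"
    using that by (simp add: pullback_alg_def \<O>C_def \<O>L_def orth_operad_def orth_operad_map_def)
  have \<psi>h: "\<psi> d \<in> hom M (AO A d) (AO B d)" if "d \<in> Obj CW" for d
  proof -
    obtain c where c: "c \<in> Obj C" "d = FO L c" using surj \<open>d \<in> Obj CW\<close> by auto
    have "\<phi> c \<in> hom M (AO (pullback_alg \<O>C \<O>L A) c) (AO (pullback_alg \<O>C \<O>L B) c)"
      using \<phi> c(1) by (simp add: is_algebra_morphism_def \<O>C_def orth_operad_def)
    then show ?thesis using AO[OF c(1)] \<psi>L[OF c(1)] c(2) by simp
  qed
  \<comment> \<open>\<open>MO_class\<close> evaluates \<open>\<O>L\<close> on a representative. The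
    pulled back action of a class is thus the action of the class of its image, and the claim
    becomes the morphism condition for \<open>\<phi>\<close>.\<close>
  have image: "commutes M A B \<psi> (FO L t) (map (FO L) cs) (cong_class PD R' (FO L t) (map (FO L) cs) (opF x))"
    if x: "x \<in> Ops PC t cs" for t cs x
  proof -
    let ?x = "cong_class PC R t cs x"
    have op: "?x \<in> Ops \<O>C t cs" using x by (simp add: \<O>C_def orth_operad_def)
    have AA: "AA (pullback_alg \<O>C \<O>L E) t cs ?x = AA E (FO L t) (map (FO L) cs) (cong_class PD R' (FO L t) (map (FO L) cs) (opF x))"
      for E :: "(_, _, 'o, 'm) alg"
      using op MO_class[OF x] unfolding \<O>L_def[symmetric] by (simp add: pullback_alg_def) (simp add: \<O>L_def orth_operad_map_def)
    have t: "t \<in> Obj C" "set cs \<subseteq> Obj C" using x by (auto simp: cat_operad_ops)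
    have "map \<psi> (map (FO L) cs) = map \<phi> cs" using t(2) \<psi>L by auto
    then show ?thesis
      using \<phi> op unfolding is_algebra_morphism_def commutes_def AA[symmetric] \<psi>L[OF t(1)]
      by (simp del: map_map)
  qed
  \<comment> \<open>The profile is read off \<open>Dom\<close> and \<open>Cod\<close>, since the
    generation lemma takes a predicate on bare arrows.\<close>
  define P where "P f \<longleftrightarrow> commutes M A B \<psi> (Cod CW f) [Dom CW f] (cong_class PD R' (Cod CW f) [Dom CW f] (id, [f]))" for f
  note AB = A[unfolded \<O>CW_def] B[unfolded \<O>CW_def]
  have P_L: "P (FA L f)" if "f \<in> Arr C" for f
  proof -
    have f: "f \<in> hom C (Dom C f) (Cod C f)" using that by (simp add: hom_def)
    have "(id, [f]) \<in> Ops PC (Cod C f) [Dom C f]" using f by (simp only: C.cat_operad_unary)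
    from image[OF this] show ?thesis using F_hom[OF f] by (simp add: P_def opF_def hom_def)
  qed
  have "Arr CW \<subseteq> Collect P"
  proof (rule localization_generated(2)[OF C.category_axioms W loc, where P = P, OF P_L])
    fix w v assume w: "w \<in> W" and v: "is_inverse CW (FA L w) v"
    have h: "FA L w \<in> hom CW (Dom CW (FA L w)) (Cod CW (FA L w))" using v by (simp add: is_inverse_def hom_def)
    have "P (FA L w)" using P_L w W by auto
    then show "P v" using commutes_unary_inverse[OF M AB \<psi>h h v] v unfolding P_def by (auto simp: is_inverse_def hom_def)
  next
    fix f g a b c assume h: "f \<in> hom CW a b" "g \<in> hom CW b c" and "P f" "P g"
    then show "P (Comp CW g f)"
      using commutes_unary_Comp[OF M AB \<psi>h h] D.Comp_in[OF h] unfolding P_def by (simp add: hom_def)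
  qed
  then have "is_algebra_morphism M \<O>CW A B \<psi>" unfolding \<O>CW_def
    by (intro is_algebra_morphism_if_commutes[OF M AB surj _ \<psi>h image]) (auto simp: \<psi>_def P_def hom_def)
  moreover have "(\<lambda>c\<in>Obj C. \<psi> (FO L c)) = \<phi>"
    by (rule extensionalityI[of _ "Obj C"]) (use \<phi> \<psi>L in \<open>auto simp: is_algebra_morphism_def \<O>C_def orth_operad_def\<close>)
  ultimately show ?thesis by blast
qed

theorem proposition4p4:
  fixes M :: "('o, 'm, 'z) moncat_scheme"
    and C CW :: "('u, 'u) cat"
    and orth :: "('u \<times> 'u) set"
    and W :: "'u set"
    and L :: "('u, 'u, 'u, 'u) fctr"
    and Lan \<eta> \<epsilon>
  defines "\<O>C \<equiv> orth_operad C orth"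
    and "\<O>CW \<equiv> orth_operad CW (pushforward_orth CW L orth)"
    and "\<O>L \<equiv> orth_operad_map CW (pushforward_orth CW L orth) L"
  assumes "infinite (UNIV :: 'u set)"
    and "closed_symmetric_monoidal_category M"
    and "bicomplete TYPE('u) M"
    and "orthogonal_category C orth"
    and "W \<subseteq> Arr C"
    and "is_localization C W CW L"
    and "adjunction (Alg M \<O>C) (Alg M \<O>CW) Lan (pullback_functor \<O>C \<O>L) \<eta> \<epsilon>"
  shows "natural_isomorphism (Alg M \<O>CW) (Alg M \<O>CW)
           (Lan \<circ>\<^sub>F pullback_functor \<O>C \<O>L) id_functor \<epsilon>"
proof (rule counit_natural_isomorphism[OF _ _ assms(10)])
  interpret M: closed_symmetric_monoidal_category M by fact
  interpret C: orthogonal_category C orth by fact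
  have M: "symmetric_monoidal_category M" ..
  have D: "category CW" using assms(9) by (simp add: is_localization_def)
  show "category (Alg M \<O>C)" "category (Alg M \<O>CW)"
    using M.category_Alg colored_operad_orth C.category_axioms D unfolding \<O>C_def \<O>CW_def by blast+
  have Col: "Col \<O>C = Obj C" "Col \<O>CW = Obj CW" by (simp_all add: \<O>C_def \<O>CW_def Col_orth_operad)
  have FA: "FA (pullback_functor \<O>C \<O>L) (A, B, \<psi>) =
    (pullback_alg \<O>C \<O>L A, pullback_alg \<O>C \<O>L B, \<lambda>c\<in>Obj C. \<psi> (FO L c))"
    and FO: "FO (pullback_functor \<O>C \<O>L) A = pullback_alg \<O>C \<O>L A" for A B \<psi>
    by (simp_all add: pullback_functor_def Col) (simp add: \<O>L_def orth_operad_map_def)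
  show "\<exists>f\<in>hom (Alg M \<O>CW) A B. FA (pullback_functor \<O>C \<O>L) f = g"
    if "A \<in> Obj (Alg M \<O>CW)" "B \<in> Obj (Alg M \<O>CW)"
      and g: "g \<in> hom (Alg M \<O>C) (FO (pullback_functor \<O>C \<O>L) A) (FO (pullback_functor \<O>C \<O>L) B)" for A B g
  proof -
    have AB: "is_algebra M \<O>CW A" "is_algebra M \<O>CW B" using that(1,2) by (simp_all add: Alg_def)
    obtain \<phi> where \<phi>: "g = (pullback_alg \<O>C \<O>L A, pullback_alg \<O>C \<O>L B, \<phi>)"
      "is_algebra_morphism M \<O>C (pullback_alg \<O>C \<O>L A) (pullback_alg \<O>C \<O>L B) \<phi>"
      using g by (cases g) (auto simp: M.AlgI FO)
    obtain \<psi> where "is_algebra_morphism M \<O>CW A B \<psi>" "(\<lambda>c\<in>Obj C. \<psi> (FO L c)) = \<phi>"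
      using pullback_functor_full[OF assms(4) M assms(7-9)] AB \<phi>(2) unfolding \<O>C_def \<O>CW_def \<O>L_def by blast
    then show ?thesis using AB by (intro bexI[of _ "(A, B, \<psi>)"]) (simp_all add: FA \<phi>(1) M.AlgI)
  qed
  have surj: "Obj CW \<subseteq> FO L ` Obj C"
    by (rule localization_generated(1)[OF C.category_axioms assms(8,9), of "\<lambda>_. True"]) auto
  show "f = f'" if f: "f \<in> hom (Alg M \<O>CW) A B" and f': "f' \<in> hom (Alg M \<O>CW) A B"
    and e: "FA (pullback_functor \<O>C \<O>L) f = FA (pullback_functor \<O>C \<O>L) f'" for A B f f'
  proof -
    obtain \<psi> \<psi>' where p: "f = (A, B, \<psi>)" "f' = (A, B, \<psi>')" "\<psi> \<in> extensional (Obj CW)" "\<psi>' \<in> extensional (Obj CW)"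
      using f f' by (cases f; cases f') (auto simp: M.AlgI is_algebra_morphism_def Col)
    have "\<psi> (FO L c) = \<psi>' (FO L c)" if "c \<in> Obj C" for c
      using e that unfolding p(1,2) FA by (auto dest: fun_cong[of _ _ c])
    \<comment> \<open>Every color has the form \<open>FO L c\<close>, and extensionality excludes
      differences elsewhere.\<close>
    then have "\<psi> = \<psi>'" using surj by (intro extensionalityI[OF p(3,4)]) auto
    then show ?thesis using p by simp
  qed
qed

end
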